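(* Let $k \leq n$ be positive integers and let $<$ be the lexicographic monomial order on $\mathbb{Q}[x_1,\dots,x_n]$. A Gröbner basis for $I_{n,k}$ with respect to $<$ is given by the variable powers $x_1^k, x_2^k, \dots, x_n^k$ together with the reverse Demazure characters $\kappa_{\gamma(S)^*}(x_n, x_{n-1}, \dots, x_1)$ for $S \subseteq [n-1]$ satisfying $|S| = n-k+1$. If $k < n$, this Gröbner basis is the reduced Gröbner basis for $I_{n,k}$ with respect to $<$.
   Context: $[m] = \{1,\dots,m\}$. For positive integers $k \le n$, $I_{n,k} \subseteq \mathbb{Q}[x_1,\dots,x_n]$ is the ideal $\langle x_1^k, \dots, x_n^k, e_n, e_{n-1}, \dots, e_{n-k+1}\rangle$, where $e_d = e_d(x_1,\dots,x_n)$ is the elementary symmetric polynomial of degree $d$. Lexicographic order: $x_1^{a_1}\cdots x_n^{a_n} < x_1^{b_1}\cdots x_n^{b_n}$ if for some $i$, $a_1=b_1,\dots,a_{i-1}=b_{i-1}$, $a_i<b_i$. A Gröbner basis is reduced if all leading coefficients are $1$ and no monomial of an element $g$ is divisible by the leading monomial of a different element. For $S = \{s_1<\cdots<s_m\} \subseteq [n]$, the skip composition $\gamma(S) = (\gamma_1,\dots,\gamma_n)$ has $\gamma_{s_j} = s_j - j + 1$ for $1 \le j \le m$ and $\gamma_i = 0$ for $i \notin S$. For a weak composition $\gamma = (\gamma_1,\dots,\gamma_n)$ (sequence of nonnegative integers), $\gamma^* = (\gamma_n,\dots,\gamma_1)$. Demazure characters $\kappa_\gamma(x_1,\dots,x_n)$: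 The augmented skyline diagram of $\gamma$ has cells $(i,r)$ with $1\le i\le n$ (column) and $0 \le r \le \gamma_i$ (row); row $0$ is the basement, and cell $(i,0)$ contains $n-i+1$. A semistandard skyline filling (SSK) of shape $\gamma$ is a filling of the non-basement cells by positive integers such that (1) entries weakly decrease going up each column, basement included; (2) there is no coinversion triple, basement cells included, where for $i<j$ a triple is either type A: $\gamma_i \ge \gamma_j$ and cells $a=(i,r), b=(j,r), c=(i,r-1)$, or type B: $\gamma_i<\gamma_j$ and cells $a=(j,r+1), b=(i,r), c=(j,r)$, and it is a coinversion triple if its entries satisfy $a \le b \le c$. Then $\kappa_\gamma(x_1,\dots,x_n) := \sum_{F} \prod_i x_i^{\#\text{ of } i\text{'s in the non-basement cells of } F}$, summed over all SSK $F$ of shape $\gamma^*$. (Equivalently: $\kappa_\gamma = x_1^{\gamma_1}\cdots x_n^{\gamma_n}$ if $\gamma_1\ge\cdots\ge\gamma_n$; and if $\gamma$ is obtained from $\gamma'$ by swapping entries $\gamma'_i>\gamma'_{i+1}$ then $\kappa_\gamma = \frac{x_i\kappa_{\gamma'} - s_i(x_i \kappa_{\gamma'})}{x_i-x_{i+1}}$, where $s_i$ interchanges $x_i$ and $x_{i+1}$.) The reverse Demazure character $\kappa_{\gamma}(x_n,\dots,x_1)$ is obtained by substituting $x_i \mapsto x_{n-i+1}$. *)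

theory Defs
  imports Complex_Main "HOL-Library.Poly_Mapping" "HOL-Library.FuncSet" "HOL-Algebra.Ideal"
begin

section \<open>The polynomial ring in the variables indexed by 1, ..., n over the rationals\<close>

text \<open>A monomial is its exponent vector \<open>nat \<Rightarrow>\<^sub>0 nat\<close>.\<close>

type_synonym rpoly = "(nat \<Rightarrow>\<^sub>0 nat) \<Rightarrow>\<^sub>0 rat"

definition X :: "nat \<Rightarrow> rpoly" where
  "X i = Poly_Mapping.single (Poly_Mapping.single i 1) 1"

definition poly_ring :: "nat \<Rightarrow> rpoly ring" where
  "poly_ring n =
     \<lparr>carrier = {p. \<forall>m\<in>Poly_Mapping.keys p. Poly_Mapping.keys m \<subseteq> {1..n}},
      monoid.mult = (*), one = 1, zero = 0, add = (+)\<rparr>"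

lemma cring_poly_ring: "cring (poly_ring n)"
proof (rule cringI)
  let ?R = "poly_ring n"
  have add_closed: "x + y \<in> carrier ?R" if xy: "x \<in> carrier ?R" "y \<in> carrier ?R" for x y
  proof -
    have "Poly_Mapping.keys m \<subseteq> {1..n}" if "m \<in> Poly_Mapping.keys (x + y)" for m
    proof -
      have "m \<in> Poly_Mapping.keys x \<or> m \<in> Poly_Mapping.keys y"
        using that Poly_Mapping.keys_add[of x y] by blast
      then show ?thesis using xy by (auto simp: poly_ring_def)
    qed
    then show ?thesis by (simp add: poly_ring_def)
  qed
  have mult_closed: "x * y \<in> carrier ?R" if xy: "x \<in> carrier ?R" "y \<in> carrier ?R" for x y
  proof -
    have "Poly_Mapping.keys m \<subseteq> {1..n}" if m: "m \<in> Poly_Mapping.keys (x * y)" for m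
    proof -
      obtain a b where ab: "m = a + b" "a \<in> Poly_Mapping.keys x" "b \<in> Poly_Mapping.keys y"
        using m keys_mult[of x y] by blast
      then have "Poly_Mapping.keys a \<subseteq> {1..n}" "Poly_Mapping.keys b \<subseteq> {1..n}"
        using xy by (auto simp: poly_ring_def)
      then show ?thesis using ab(1) Poly_Mapping.keys_add[of a b] by blast
    qed
    then show ?thesis by (simp add: poly_ring_def)
  qed
  have uminus_closed: "- x \<in> carrier ?R" if "x \<in> carrier ?R" for x
    using that by (simp add: poly_ring_def)
  have consts_closed: "0 \<in> carrier ?R" "1 \<in> carrier ?R"
    by (simp_all add: poly_ring_def)
  have ops: "x \<oplus>\<^bsub>?R\<^esub> y = x + y" "x \<otimes>\<^bsub>?R\<^esub> y = x * y" "\<zero>\<^bsub>?R\<^esub> = 0" "\<one>\<^bsub>?R\<^esub> = 1" for x y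
    by (simp_all add: poly_ring_def)
  show "abelian_group ?R"
  proof (rule abelian_groupI, unfold ops)
    show "\<exists>y\<in>carrier ?R. y + x = 0" if "x \<in> carrier ?R" for x
      using uminus_closed[OF that] by (intro bexI[of _ "- x"]) simp_all
  qed (assumption | rule add_closed consts_closed add.assoc add.commute add_0_left)+
  show "Group.comm_monoid ?R"
    by (rule comm_monoidI, unfold ops)
      (assumption | rule mult_closed consts_closed mult.assoc mult.commute mult_1_left)+
  show "(x \<oplus>\<^bsub>?R\<^esub> y) \<otimes>\<^bsub>?R\<^esub> z = x \<otimes>\<^bsub>?R\<^esub> z \<oplus>\<^bsub>?R\<^esub> y \<otimes>\<^bsub>?R\<^esub> z" for x y z
    unfolding ops by (rule distrib_right)
qed


section \<open>The ideal \<open>I\<^sub>n\<^sub>,\<^sub>k\<close>\<close>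

definition elem_sym :: "nat \<Rightarrow> nat \<Rightarrow> rpoly" where
  "elem_sym n d = (\<Sum>A | A \<subseteq> {1..n} \<and> card A = d. \<Prod>i\<in>A. X i)"

definition I_ideal :: "nat \<Rightarrow> nat \<Rightarrow> rpoly set" where
  "I_ideal n k = genideal (poly_ring n)
     ({X i ^ k | i. i \<in> {1..n}} \<union> {elem_sym n d | d. d \<in> {n - k + 1..n}})"


section \<open>Lexicographic Groebner bases\<close>

text \<open>
  The library's linear order on \<open>nat \<Rightarrow>\<^sub>0 nat\<close> is the lexicographic order in which
  the variable of smallest index is the largest:
\<close>

lemma monomial_less_iff_lex:
  fixes a b :: "nat \<Rightarrow>\<^sub>0 nat"
  shows "a < b \<longleftrightarrow> (\<exists>i. (\<forall>j<i. Poly_Mapping.lookup a j = Poly_Mapping.lookup b j) \<and>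
                        Poly_Mapping.lookup a i < Poly_Mapping.lookup b i)"
  by (auto simp: less_poly_mapping.rep_eq less_fun_def)

text \<open>The following two are meaningful for nonzero polynomials only.\<close>

definition lead_exp :: "rpoly \<Rightarrow> (nat \<Rightarrow>\<^sub>0 nat)" where
  "lead_exp p = Max (Poly_Mapping.keys p)"

definition lead_coef :: "rpoly \<Rightarrow> rat" where
  "lead_coef p = Poly_Mapping.lookup p (lead_exp p)"

definition lead_mon :: "rpoly \<Rightarrow> rpoly" where
  "lead_mon p = Poly_Mapping.single (lead_exp p) 1"

definition initial_ideal :: "nat \<Rightarrow> rpoly set \<Rightarrow> rpoly set" where
  "initial_ideal n J = genideal (poly_ring n) (lead_mon ` (J - {0}))"

definition groebner_basis :: "nat \<Rightarrow> rpoly set \<Rightarrow> rpoly set \<Rightarrow> bool" where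
  "groebner_basis n J G \<longleftrightarrow>
     finite G \<and> G \<subseteq> J - {0} \<and>
     initial_ideal n J = genideal (poly_ring n) (lead_mon ` G)"

definition mon_dvd :: "(nat \<Rightarrow>\<^sub>0 nat) \<Rightarrow> (nat \<Rightarrow>\<^sub>0 nat) \<Rightarrow> bool" where
  "mon_dvd a b \<longleftrightarrow> (\<exists>c. b = a + c)"

definition reduced_groebner_basis :: "nat \<Rightarrow> rpoly set \<Rightarrow> rpoly set \<Rightarrow> bool" where
  "reduced_groebner_basis n J G \<longleftrightarrow>
     groebner_basis n J G \<and>
     (\<forall>g\<in>G. lead_coef g = 1) \<and>
     (\<forall>g\<in>G. \<forall>h\<in>G. h \<noteq> g \<longrightarrow> (\<forall>m\<in>Poly_Mapping.keys g. \<not> mon_dvd (lead_exp h) m))"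


section \<open>Skip compositions\<close>

text \<open>
  A weak composition of length \<open>n\<close> is a function on \<open>nat\<close> of which only the values
  on \<open>{1..n}\<close> matter.
\<close>

definition rev_comp :: "nat \<Rightarrow> (nat \<Rightarrow> nat) \<Rightarrow> nat \<Rightarrow> nat" where
  "rev_comp n \<gamma> i = \<gamma> (n + 1 - i)"

text \<open>For \<open>i = s\<^sub>j\<close> the cardinality below is the rank \<open>j\<close> of \<open>i\<close> in \<open>S\<close>.\<close>

definition skip_comp :: "nat set \<Rightarrow> nat \<Rightarrow> nat" where
  "skip_comp S i = (if i \<in> S then i - card {s\<in>S. s \<le> i} + 1 else 0)"


section \<open>Semistandard skyline fillings and Demazure characters\<close>

text \<open>Cells are pairs (column, row); the augmented diagram includes the basement row 0.\<close>

definition aug_diagram :: "nat \<Rightarrow> (nat \<Rightarrow> nat) \<Rightarrow> (nat \<times> nat) set" where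
  "aug_diagram n \<gamma> = (SIGMA i:{1..n}. {0..\<gamma> i})"

definition skyline_cells :: "nat \<Rightarrow> (nat \<Rightarrow> nat) \<Rightarrow> (nat \<times> nat) set" where
  "skyline_cells n \<gamma> = (SIGMA i:{1..n}. {1..\<gamma> i})"

definition skyline_triples ::
    "nat \<Rightarrow> (nat \<Rightarrow> nat) \<Rightarrow> ((nat \<times> nat) \<times> (nat \<times> nat) \<times> (nat \<times> nat)) set" where
  "skyline_triples n \<gamma> =
     {(a, b, c). {a, b, c} \<subseteq> aug_diagram n \<gamma> \<and>
        (\<exists>i j r. i < j \<and>
           (\<gamma> i \<ge> \<gamma> j \<and> a = (i, Suc r) \<and> b = (j, Suc r) \<and> c = (i, r) \<or>
            \<gamma> i < \<gamma> j \<and> a = (j, Suc r) \<and> b = (i, r) \<and> c = (j, r)))}"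

text \<open>
  A filling is extended by the basement entries; outside the augmented diagram it has the
  default value of \<open>extensional\<close>, so that distinct functions are distinct fillings.
\<close>

definition SSK :: "nat \<Rightarrow> (nat \<Rightarrow> nat) \<Rightarrow> (nat \<times> nat \<Rightarrow> nat) set" where
  "SSK n \<gamma> = {F \<in> extensional (aug_diagram n \<gamma>).
     (\<forall>i\<in>{1..n}. F (i, 0) = n - i + 1) \<and>
     (\<forall>c\<in>skyline_cells n \<gamma>. F c \<ge> 1) \<and>
     (\<forall>i r. (i, Suc r) \<in> skyline_cells n \<gamma> \<longrightarrow> F (i, Suc r) \<le> F (i, r)) \<and>
     (\<forall>(a, b, c)\<in>skyline_triples n \<gamma>. \<not> (F a \<le> F b \<and> F b \<le> F c))}"

text \<open>All entries are at most \<open>n\<close>, so the sum defining a Demazure character is finite.\<close>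

lemma finite_SSK: "finite (SSK n \<gamma>)"
proof (rule finite_subset)
  show "SSK n \<gamma> \<subseteq> aug_diagram n \<gamma> \<rightarrow>\<^sub>E {..n}"
  proof
    fix F assume F: "F \<in> SSK n \<gamma>"
    have "F (i, r) \<le> n" if "i \<in> {1..n}" "r \<le> \<gamma> i" for i r
      using that(2)
    proof (induction r)
      case 0
      have "F (i, 0) = n - i + 1" using F that(1) by (simp add: SSK_def)
      moreover have "n - i + 1 \<le> n" using that(1) by (auto simp del: One_nat_def)
      ultimately show ?case by simp
    next
      case (Suc r)
      then have "(i, Suc r) \<in> skyline_cells n \<gamma>"
        using that(1) by (simp add: skyline_cells_def)
      then have "F (i, Suc r) \<le> F (i, r)" using F by (simp add: SSK_def)
      then show ?case using Suc by simp
    qed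
    moreover have "F \<in> extensional (aug_diagram n \<gamma>)"
      using F by (simp add: SSK_def)
    ultimately show "F \<in> aug_diagram n \<gamma> \<rightarrow>\<^sub>E {..n}"
      by (auto simp: PiE_def aug_diagram_def)
  qed
  show "finite (aug_diagram n \<gamma> \<rightarrow>\<^sub>E {..n})"
    by (intro finite_PiE) (auto simp: aug_diagram_def)
qed

text \<open>
  \<open>demazure n \<gamma> x\<close> is the Demazure character of \<open>\<gamma>\<close> with \<open>x 1, \<dots>, x n\<close> substituted
  for its \<open>n\<close> variables.
\<close>

definition demazure :: "nat \<Rightarrow> (nat \<Rightarrow> nat) \<Rightarrow> (nat \<Rightarrow> rpoly) \<Rightarrow> rpoly" where
  "demazure n \<gamma> x =
     (\<Sum>F\<in>SSK n (rev_comp n \<gamma>).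
        \<Prod>i\<in>{1..n}. x i ^ card {c \<in> skyline_cells n (rev_comp n \<gamma>). F c = i})"

definition rev_demazure :: "nat \<Rightarrow> (nat \<Rightarrow> nat) \<Rightarrow> rpoly" where
  "rev_demazure n \<gamma> = demazure n \<gamma> (\<lambda>i. X (n - i + 1))"

end

theory Submission
  imports Defs
    "HOL-Computational_Algebra.Formal_Power_Series"
    "Jordan_Normal_Form.Determinant"
    "HOL-Library.Function_Algebras"
    "HOL-Computational_Algebra.Polynomial"
begin

text \<open>
  Replacing entries \<open>i\<close> by \<open>n + 1 - i\<close> turns the fillings of a skip composition into systems of
  particles, the column heights, which fall as the entries are removed from the largest to the
  smallest. A crystal structure on the rows carrying two consecutive entries shows that the
  generating function satisfies the Demazure recursion in the bases of the columns; so does the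
  flagged Jacobi--Trudi determinant with entries \<open>h\<^sub>d(x\<^sub>s, \<dots>, x\<^sub>n)\<close>, whence both agree. For a skip
  composition with \<open>n - k + 1\<close> nonzero parts the identity
  \<open>\<Sum>\<^sub>c (-1)\<^sup>c e\<^sub>c h\<^sub>s\<^sub>-\<^sub>c(x\<^sub>s, \<dots>, x\<^sub>n) = 0\<close> is a relation between the columns of the matrix
  modulo \<open>e\<^sub>n\<^sub>-\<^sub>k\<^sub>+\<^sub>1, \<dots>, e\<^sub>n\<close>, so the determinant lies in the ideal. Its leading monomial is the
  skip monomial, and the entries in each row of a filling are distinct.

  Conversely, the ideal consists of top components of polynomials vanishing on the points of
  \<open>{0, \<dots>, k - 1}\<^sup>n\<close> whose coordinates take all \<open>k\<close> values. Hence the monomials that are not leading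
  monomials span the functions on these points, and there are at least as many of them as points.
  A greedy count shows that there are at most as many monomials divisible by no \<open>x\<^sub>i\<^sup>k\<close> and no
  skip monomial, which forces equality.
\<close>

section \<open>Particles falling through sets of rows\<close>

text \<open>A Demazure operator moves the base of one column and leaves the heights alone, and the
  intermediate families of columns need not come from skip compositions. This is why the generating
  function and the determinant are set up for arbitrary decreasing bases and weakly decreasing
  heights. Bases are raised until they fill an interval ending at \<open>n\<close>; there both sides
  are the same monomial.

  Moving a base from \<open>t + 1\<close> to \<open>t\<close> affects only the passes for these two
  entries, but in these passes every column competes for the same rows. The decisive fact is that
  transferring one bracketed row from the first pass to the second changes no position reached after
  both passes, whatever the other columns do.

  Complementing the entries makes every entry of column \<open>s\<close> at least \<open>s\<close>,
  so the filling that is constant on columns has the lexicographically largest weight.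

  For the converse no S-polynomials are formed. Points \<le> non-leading monomials \<le> monomials
  avoiding the proposed leading terms \<le> points: the chain closes because the greedy procedure
  and the number of distinct letters of a word have the same distribution.\<close>

text \<open>A particle at height \<open>h\<close> falls as long as the row it stands on belongs to \<open>P\<close>. A list of
  particles is processed in order of priority (rightmost skyline column first), every particle
  consuming the rows through which it falls.\<close>

primrec drop_to :: "nat set \<Rightarrow> nat \<Rightarrow> nat" where
  "drop_to P 0 = 0"
| "drop_to P (Suc h) = (if Suc h \<in> P then drop_to P h else Suc h)"

lemma drop_to_le: "drop_to P h \<le> h"
  by (induction h) auto

lemma drop_to_run: "{drop_to P h<..h} \<subseteq> P"
  by (induction h) (auto simp: less_Suc_eq_le le_Suc_eq)

lemma drop_to_stop: "drop_to P h = 0 \<or> drop_to P h \<notin> P"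
  by (induction h) auto

lemma drop_to_eqI:
  assumes "l \<le> h" "{l<..h} \<subseteq> P" "l = 0 \<or> l \<notin> P"
  shows "drop_to P h = l"
proof (rule ccontr)
  assume "drop_to P h \<noteq> l"
  then consider "drop_to P h < l" | "l < drop_to P h" by linarith
  then show False
  proof cases
    case 1
    then have "l \<in> P" using drop_to_run[of P h] assms(1) by auto
    then show False using 1 assms(3) by auto
  next
    case 2
    then have "drop_to P h \<in> P" using assms(2) drop_to_le[of P h] by auto
    then show False using 2 drop_to_stop[of P h] by auto
  qed
qed

primrec final :: "nat list \<Rightarrow> nat set \<Rightarrow> nat list" where
  "final [] P = []"
| "final (h # hs) P = drop_to P h # final hs (P - {drop_to P h<..h})"

text \<open>\<open>rest hs P = {}\<close> is the admissibility condition that every row of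
  \<open>P\<close> is used. The leftover set itself is recorded, since invariance under moves is
  proved one particle at a time and the leftover rows are passed on to the next particle.\<close>

primrec rest :: "nat list \<Rightarrow> nat set \<Rightarrow> nat set" where
  "rest [] P = P"
| "rest (h # hs) P = rest hs (P - {drop_to P h<..h})"

text \<open>The crystal lowering operator on the rows \<open>P\<close> of the entry \<open>v + 1\<close> and the rows \<open>Q\<close> of the
  entry \<open>v\<close>: row \<open>r\<close> moves from \<open>P\<close> to \<open>Q\<close>. The bracketing condition is imposed only inside
  the connected component of \<open>P \<union> Q\<close> around \<open>r\<close>, since the global condition is not
  inherited by the rows left over after a particle has fallen.\<close>

definition movable :: "nat \<Rightarrow> nat set \<Rightarrow> nat set \<Rightarrow> bool" where
  "movable r P Q \<longleftrightarrow> 1 \<le> r \<and> r \<in> P \<and> r \<notin> Q \<and>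
     (\<forall>s\<in>{1..r}. {s..<r} \<subseteq> P \<union> Q \<longrightarrow> card (P \<inter> {s..<r}) \<le> card (Q \<inter> {s..<r})) \<and>
     (\<forall>t>r. {r<..t} \<subseteq> P \<union> Q \<longrightarrow> card (Q \<inter> {r<..t}) \<le> card (P \<inter> {r<..t}))"

definition mv :: "nat set \<times> nat set \<Rightarrow> nat set \<times> nat set \<Rightarrow> bool" where
  "mv V W \<longleftrightarrow> (\<exists>r. movable r (fst V) (snd V) \<and> W = (fst V - {r}, insert r (snd V)))"

text \<open>The rows of the block move one after the other, lowest first: when \<open>r\<close> is
  due, the rows of the block below it are already in \<open>Q\<close> and those above it still in
  \<open>P\<close>. The two empty rows bounding the block confine every interval of the bracketing
  condition to the block.\<close>

lemma mv_block:
  assumes "{p..<q} \<subseteq> P" "{p..<q} \<inter> Q = {}" "1 \<le> p" "p \<le> q"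
    "p = 1 \<or> p - 1 \<notin> P \<union> Q" "q \<notin> P \<union> Q"
  shows "mv\<^sup>*\<^sup>* (P, Q) (P - {p..<q}, Q \<union> {p..<q})"
proof -
  have "q' \<le> q \<Longrightarrow> mv\<^sup>*\<^sup>* (P, Q) (P - {p..<q'}, Q \<union> {p..<q'})" if "p \<le> q'" for q'
    using that
  proof (induction q' rule: dec_induct)
    case base
    then show ?case by simp
  next
    case (step r)
    let ?P = "P - {p..<r}" and ?Q = "Q \<union> {p..<r}"
    have "movable r ?P ?Q"
      unfolding movable_def
    proof (intro conjI ballI allI impI)
      show "1 \<le> r" using assms(3) step by simp
      have "r \<in> {p..<q}" using step by auto
      then show "r \<in> ?P" "r \<notin> ?Q" using assms(1,2) by auto
    next
      fix s assume s: "s \<in> {1..r}" "{s..<r} \<subseteq> ?P \<union> ?Q"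
      have "p \<le> s"
      proof (rule ccontr)
        assume "\<not> p \<le> s"
        then have "p - 1 \<in> {s..<r}" using step by auto
        then have "p - 1 \<in> P \<union> Q" using s(2) \<open>\<not> p \<le> s\<close> s(1) by auto
        then show False using assms(5) \<open>\<not> p \<le> s\<close> s(1) by auto
      qed
      then have "?P \<inter> {s..<r} = {}" by auto
      then show "card (?P \<inter> {s..<r}) \<le> card (?Q \<inter> {s..<r})" by simp
    next
      fix t assume t: "r < t" "{r<..t} \<subseteq> ?P \<union> ?Q"
      have "t < q"
      proof (rule ccontr)
        assume "\<not> t < q"
        then have "q \<in> {r<..t}" using step by auto
        then have "q \<in> ?P \<union> ?Q" using t(2) by blast
        then have "q \<in> P \<union> Q" using step by auto
        then show False using assms(6) by simp
      qed
      then have "{r<..t} \<subseteq> {p..<q}" using step by auto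
      then have "?Q \<inter> {r<..t} = {}" using assms(2) by auto
      then show "card (?Q \<inter> {r<..t}) \<le> card (?P \<inter> {r<..t})" by simp
    qed
    then have "mv (?P, ?Q) (?P - {r}, insert r ?Q)"
      unfolding mv_def by (intro exI[of _ r]) simp
    moreover have "?P - {r} = P - {p..<Suc r}" "insert r ?Q = Q \<union> {p..<Suc r}"
      using step by auto
    moreover have "mv\<^sup>*\<^sup>* (P, Q) (?P, ?Q)" using step by simp
    ultimately show ?case by (metis rtranclp.rtrancl_into_rtrancl)
  qed
  then show ?thesis using assms(4) by blast
qed

lemma mv_imp_equivclp: "mv V W \<Longrightarrow> equivclp mv V W"
  by auto

lemma mv_rtranclp_imp_equivclp: "mv\<^sup>*\<^sup>* V W \<Longrightarrow> equivclp mv V W"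
  by (induction rule: rtranclp_induct) (auto intro: equivclp_trans)

text \<open>If the particle does not use row \<open>r\<close>, the move commutes with its fall. If
  it does, it now stops at \<open>r\<close> in the first pass, but bracketing forces the rows just
  below \<open>r\<close> into \<open>Q\<close>, so the second pass makes up for the loss. The
  leftover pairs then differ by a whole block moved in the opposite direction, which is why the
  statement is about the equivalence closure of \<open>mv\<close>.\<close>

lemma mv_particle:
  fixes h :: nat
  assumes "movable r P Q"
  defines "P' \<equiv> P - {r}" and "Q' \<equiv> insert r Q"
  defines "a \<equiv> drop_to P h" and "a' \<equiv> drop_to P' h"
  defines "b \<equiv> drop_to Q a" and "b' \<equiv> drop_to Q' a'"
  shows "b' = b \<and> equivclp mv (P - {a<..h}, Q - {b<..a}) (P' - {a'<..h}, Q' - {b'<..a'})"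
proof -
  have r: "1 \<le> r" "r \<in> P" "r \<notin> Q" using assms(1) by (auto simp: movable_def)
  have below: "card (P \<inter> {s..<r}) \<le> card (Q \<inter> {s..<r})" if "1 \<le> s" "s \<le> r" "{s..<r} \<subseteq> P \<union> Q" for s
    using assms(1) that by (auto simp: movable_def)
  have above: "card (Q \<inter> {r<..t}) \<le> card (P \<inter> {r<..t})" if "r < t" "{r<..t} \<subseteq> P \<union> Q" for t
    using assms(1) that by (auto simp: movable_def)
  have a: "a \<le> h" "{a<..h} \<subseteq> P" "a = 0 \<or> a \<notin> P"
    unfolding a_def by (rule drop_to_le drop_to_run drop_to_stop)+
  have b: "b \<le> a" "{b<..a} \<subseteq> Q" "b = 0 \<or> b \<notin> Q"
    unfolding b_def by (rule drop_to_le drop_to_run drop_to_stop)+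
  \<comment> \<open>The first pass stopped at \<open>a\<close>, so \<open>a\<close> is not in
    \<open>P\<close>; if it lies in \<open>Q\<close>, the second pass consumes it. This empty row
    separates the leftovers above and below, and makes the local form of the bracketing condition
    hereditary.\<close>
  have gap: "a = 0 \<or> a \<notin> (P - {a<..h}) \<union> (Q - {b<..a})" using a b by auto
  consider "a < r" "r \<le> h" | "h < r" | "r \<le> a" by linarith
  then show ?thesis
  proof cases
    case 1
    have a'eq: "a' = r"
      unfolding a'_def P'_def using 1 a by (intro drop_to_eqI) auto
    have full: "{Suc a..<r} \<subseteq> P" using a 1 by auto
    \<comment> \<open>All rows strictly between \<open>a\<close> and \<open>r\<close> lie in
      \<open>P\<close>, so the condition below \<open>r\<close> demands as many rows of
      \<open>Q\<close> there, that is, all of them.\<close>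
    have "card (P \<inter> {Suc a..<r}) \<le> card (Q \<inter> {Suc a..<r})"
      using below[of "Suc a"] full 1 by auto
    moreover have "P \<inter> {Suc a..<r} = {Suc a..<r}" using full by auto
    ultimately have "{Suc a..<r} = Q \<inter> {Suc a..<r}"
      by (metis card_seteq finite_atLeastLessThan inf_le2)
    then have fullQ: "{Suc a..<r} \<subseteq> Q" by auto
    have b'eq: "b' = b"
      unfolding b'_def a'eq Q'_def
    proof (rule drop_to_eqI)
      show "b \<le> r" using b 1 by simp
      show "{b<..r} \<subseteq> insert r Q"
      proof
        fix i assume i: "i \<in> {b<..r}"
        show "i \<in> insert r Q"
        proof (cases "i \<le> a")
          case True
          then have "i \<in> {b<..a}" using i by auto
          then show ?thesis using b(2) by blast
        next
          case False
          then have "i = r \<or> i \<in> {Suc a..<r}" using i by auto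
          then show ?thesis using fullQ by auto
        qed
      qed
      show "b = 0 \<or> b \<notin> insert r Q" using b 1 by auto
    qed
    let ?P = "P' - {r<..h}" and ?Q = "Q' - {b<..r}"
    have "mv\<^sup>*\<^sup>* (?P, ?Q) (?P - {Suc a..<r}, ?Q \<union> {Suc a..<r})"
    proof (rule mv_block)
      show "{Suc a..<r} \<subseteq> ?P" using full by (auto simp: P'_def)
      show "{Suc a..<r} \<inter> ?Q = {}" using b by auto
      show "Suc a = 1 \<or> Suc a - 1 \<notin> ?P \<union> ?Q"
        using gap a b 1 by (auto simp: P'_def Q'_def)
      show "r \<notin> ?P \<union> ?Q" using b 1 by (auto simp: P'_def)
    qed (use 1 in auto)
    moreover have "?P - {Suc a..<r} = P - {a<..h}"
      using 1 by (auto simp: P'_def)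
    moreover have "?Q \<union> {Suc a..<r} = Q - {b<..a}"
      using 1 fullQ b r by (auto simp: Q'_def)
    ultimately have "mv\<^sup>*\<^sup>* (P' - {a'<..h}, Q' - {b'<..a'}) (P - {a<..h}, Q - {b<..a})"
      by (simp add: a'eq b'eq)
    then show ?thesis
      using b'eq by (metis equivclp_sym mv_rtranclp_imp_equivclp)
  next
    case 2
    have a'eq: "a' = a"
      unfolding a'_def P'_def using 2 a by (intro drop_to_eqI) auto
    have b'eq: "b' = b"
      unfolding b'_def a'eq Q'_def using 2 a b by (intro drop_to_eqI) auto
    let ?P = "P - {a<..h}" and ?Q = "Q - {b<..a}"
    have "movable r ?P ?Q"
      unfolding movable_def
    proof (intro conjI ballI allI impI)
      show "1 \<le> r" "r \<in> ?P" "r \<notin> ?Q" using r 2 by auto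
    next
      fix s assume s: "s \<in> {1..r}" "{s..<r} \<subseteq> ?P \<union> ?Q"
      have "a < s"
      proof (rule ccontr)
        assume "\<not> a < s"
        then have "a \<in> {s..<r}" "a \<noteq> 0" using 2 a s by auto
        then show False using gap s(2) by blast
      qed
      then have "?Q \<inter> {s..<r} = Q \<inter> {s..<r}" by auto
      moreover have "card (?P \<inter> {s..<r}) \<le> card (P \<inter> {s..<r})"
        by (rule card_mono) auto
      moreover have "card (P \<inter> {s..<r}) \<le> card (Q \<inter> {s..<r})"
        using below[of s] s by auto
      ultimately show "card (?P \<inter> {s..<r}) \<le> card (?Q \<inter> {s..<r})" by simp
    next
      fix t assume t: "r < t" "{r<..t} \<subseteq> ?P \<union> ?Q"
      have "?Q \<inter> {r<..t} = Q \<inter> {r<..t}" "?P \<inter> {r<..t} = P \<inter> {r<..t}"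
        using 2 a b by auto
      then show "card (?Q \<inter> {r<..t}) \<le> card (?P \<inter> {r<..t})"
        using above[of t] t by auto
    qed
    then have "mv (?P, ?Q) (?P - {r}, insert r ?Q)"
      unfolding mv_def by (intro exI[of _ r]) simp
    moreover have "?P - {r} = P' - {a<..h}" "insert r ?Q = Q' - {b<..a}"
      using 2 a by (auto simp: P'_def Q'_def)
    ultimately show ?thesis using b'eq a'eq by (simp add: mv_imp_equivclp)
  next
    case 3
    then have ra: "r < a" using a r by (cases "r = a") auto
    have a'eq: "a' = a"
      unfolding a'_def P'_def using 3 a by (intro drop_to_eqI) auto
    \<comment> \<open>Otherwise the rows from \<open>r + 1\<close> to \<open>a\<close> all lie in
      \<open>Q\<close>, and the condition above \<open>r\<close> puts them into \<open>P\<close> as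
      well, against \<open>a \<notin> P\<close>.\<close>
    have rb: "r < b"
    proof (rule ccontr)
      assume "\<not> r < b"
      then have sub: "{r<..a} \<subseteq> Q" using b by auto
      then have "Q \<inter> {r<..a} = {r<..a}" "{r<..a} \<subseteq> P \<union> Q" by auto
      then have "card {r<..a} \<le> card (P \<inter> {r<..a})"
        using above[of a] ra by simp
      then have "P \<inter> {r<..a} = {r<..a}"
        by (metis card_seteq finite_greaterThanAtMost inf_le2)
      then have "{r<..a} \<subseteq> P" by blast
      then have "a \<in> P" using ra by auto
      then show False using a ra by auto
    qed
    have b'eq: "b' = b"
      unfolding b'_def a'eq Q'_def using rb b by (intro drop_to_eqI) auto
    let ?P = "P - {a<..h}" and ?Q = "Q - {b<..a}"
    have "movable r ?P ?Q"
      unfolding movable_def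
    proof (intro conjI ballI allI impI)
      show "1 \<le> r" "r \<in> ?P" "r \<notin> ?Q" using r 3 by auto
    next
      fix s assume s: "s \<in> {1..r}" "{s..<r} \<subseteq> ?P \<union> ?Q"
      have "?Q \<inter> {s..<r} = Q \<inter> {s..<r}" "?P \<inter> {s..<r} = P \<inter> {s..<r}"
        using rb ra by auto
      then show "card (?P \<inter> {s..<r}) \<le> card (?Q \<inter> {s..<r})"
        using below[of s] s by auto
    next
      fix t assume t: "r < t" "{r<..t} \<subseteq> ?P \<union> ?Q"
      have "t < a"
      proof (rule ccontr)
        assume "\<not> t < a"
        then have "a \<in> {r<..t}" "a \<noteq> 0" using ra by auto
        then show False using gap t(2) by blast
      qed
      then have "?P \<inter> {r<..t} = P \<inter> {r<..t}" by auto
      moreover have "card (?Q \<inter> {r<..t}) \<le> card (Q \<inter> {r<..t})"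
        by (rule card_mono) auto
      moreover have "card (Q \<inter> {r<..t}) \<le> card (P \<inter> {r<..t})"
        using above[of t] t by auto
      ultimately show "card (?Q \<inter> {r<..t}) \<le> card (?P \<inter> {r<..t})" by simp
    qed
    then have "mv (?P, ?Q) (?P - {r}, insert r ?Q)"
      unfolding mv_def by (intro exI[of _ r]) simp
    moreover have "?P - {r} = P' - {a<..h}" "insert r ?Q = Q' - {b<..a}"
      using rb ra by (auto simp: P'_def Q'_def)
    ultimately show ?thesis using b'eq a'eq by (simp add: mv_imp_equivclp)
  qed
qed

lemma equivclp_particle:
  assumes "equivclp mv (P, Q) (P', Q')"
  shows "drop_to Q (drop_to P h) = drop_to Q' (drop_to P' h) \<and>
    equivclp mv (P - {drop_to P h<..h}, Q - {drop_to Q (drop_to P h)<..drop_to P h})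
      (P' - {drop_to P' h<..h}, Q' - {drop_to Q' (drop_to P' h)<..drop_to P' h})"
  using assms
proof (induction "(P', Q')" arbitrary: P' Q' rule: equivclp_induct)
  case base
  then show ?case by simp
next
  case (step Y P'' Q'')
  obtain P1 Q1 where Y: "Y = (P1, Q1)" by (cases Y)
  note IH = step(3)[OF Y]
  from step(2) Y consider "mv (P1, Q1) (P'', Q'')" | "mv (P'', Q'') (P1, Q1)" by auto
  then show ?case
  proof cases
    case 1
    then obtain r where r: "movable r P1 Q1" "P'' = P1 - {r}" "Q'' = insert r Q1"
      by (auto simp: mv_def)
    note p = mv_particle[OF r(1), of h, folded r(2,3)]
    show ?thesis
      using equivclp_trans[OF conjunct2[OF IH] conjunct2[OF p]] conjunct1[OF IH] conjunct1[OF p]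
      by simp
  next
    case 2
    then obtain r where r: "movable r P'' Q''" "P1 = P'' - {r}" "Q1 = insert r Q''"
      by (auto simp: mv_def)
    note p = mv_particle[OF r(1), of h, folded r(2,3)]
    show ?thesis
      using equivclp_trans[OF conjunct2[OF IH] equivclp_sym[OF conjunct2[OF p]]]
        conjunct1[OF IH] conjunct1[OF p]
      by simp
  qed
qed

text \<open>The order of events is changed: each particle completes both falls before the next one
  starts. This gives the same result, because its second fall depends only on its own stopping place
  and on the rows of \<open>Q\<close> left by its predecessors.\<close>

lemma equivclp_final:
  assumes "equivclp mv (P, Q) (P', Q')"
  shows "final (final hs P) Q = final (final hs P') Q' \<and>
    equivclp mv (rest hs P, rest (final hs P) Q) (rest hs P', rest (final hs P') Q')"
  using assms
proof (induction hs arbitrary: P Q P' Q')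
  case Nil
  then show ?case by simp
next
  case (Cons h hs)
  from equivclp_particle[OF Cons.prems, of h]
  have 1: "drop_to Q (drop_to P h) = drop_to Q' (drop_to P' h)"
    and 2: "equivclp mv (P - {drop_to P h<..h}, Q - {drop_to Q (drop_to P h)<..drop_to P h})
      (P' - {drop_to P' h<..h}, Q' - {drop_to Q' (drop_to P' h)<..drop_to P' h})" by auto
  from Cons.IH[OF 2] 1 show ?case by simp
qed

text \<open>Applied to the leftover rows: as the union is invariant, nothing is left in either pass
  before the moves exactly if nothing is left after them.\<close>

lemma equivclp_mv_Un:
  assumes "equivclp mv V W"
  shows "fst V \<union> snd V = fst W \<union> snd W"
  using assms by (induction rule: equivclp_induct) (auto simp: mv_def movable_def)

section \<open>Crystal strings of pairs of row sets\<close>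

text \<open>The lattice path of the bracket word: a row only in the first set is a step up, a row
  only in the second a step down, and all other rows are flat.\<close>

definition phi :: "nat set \<times> nat set \<Rightarrow> nat \<Rightarrow> int" where
  "phi V t = int (card (fst V \<inter> {1..t})) - int (card (snd V \<inter> {1..t}))"

lemma phi_0 [simp]: "phi V 0 = 0"
  by (simp add: phi_def)

lemma card_Int_atMost_Suc:
  "card (A \<inter> {1..Suc t}) = card (A \<inter> {1..t}) + (if Suc t \<in> A then 1 else 0)"
proof -
  have "A \<inter> {1..Suc t} = (if Suc t \<in> A then insert (Suc t) (A \<inter> {1..t}) else A \<inter> {1..t})"
    by (auto simp: le_Suc_eq)
  then show ?thesis by simp
qed

lemma phi_Suc:
  "phi V (Suc t) = phi V t + (if Suc t \<in> fst V then 1 else 0) - (if Suc t \<in> snd V then 1 else 0)"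
  unfolding phi_def by (simp add: card_Int_atMost_Suc del: One_nat_def)

lemma phi_remove_insert:
  assumes "r \<in> fst V" "r \<notin> snd V" "1 \<le> r"
  shows "phi (fst V - {r}, insert r (snd V)) t = (if t < r then phi V t else phi V t - 2)"
proof (induction t)
  case 0
  then show ?case using assms(3) by simp
next
  case (Suc t)
  then show ?case using assms by (cases "Suc t = r") (auto simp: phi_Suc)
qed

text \<open>The step that leaves the last minimum of the path. Its counterpart \<open>hi_row\<close>
  is the step that reaches the first minimum; these are the rows on which the crystal operators
  act.\<close>

definition lo_row :: "nat \<Rightarrow> nat set \<times> nat set \<Rightarrow> nat \<Rightarrow> bool" where
  "lo_row N V r \<longleftrightarrow> 1 \<le> r \<and> r \<le> N \<and>
     (\<forall>t<r. phi V (r - 1) \<le> phi V t) \<and> (\<forall>t. r \<le> t \<and> t \<le> N \<longrightarrow> phi V (r - 1) < phi V t)"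

definition hi_row :: "nat \<Rightarrow> nat set \<times> nat set \<Rightarrow> nat \<Rightarrow> bool" where
  "hi_row N V r \<longleftrightarrow> 1 \<le> r \<and> r \<le> N \<and>
     (\<forall>t<r. phi V r < phi V t) \<and> (\<forall>t. r \<le> t \<and> t \<le> N \<longrightarrow> phi V r \<le> phi V t)"

text \<open>The path starts at \<open>0\<close>, so this is its deepest descent, which equals the
  number of times \<open>upper\<close> can be applied.\<close>

definition depth :: "nat \<Rightarrow> nat set \<times> nat set \<Rightarrow> int" where
  "depth N V = - Min (phi V ` {0..N})"

lemma depth_ge: "t \<le> N \<Longrightarrow> - depth N V \<le> phi V t"
  unfolding depth_def minus_minus by (rule Min_le) auto

lemma depth_eqI:
  assumes "\<And>t. t \<le> N \<Longrightarrow> - d \<le> phi V t" "t \<le> N" "phi V t = - d"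
  shows "depth N V = d"
proof -
  have "Min (phi V ` {0..N}) = - d"
    using assms by (intro Min_eqI) (auto intro: rev_image_eqI)
  then show ?thesis by (simp add: depth_def)
qed

lemma depth_nonneg: "0 \<le> depth N V"
  using depth_ge[of 0 N V] by simp

lemma depth_attained: "\<exists>t\<le>N. phi V t = - depth N V"
proof -
  have "Min (phi V ` {0..N}) \<in> phi V ` {0..N}" by (intro Min_in) auto
  then obtain t where "t \<in> {0..N}" "Min (phi V ` {0..N}) = phi V t" by (rule imageE)
  then show ?thesis by (intro exI[of _ t]) (simp add: depth_def)
qed

lemma lo_row_unique: "lo_row N V r \<Longrightarrow> lo_row N V s \<Longrightarrow> r = s"
proof (induction r s rule: linorder_wlog)
  case (le r s)
  show ?case
  proof (rule ccontr)
    assume "r \<noteq> s"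
    then have "r \<le> s - 1" "s - 1 \<le> N" "r - 1 < s" using le unfolding lo_row_def by auto
    then have "phi V (r - 1) < phi V (s - 1)" "phi V (s - 1) \<le> phi V (r - 1)"
      using le unfolding lo_row_def by blast+
    then show False by simp
  qed
qed auto

lemma hi_row_unique: "hi_row N V r \<Longrightarrow> hi_row N V s \<Longrightarrow> r = s"
proof (induction r s rule: linorder_wlog)
  case (le r s)
  show ?case
  proof (rule ccontr)
    assume "r \<noteq> s"
    then have "phi V r \<le> phi V s" "phi V s < phi V r"
      using le unfolding hi_row_def by auto
    then show False by simp
  qed
qed auto

lemma lo_row_exists:
  assumes "phi V N > - depth N V"
  shows "\<exists>r. lo_row N V r"
proof -
  let ?T = "{t \<in> {0..N}. phi V t = - depth N V}"
  have ne: "?T \<noteq> {}" using depth_attained[of N V] by auto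
  define t where "t = Max ?T"
  have t: "t \<in> ?T" unfolding t_def using ne by (intro Max_in) auto
  have max: "s \<le> t" if "s \<in> ?T" for s unfolding t_def using that by (intro Max_ge) auto
  have "t < N" using t assms by (cases "t = N") auto
  moreover have "phi V t < phi V s" if "Suc t \<le> s" "s \<le> N" for s
    using max[of s] depth_ge[of s N V] that t by force
  ultimately have "lo_row N V (Suc t)"
    unfolding lo_row_def using t depth_ge[of _ N V] by auto
  then show ?thesis by blast
qed

lemma hi_row_exists:
  assumes "depth N V > 0"
  shows "\<exists>r. hi_row N V r"
proof -
  let ?T = "{t \<in> {0..N}. phi V t = - depth N V}"
  have ne: "?T \<noteq> {}" using depth_attained[of N V] by auto
  define t where "t = Min ?T"
  have t: "t \<in> ?T" unfolding t_def using ne by (intro Min_in) auto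
  have min: "t \<le> s" if "s \<in> ?T" for s unfolding t_def using that by (intro Min_le) auto
  have "t \<noteq> 0"
  proof
    assume "t = 0"
    then show False using t assms by simp
  qed
  moreover have "phi V t < phi V s" if "s < t" for s
    using min[of s] depth_ge[of s N V] that t by force
  ultimately have "hi_row N V t"
    unfolding hi_row_def using t depth_ge[of _ N V] by auto
  then show ?thesis by blast
qed

lemma lo_row_mem:
  assumes "lo_row N V r"
  shows "r \<in> fst V" "r \<notin> snd V" "phi V r = phi V (r - 1) + 1"
proof -
  obtain t where r: "r = Suc t" using assms by (cases r) (auto simp: lo_row_def)
  have "phi V t < phi V (Suc t)" using assms by (auto simp: lo_row_def r)
  then show "r \<in> fst V" "r \<notin> snd V" "phi V r = phi V (r - 1) + 1"
    using phi_Suc[of V t] r by (auto split: if_splits)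
qed

lemma hi_row_mem:
  assumes "hi_row N V r"
  shows "r \<in> snd V" "r \<notin> fst V" "phi V r = phi V (r - 1) - 1"
proof -
  obtain t where r: "r = Suc t" using assms by (cases r) (auto simp: hi_row_def)
  have "phi V (Suc t) < phi V t" using assms by (auto simp: hi_row_def r)
  then show "r \<in> snd V" "r \<notin> fst V" "phi V r = phi V (r - 1) - 1"
    using phi_Suc[of V t] r by (auto split: if_splits)
qed

lemma card_Int_segment:
  fixes s t :: nat
  assumes "s \<le> t"
  shows "int (card (A \<inter> {s<..t})) = int (card (A \<inter> {1..t})) - int (card (A \<inter> {1..s}))"
proof -
  have "A \<inter> {1..t} = (A \<inter> {1..s}) \<union> (A \<inter> {s<..t})" using assms by auto
  moreover have "card \<dots> = card (A \<inter> {1..s}) + card (A \<inter> {s<..t})"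
    by (intro card_Un_disjoint) auto
  ultimately show ?thesis by simp
qed

lemma phi_beyond:
  assumes "fst V \<subseteq> {1..N}" "snd V \<subseteq> {1..N}" "N \<le> t"
  shows "phi V t = phi V N"
proof -
  have "A \<inter> {1..t} = A \<inter> {1..N}" if "A \<subseteq> {1..N}" for A using that assms(3) by auto
  then show ?thesis using assms by (simp add: phi_def)
qed

definition lower :: "nat \<Rightarrow> nat set \<times> nat set \<Rightarrow> nat set \<times> nat set" where
  "lower N V = (let r = (THE r. lo_row N V r) in (fst V - {r}, insert r (snd V)))"

definition upper :: "nat \<Rightarrow> nat set \<times> nat set \<Rightarrow> nat set \<times> nat set" where
  "upper N V = (let r = (THE r. hi_row N V r) in (insert r (fst V), snd V - {r}))"

lemma lower_eq: "lo_row N V r \<Longrightarrow> lower N V = (fst V - {r}, insert r (snd V))"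
  unfolding lower_def using lo_row_unique by (simp add: the_equality[of "lo_row N V" r])

lemma upper_eq: "hi_row N V r \<Longrightarrow> upper N V = (insert r (fst V), snd V - {r})"
  unfolding upper_def using hi_row_unique by (simp add: the_equality[of "hi_row N V" r])

text \<open>The move shifts the path down by two from row \<open>r\<close> on. Hence the minimum
  drops by one and is first reached at \<open>r\<close>, which is where \<open>upper\<close>
  acts.\<close>

lemma lower_props:
  assumes "lo_row N V r"
  shows "hi_row N (lower N V) r" "depth N (lower N V) = depth N V + 1"
    "phi (lower N V) N = phi V N - 2" "upper N (lower N V) = V"
proof -
  have r: "1 \<le> r" "r \<le> N" using assms by (auto simp: lo_row_def)
  note mem = lo_row_mem[OF assms]
  have phi': "phi (lower N V) t = (if t < r then phi V t else phi V t - 2)" for t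
    unfolding lower_eq[OF assms] using mem r by (intro phi_remove_insert) auto
  have bnd: "phi V (r - 1) \<le> phi V t" if "t < r" for t
    using assms that by (auto simp: lo_row_def)
  have bnd2: "phi V (r - 1) < phi V t" if "r \<le> t" "t \<le> N" for t
    using assms that by (auto simp: lo_row_def)
  show hi: "hi_row N (lower N V) r"
    unfolding hi_row_def phi' using r mem(3) bnd bnd2 by fastforce
  have "depth N V = - phi V (r - 1)"
  proof (rule depth_eqI)
    show "- (- phi V (r - 1)) \<le> phi V t" if "t \<le> N" for t
      using bnd[of t] bnd2[of t] that by (cases "t < r") auto
    show "r - 1 \<le> N" using r by simp
  qed simp
  moreover have "depth N (lower N V) = - phi (lower N V) r"
  proof (rule depth_eqI)
    show "- (- phi (lower N V) r) \<le> phi (lower N V) t" if "t \<le> N" for t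
      using hi that by (cases "t < r") (auto simp: hi_row_def)
    show "r \<le> N" using r by simp
  qed simp
  ultimately show "depth N (lower N V) = depth N V + 1"
    using mem(3) by (simp add: phi')
  show "phi (lower N V) N = phi V N - 2" using r by (simp add: phi')
  show "upper N (lower N V) = V"
    unfolding upper_eq[OF hi] unfolding lower_eq[OF assms]
    using mem by (cases V) auto
qed

lemma upper_props:
  assumes "hi_row N V r"
  shows "lo_row N (upper N V) r" "depth N (upper N V) = depth N V - 1"
    "phi (upper N V) N = phi V N + 2" "lower N (upper N V) = V"
proof -
  have r: "1 \<le> r" "r \<le> N" using assms by (auto simp: hi_row_def)
  note mem = hi_row_mem[OF assms]
  have V: "V = (fst (upper N V) - {r}, insert r (snd (upper N V)))"
    unfolding upper_eq[OF assms] using mem by (cases V) auto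
  have "phi V t = (if t < r then phi (upper N V) t else phi (upper N V) t - 2)" for t
    by (subst (1) V, rule phi_remove_insert) (use mem r in \<open>auto simp: upper_eq[OF assms]\<close>)
  then have phi': "phi (upper N V) t = (if t < r then phi V t else phi V t + 2)" for t
    by simp
  have bnd: "phi V r < phi V t" if "t < r" for t
    using assms that by (auto simp: hi_row_def)
  have bnd2: "phi V r \<le> phi V t" if "r \<le> t" "t \<le> N" for t
    using assms that by (auto simp: hi_row_def)
  show lo: "lo_row N (upper N V) r"
    unfolding lo_row_def phi' using r mem(3) bnd bnd2 by fastforce
  have *: "lower N (upper N V) = V"
    unfolding lower_eq[OF lo] using V by simp
  then show "lower N (upper N V) = V" .
  from lower_props(2,3)[OF lo] * show "depth N (upper N V) = depth N V - 1"
    "phi (upper N V) N = phi V N + 2" by auto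
qed

text \<open>The last-minimum condition gives the bracketing inequalities on all intervals ending or
  starting at \<open>r\<close>, in particular on the connected ones. Beyond \<open>N\<close> the
  path is constant, which settles the unbounded \<open>t\<close> in \<open>movable\<close>.\<close>

lemma lo_row_movable:
  assumes "lo_row N V r" "fst V \<subseteq> {1..N}" "snd V \<subseteq> {1..N}"
  shows "movable r (fst V) (snd V)"
  unfolding movable_def
proof (intro conjI ballI allI impI)
  have r: "1 \<le> r" "r \<le> N" using assms by (auto simp: lo_row_def)
  show "1 \<le> r" "r \<in> fst V" "r \<notin> snd V" using r lo_row_mem[OF assms(1)] by auto
  fix s assume s: "s \<in> {1..r}"
  then have "phi V (r - 1) \<le> phi V (s - 1)" using assms(1) by (auto simp: lo_row_def)
  moreover have "{s..<r} = {s - 1<..r - 1}" using s by auto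
  ultimately show "card (fst V \<inter> {s..<r}) \<le> card (snd V \<inter> {s..<r})"
    using card_Int_segment[of "s - 1" "r - 1" "fst V"] card_Int_segment[of "s - 1" "r - 1" "snd V"]
      diff_le_mono[of s r 1] s
    by (simp add: phi_def)
next
  fix t assume t: "r < t"
  have r: "1 \<le> r" "r \<le> N" using assms by (auto simp: lo_row_def)
  have "phi V r \<le> phi V t"
  proof (cases "t \<le> N")
    case True
    then have "phi V (r - 1) < phi V t" using assms(1) t by (auto simp: lo_row_def)
    then show ?thesis using lo_row_mem(3)[OF assms(1)] by simp
  next
    case False
    then have "phi V t = phi V N" using assms by (intro phi_beyond) auto
    moreover have "phi V (r - 1) < phi V N" using assms(1) r by (auto simp: lo_row_def)
    ultimately show ?thesis using lo_row_mem(3)[OF assms(1)] by simp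
  qed
  then show "card (snd V \<inter> {r<..t}) \<le> card (fst V \<inter> {r<..t})"
    using card_Int_segment[of r t "fst V"] card_Int_segment[of r t "snd V"] t
    by (simp add: phi_def)
qed

lemma mv_lower:
  assumes "lo_row N V r" "fst V \<subseteq> {1..N}" "snd V \<subseteq> {1..N}"
  shows "mv V (lower N V)"
  using lo_row_movable[OF assms] lower_eq[OF assms(1)] by (auto simp: mv_def)

section \<open>Demazure operators on crystal strings\<close>

lemma diff_mult_sum_power_shift:
  fixes x y :: "'a::comm_ring_1"
  shows "(y - x) * (\<Sum>j\<le>u. y ^ (q + u - j) * x ^ (q + j)) =
    y * (y ^ (q + u) * x ^ q) - x * (x ^ (q + u) * y ^ q)"
proof -
  have "(\<Sum>j\<le>u. y ^ (q + u - j) * x ^ (q + j)) =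
      (x * y) ^ q * (\<Sum>j<Suc u. x ^ j * y ^ (u - j))"
    unfolding sum_distrib_left lessThan_Suc_atMost
  proof (rule sum.cong)
    fix j assume "j \<in> {..u}"
    then have "q + u - j = q + (u - j)" by simp
    then show "y ^ (q + u - j) * x ^ (q + j) = (x * y) ^ q * (x ^ j * y ^ (u - j))"
      by (simp add: power_add power_mult_distrib mult_ac)
  qed simp
  then have "(y - x) * (\<Sum>j\<le>u. y ^ (q + u - j) * x ^ (q + j)) =
      - ((x * y) ^ q * ((x - y) * (\<Sum>j<Suc u. x ^ j * y ^ (u - j))))"
    by (simp add: algebra_simps)
  also have "(x - y) * (\<Sum>j<Suc u. x ^ j * y ^ (u - j)) = x ^ Suc u - y ^ Suc u"
    by (rule diff_power_eq_sum[symmetric])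
  finally show ?thesis by (simp add: power_mult_distrib power_add algebra_simps)
qed

lemma sum_power_shift_swap:
  fixes x y :: "'a::comm_ring_1"
  shows "(\<Sum>j\<le>u. y ^ (q + u - j) * x ^ (q + j)) = (\<Sum>j\<le>u. x ^ (q + u - j) * y ^ (q + j))"
  by (rule sum.reindex_bij_witness[of _ "\<lambda>j. u - j" "\<lambda>j. u - j"])
    (auto simp: mult.commute Nat.add_diff_assoc)

text \<open>With the denominator cleared, this says that a Demazure operator turns the generating
  function of \<open>\<A>\<close> into that of \<open>\<V>\<close>. The weight sum of a full string
  is symmetric, hence fixed; the weight of a lone top element is spread over its string. By
  \<open>top\<close>, \<open>raise\<close> and \<open>forth\<close>, \<open>\<A>\<close> contains
  all tops, is closed under raising, and can be left only in the first step down from a top.\<close>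

lemma string_identity:
  fixes x y :: "'a::comm_ring_1"
  assumes bounded: "\<V> \<subseteq> Pow {1..N} \<times> Pow {1..N}"
    and closed: "\<And>V W. mv V W \<Longrightarrow> V \<in> Pow {1..N} \<times> Pow {1..N} \<Longrightarrow> V \<in> \<V> \<longleftrightarrow> W \<in> \<V>"
    and sub: "\<A> \<subseteq> \<V>"
    and top: "\<And>V. V \<in> \<V> \<Longrightarrow> (\<And>t. t \<le> N \<Longrightarrow> 0 \<le> phi V t) \<Longrightarrow> V \<in> \<A>"
    and raise: "\<And>V W. V \<in> \<V> \<Longrightarrow> W \<in> \<A> \<Longrightarrow> mv V W \<Longrightarrow> V \<in> \<A>"
    and forth: "\<And>V r. V \<in> \<A> \<Longrightarrow> lo_row N V r \<Longrightarrow> 0 < depth N V \<Longrightarrow> lower N V \<in> \<A>"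
  shows "(y - x) * (\<Sum>V\<in>\<V>. y ^ card (fst V) * x ^ card (snd V)) =
    y * (\<Sum>V\<in>\<A>. y ^ card (fst V) * x ^ card (snd V)) -
    x * (\<Sum>V\<in>\<A>. x ^ card (fst V) * y ^ card (snd V))"
proof -
  \<comment> \<open>\<open>\<V>\<close> is a union of full strings; \<open>\<A>\<close> meets each of them in its top element or in all of it.\<close>
  define Tops where "Tops = {V \<in> \<V>. depth N V = 0}"
  \<comment> \<open>At a top element the final height of the path is the length of its string: each
    lowering decreases it by two and the minimum by one, and lowering is possible until they
    meet.\<close>
  define u where "u V = nat (phi V N)" for V
  define g where "g V j = (lower N ^^ j) V" for V j
  have finV: "finite \<V>" using bounded by (rule finite_subset) auto
  have finT: "finite Tops" using finV by (simp add: Tops_def)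
  have subs: "fst V \<subseteq> {1..N}" "snd V \<subseteq> {1..N}" if "V \<in> \<V>" for V
    using subsetD[OF bounded that] by (cases V; simp)+
  have low: "lower N V \<in> \<V>" "mv V (lower N V)" if "V \<in> \<V>" "lo_row N V r" for V r
  proof -
    show "mv V (lower N V)" using mv_lower[OF that(2)] subs[OF that(1)] by blast
    then show "lower N V \<in> \<V>" using closed[of V "lower N V"] that(1) bounded by auto
  qed
  have upp: "upper N V \<in> \<V>" if "V \<in> \<V>" "hi_row N V r" for V r
  proof -
    have "fst (upper N V) \<subseteq> {1..N}" "snd (upper N V) \<subseteq> {1..N}"
      using subs[OF that(1)] that(2) by (auto simp: upper_eq hi_row_def)
    moreover from this have "mv (upper N V) (lower N (upper N V))"
      using mv_lower[OF upper_props(1)[OF that(2)]] by blast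
    ultimately show ?thesis
      using closed[of "upper N V" V] upper_props(4)[OF that(2)] that(1)
      by (cases "upper N V") auto
  qed
  have phiN: "phi V N = int (card (fst V)) - int (card (snd V))" if "V \<in> \<V>" for V
    using subs[OF that] by (simp add: phi_def Int_absorb2)
  have string: "g V j \<in> \<V> \<and> depth N (g V j) = int j \<and> phi (g V j) N = phi V N - 2 * int j \<and>
      card (fst (g V j)) + j = card (fst V) \<and> card (snd (g V j)) = card (snd V) + j \<and>
      (upper N ^^ j) (g V j) = V \<and> (j < u V \<longrightarrow> (\<exists>r. lo_row N (g V j) r))"
    if V: "V \<in> Tops" and "j \<le> u V" for V j
    using that(2)
  proof (induction j)
    case 0
    have "0 \<le> phi V N" using depth_ge[of N N V] V by (auto simp: Tops_def)
    then show ?case using V lo_row_exists[of N V] by (auto simp: g_def Tops_def u_def)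
  next
    case (Suc j)
    then have IH: "g V j \<in> \<V>" "depth N (g V j) = int j" "phi (g V j) N = phi V N - 2 * int j"
      "card (fst (g V j)) + j = card (fst V)" "card (snd (g V j)) = card (snd V) + j"
      "(upper N ^^ j) (g V j) = V" by auto
    from Suc obtain r where r: "lo_row N (g V j) r" by auto
    have g: "g V (Suc j) = lower N (g V j)" by (simp add: g_def)
    note lp = lower_props[OF r]
    have fin: "finite (fst (g V j))" "finite (snd (g V j))"
      using subs[OF IH(1)] finite_subset by auto
    have mem: "r \<in> fst (g V j)" "r \<notin> snd (g V j)" using lo_row_mem[OF r] by auto
    have 1: "g V (Suc j) \<in> \<V>" unfolding g by (rule low(1)[OF IH(1) r])
    have 2: "depth N (g V (Suc j)) = int (Suc j)" "phi (g V (Suc j)) N = phi V N - 2 * int (Suc j)"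
      unfolding g using lp IH by auto
    have "card (fst (g V j)) > 0" using mem fin by (auto simp: card_gt_0_iff)
    then have 3: "card (fst (g V (Suc j))) + Suc j = card (fst V)"
      "card (snd (g V (Suc j))) = card (snd V) + Suc j"
      unfolding g lower_eq[OF r] using mem fin IH by auto
    have 4: "(upper N ^^ Suc j) (g V (Suc j)) = V"
      unfolding g funpow_Suc_right o_apply lp(4) by (rule IH)
    have "\<exists>r. lo_row N (g V (Suc j)) r" if "Suc j < u V"
      by (rule lo_row_exists) (use 2 that in \<open>simp add: u_def\<close>)
    with 1 2 3 4 show ?case by simp
  qed
  have surj: "\<exists>T\<in>Tops. j \<le> u T \<and> g T j = V" if "V \<in> \<V>" "depth N V = int j" for V j
    using that
  proof (induction j arbitrary: V)
    case 0
    then show ?case by (intro bexI[of _ V]) (auto simp: Tops_def g_def)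
  next
    case (Suc j)
    then obtain r where r: "hi_row N V r" using hi_row_exists[of N V] by auto
    have "upper N V \<in> \<V>" using upp Suc.prems(1) r by blast
    moreover have "depth N (upper N V) = int j" using upper_props(2)[OF r] Suc.prems by simp
    ultimately obtain T where T: "T \<in> Tops" "j \<le> u T" "g T j = upper N V"
      using Suc.IH by blast
    have gV: "g T (Suc j) = V" using T(3) upper_props(4)[OF r] by (simp add: g_def)
    have "phi V N = phi T N - 2 * int (Suc j)"
      using string[OF T(1,2)] T(3) upper_props(3)[OF r] by simp
    then have "Suc j \<le> u T" using depth_ge[of N N V] Suc.prems(2) by (simp add: u_def)
    then show ?case using T(1) gV by blast
  qed
  \<comment> \<open>The depth recovers the position in the string, and that many applications of
    \<open>upper\<close> recover its top.\<close>
  have inj: "inj_on (\<lambda>(V, j). g V j) (SIGMA V:Tops. {..u V})"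
  proof (rule inj_onI, clarify)
    fix V j W i
    assume V: "V \<in> Tops" "j \<le> u V" "W \<in> Tops" "i \<le> u W" "g V j = g W i"
    have "depth N (g V j) = int j" "depth N (g W i) = int i"
      and up: "(upper N ^^ j) (g V j) = V" "(upper N ^^ i) (g W i) = W"
      using string[OF V(1,2)] string[OF V(3,4)] by blast+
    then have "j = i" using V(5) by simp
    moreover from this have "V = W" using up V(5) by argo
    ultimately show "V = W \<and> j = i" by simp
  qed
  have nonneg: "card (fst V) = card (snd V) + u V" if "V \<in> Tops" for V
  proof -
    have "0 \<le> phi V N" using depth_ge[of N N V] that by (auto simp: Tops_def)
    then show ?thesis using phiN[of V] that by (auto simp: Tops_def u_def)
  qed
  have wt: "y ^ card (fst (g V j)) * x ^ card (snd (g V j)) =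
      y ^ (card (snd V) + u V - j) * x ^ (card (snd V) + j)" if "V \<in> Tops" "j \<le> u V" for V j and x y :: 'a
  proof -
    have "card (fst (g V j)) + j = card (fst V)" "card (snd (g V j)) = card (snd V) + j"
      using string[OF that] by blast+
    moreover from this nonneg[OF that(1)] have "card (fst (g V j)) = card (snd V) + u V - j"
      by linarith
    ultimately show ?thesis by simp
  qed
  define J where "J V = (if lower N V \<in> \<A> then {..u V} else {0})" for V
  have imV: "\<V> = (\<lambda>(V, j). g V j) ` (SIGMA V:Tops. {..u V})"
  proof (intro equalityI subsetI)
    fix V assume V: "V \<in> \<V>"
    have "depth N V = int (nat (depth N V))" using depth_nonneg[of N V] by simp
    from surj[OF V this] show "V \<in> (\<lambda>(V, j). g V j) ` (SIGMA V:Tops. {..u V})" by force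
  next
    fix V assume "V \<in> (\<lambda>(V, j). g V j) ` (SIGMA V:Tops. {..u V})"
    then show "V \<in> \<V>" using string by auto
  qed
  have topA: "V \<in> \<A>" if "V \<in> Tops" for V
    using that top[of V] depth_ge[of _ N V] by (force simp: Tops_def)
  \<comment> \<open>Every element after the top has positive depth, so \<open>forth\<close> applies
    to it; membership of the whole string is decided by its second element.\<close>
  have fwd: "g V (Suc j) \<in> \<A>" if VT: "V \<in> Tops" and "Suc j \<le> u V" and "lower N V \<in> \<A>" for V j
    using that(2)
  proof (induction j)
    case 0
    then show ?case using that(3) by (simp add: g_def)
  next
    case (Suc j)
    obtain r where r: "lo_row N (g V (Suc j)) r" using string[OF VT, of "Suc j"] Suc.prems by auto
    have "lower N (g V (Suc j)) \<in> \<A>"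
      using Suc r string[OF VT, of "Suc j"] by (intro forth[OF _ r]) auto
    then show ?case by (simp add: g_def)
  qed
  have bwd: "lower N V \<in> \<A>" if VT: "V \<in> Tops" and "Suc j \<le> u V" and "g V (Suc j) \<in> \<A>" for V j
    using that(2,3)
  proof (induction j)
    case 0
    then show ?case by (simp add: g_def)
  next
    case (Suc j)
    obtain r where r: "lo_row N (g V (Suc j)) r" using string[OF VT, of "Suc j"] Suc.prems by auto
    have mem: "g V (Suc j) \<in> \<V>" using string[OF VT, of "Suc j"] Suc.prems by auto
    have "mv (g V (Suc j)) (g V (Suc (Suc j)))"
      using low(2)[OF mem r] by (simp add: g_def)
    then have "g V (Suc j) \<in> \<A>" using raise mem Suc.prems(2) by blast
    then show ?case using Suc by simp
  qed
  have imA: "\<A> = (\<lambda>(V, j). g V j) ` (SIGMA V:Tops. J V)"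
  proof (intro equalityI subsetI)
    fix V assume V: "V \<in> \<A>"
    then have "V \<in> (\<lambda>(V, j). g V j) ` (SIGMA V:Tops. {..u V})" using sub imV by blast
    then obtain T j where T: "T \<in> Tops" "j \<le> u T" "V = g T j" by auto
    have "j \<in> J T"
    proof (cases j)
      case (Suc i)
      then show ?thesis using bwd[of T i] T V by (auto simp: J_def)
    qed (auto simp: J_def)
    then show "V \<in> (\<lambda>(V, j). g V j) ` (SIGMA V:Tops. J V)" using T by force
  next
    fix V assume "V \<in> (\<lambda>(V, j). g V j) ` (SIGMA V:Tops. J V)"
    then obtain T j where T: "T \<in> Tops" "j \<in> J T" "V = g T j" by auto
    show "V \<in> \<A>"
    proof (cases j)
      case 0
      then show ?thesis using T topA by (simp add: g_def)
    next
      case (Suc i)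
      then show ?thesis using T fwd[of T i] by (auto simp: J_def split: if_splits)
    qed
  qed
  have Jsub: "J V \<subseteq> {..u V}" for V by (auto simp: J_def)
  have injA: "inj_on (\<lambda>(V, j). g V j) (SIGMA V:Tops. J V)"
    by (rule inj_on_subset[OF inj]) (use Jsub in auto)
  have finJ: "finite (J V)" for V by (auto simp: J_def)
  define c where "c V = (\<Sum>j\<le>u V. y ^ (card (snd V) + u V - j) * x ^ (card (snd V) + j))" for V
  have sumV: "(\<Sum>V\<in>\<V>. y ^ card (fst V) * x ^ card (snd V)) = (\<Sum>V\<in>Tops. c V)"
  proof -
    have "(\<Sum>V\<in>\<V>. y ^ card (fst V) * x ^ card (snd V)) =
        (\<Sum>(V, j)\<in>(SIGMA V:Tops. {..u V}). y ^ card (fst (g V j)) * x ^ card (snd (g V j)))"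
      by (subst imV, subst sum.reindex[OF inj]) (simp add: o_def case_prod_unfold)
    also have "\<dots> = (\<Sum>V\<in>Tops. \<Sum>j\<le>u V. y ^ card (fst (g V j)) * x ^ card (snd (g V j)))"
      using finT by (simp add: sum.Sigma)
    also have "\<dots> = (\<Sum>V\<in>Tops. c V)"
      unfolding c_def by (intro sum.cong refl wt) auto
    finally show ?thesis .
  qed
  have sumA: "(\<Sum>V\<in>\<A>. y ^ card (fst V) * x ^ card (snd V)) =
      (\<Sum>V\<in>Tops. if lower N V \<in> \<A> then \<Sum>j\<le>u V. y ^ (card (snd V) + u V - j) * x ^ (card (snd V) + j)
        else y ^ (card (snd V) + u V) * x ^ card (snd V))" for x y :: 'a
  proof -
    have "(\<Sum>V\<in>\<A>. y ^ card (fst V) * x ^ card (snd V)) =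
        (\<Sum>(V, j)\<in>(SIGMA V:Tops. J V). y ^ card (fst (g V j)) * x ^ card (snd (g V j)))"
      by (subst imA, subst sum.reindex[OF injA]) (simp add: o_def case_prod_unfold)
    also have "\<dots> = (\<Sum>V\<in>Tops. \<Sum>j\<in>J V. y ^ card (fst (g V j)) * x ^ card (snd (g V j)))"
      using finT finJ by (simp add: sum.Sigma)
    also have "\<dots> = (\<Sum>V\<in>Tops. \<Sum>j\<in>J V. y ^ (card (snd V) + u V - j) * x ^ (card (snd V) + j))"
      using Jsub by (intro sum.cong refl wt) auto
    also have "\<dots> = (\<Sum>V\<in>Tops. if lower N V \<in> \<A> then \<Sum>j\<le>u V. y ^ (card (snd V) + u V - j) * x ^ (card (snd V) + j)
        else y ^ (card (snd V) + u V) * x ^ card (snd V))"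
      by (intro sum.cong) (auto simp: J_def)
    finally show ?thesis .
  qed
  show ?thesis
    unfolding sumV sumA[of y x] sumA[of x y] sum_distrib_left sum_subtractf[symmetric]
  proof (intro sum.cong refl)
    fix V
    show "(y - x) * c V =
      y * (if lower N V \<in> \<A> then \<Sum>j\<le>u V. y ^ (card (snd V) + u V - j) * x ^ (card (snd V) + j)
        else y ^ (card (snd V) + u V) * x ^ card (snd V)) -
      x * (if lower N V \<in> \<A> then \<Sum>j\<le>u V. x ^ (card (snd V) + u V - j) * y ^ (card (snd V) + j)
        else x ^ (card (snd V) + u V) * y ^ card (snd V))"
    proof (cases "lower N V \<in> \<A>")
      case True
      then show ?thesis
        unfolding c_def
        using sum_power_shift_swap[of y "card (snd V)" "u V" x] by (simp add: left_diff_distrib)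
    next
      case False
      then show ?thesis unfolding c_def by (simp only: if_False diff_mult_sum_power_shift)
    qed
  qed
qed

section \<open>The generating function of the particle process\<close>

text \<open>Reading a skyline filling from the largest entry \<open>v\<close> down, the heights of the columns after
  removal of all entries \<open>\<ge> v\<close> are the positions of particles. The column with base \<open>v \<in> S\<close> must
  have reached height \<open>0\<close> by then; it is the head of the list and is discarded.\<close>

primrec Z :: "(nat \<Rightarrow> 'a::comm_ring_1) \<Rightarrow> nat \<Rightarrow> nat set \<Rightarrow> nat \<Rightarrow> nat list \<Rightarrow> 'a" where
  "Z x N S 0 hs = (if hs = [] then 1 else 0)"
| "Z x N S (Suc v) hs = (\<Sum>P\<in>Pow {1..N}. if rest hs P = {} then
     x (Suc v) ^ card P *
       (if Suc v \<in> S then (if hs \<noteq> [] \<and> hd (final hs P) = 0 then Z x N S v (tl (final hs P)) else 0)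
        else Z x N S v (final hs P)) else 0)"

lemma Z_cong:
  assumes "\<And>i. 1 \<le> i \<Longrightarrow> i \<le> v \<Longrightarrow> x i = y i" "\<And>i. 1 \<le> i \<Longrightarrow> i \<le> v \<Longrightarrow> i \<in> S \<longleftrightarrow> i \<in> T"
  shows "Z x N S v hs = Z y N T v hs"
  using assms
proof (induction v arbitrary: hs)
  case (Suc v)
  have "Z x N S v hs = Z y N T v hs" for hs using Suc.prems by (intro Suc.IH) auto
  moreover have "x (Suc v) = y (Suc v)" "Suc v \<in> S \<longleftrightarrow> Suc v \<in> T" using Suc.prems by auto
  ultimately show ?case by (simp cong: if_cong)
qed simp

definition two_step :: "nat \<Rightarrow> nat list \<Rightarrow> nat list \<Rightarrow> (nat set \<times> nat set) set" where
  "two_step N hs ks = {(P, Q) \<in> Pow {1..N} \<times> Pow {1..N}.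
     rest hs P = {} \<and> rest (final hs P) Q = {} \<and> final (final hs P) Q = ks}"

lemma two_step_mv:
  assumes "mv V W" "V \<in> Pow {1..N} \<times> Pow {1..N}"
  shows "V \<in> two_step N hs ks \<longleftrightarrow> W \<in> two_step N hs ks"
proof -
  obtain P Q P' Q' where VW: "V = (P, Q)" "W = (P', Q')" by (cases V, cases W)
  have eq: "equivclp mv (P, Q) (P', Q')" using assms(1) VW mv_imp_equivclp by simp
  have W: "W \<in> Pow {1..N} \<times> Pow {1..N}" using assms by (auto simp: mv_def movable_def)
  from equivclp_final[OF eq, of hs]
  have 1: "final (final hs P) Q = final (final hs P') Q'"
    and "equivclp mv (rest hs P, rest (final hs P) Q) (rest hs P', rest (final hs P') Q')" by auto
  from equivclp_mv_Un[OF this(2)]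
  have "rest hs P \<union> rest (final hs P) Q = rest hs P' \<union> rest (final hs P') Q'" by simp
  then have "rest hs P = {} \<and> rest (final hs P) Q = {} \<longleftrightarrow>
      rest hs P' = {} \<and> rest (final hs P') Q' = {}" by blast
  then show ?thesis using 1 W assms(2) by (auto simp: two_step_def VW)
qed

text \<open>\<open>\<V>\<close> is the case where the first column must be empty only after the
  second pass, \<open>\<A>\<close> the case where it must be empty after the first. If that column
  stops at a row \<open>k > 0\<close> in the first pass, all rows up to \<open>k\<close> lie in the
  second set and \<open>k\<close> is not in the first, so the path is negative at \<open>k\<close>;
  hence tops lie in \<open>\<A>\<close>. Inside \<open>\<A>\<close> the path is nonnegative up to
  \<open>h\<close>, so at positive depth the lowered row lies above \<open>h\<close> and the first
  column is not disturbed.\<close>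

lemma two_step_identity:
  fixes x y :: "'a::comm_ring_1" and N h :: nat and hs ks :: "nat list"
  defines "\<V> \<equiv> two_step N (h # hs) (0 # ks)"
  defines "\<A> \<equiv> {V \<in> \<V>. drop_to (fst V) h = 0}"
  shows "(y - x) * (\<Sum>V\<in>\<V>. y ^ card (fst V) * x ^ card (snd V)) =
    y * (\<Sum>V\<in>\<A>. y ^ card (fst V) * x ^ card (snd V)) -
    x * (\<Sum>V\<in>\<A>. x ^ card (fst V) * y ^ card (snd V))"
proof (rule string_identity)
  show sub: "\<V> \<subseteq> Pow {1..N} \<times> Pow {1..N}" by (auto simp: \<V>_def two_step_def)
  show closed: "V \<in> \<V> \<longleftrightarrow> W \<in> \<V>" if "mv V W" "V \<in> Pow {1..N} \<times> Pow {1..N}" for V W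
    unfolding \<V>_def by (rule two_step_mv[OF that])
  show "\<A> \<subseteq> \<V>" by (auto simp: \<A>_def)
  show "V \<in> \<A>" if V: "V \<in> \<V>" and nonneg: "\<And>t. t \<le> N \<Longrightarrow> 0 \<le> phi V t" for V
  proof -
    let ?k = "drop_to (fst V) h"
    have "drop_to (snd V) ?k = 0" using V by (auto simp: \<V>_def two_step_def)
    then have Q: "{0<..?k} \<subseteq> snd V" using drop_to_run[of "snd V" ?k] by simp
    have "?k = 0"
    proof (rule ccontr)
      assume k: "?k \<noteq> 0"
      then have "?k \<in> snd V" using Q by auto
      then have kN: "?k \<le> N" using subsetD[OF sub V] by (cases V) auto
      have "?k \<notin> fst V" using drop_to_stop[of "fst V" h] k by auto
      then have "fst V \<inter> {1..?k} \<subseteq> {1..?k} - {?k}" by auto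
      then have "card (fst V \<inter> {1..?k}) \<le> card ({1..?k} - {?k})" by (rule card_mono[rotated]) simp
      then have "card (fst V \<inter> {1..?k}) < ?k" using k by simp
      moreover have "snd V \<inter> {1..?k} = {1..?k}" using Q by auto
      ultimately have "phi V ?k < 0" by (simp add: phi_def)
      then show False using nonneg[OF kN] by simp
    qed
    then show ?thesis using V by (simp add: \<A>_def)
  qed
  show "V \<in> \<A>" if V: "V \<in> \<V>" and W: "W \<in> \<A>" and "mv V W" for V W
  proof -
    have "{0<..h} \<subseteq> fst W" using W drop_to_run[of "fst W" h] by (auto simp: \<A>_def)
    moreover have "fst W \<subseteq> fst V" using that(3) by (auto simp: mv_def)
    ultimately have "drop_to (fst V) h = 0" by (intro drop_to_eqI) auto
    then show ?thesis using V by (simp add: \<A>_def)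
  qed
  show "lower N V \<in> \<A>" if V: "V \<in> \<A>" and r: "lo_row N V r" and d: "0 < depth N V" for V r
  proof -
    have V': "V \<in> Pow {1..N} \<times> Pow {1..N}" using V sub by (auto simp: \<A>_def)
    then have "mv V (lower N V)" using r by (intro mv_lower) auto
    then have 1: "lower N V \<in> \<V>" using closed[OF _ V'] V by (simp add: \<A>_def)
    have P: "{0<..h} \<subseteq> fst V" using V drop_to_run[of "fst V" h] by (auto simp: \<A>_def)
    have "h < r"
    proof (rule ccontr)
      assume "\<not> h < r"
      then have "{1..r - 1} \<subseteq> {0<..h}" by auto
      then have "fst V \<inter> {1..r - 1} = {1..r - 1}" using P by auto
      moreover have "card (snd V \<inter> {1..r - 1}) \<le> card {1..r - 1}" by (rule card_mono) auto
      ultimately have "0 \<le> phi V (r - 1)" by (simp add: phi_def)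
      moreover obtain t where "t \<le> N" "phi V t < 0"
        using depth_attained[of N V] d by auto
      moreover from this have "phi V (r - 1) \<le> phi V t"
        using r unfolding lo_row_def by (meson less_imp_le not_less)
      ultimately show False by simp
    qed
    then have "drop_to (fst (lower N V)) h = 0"
      using P by (intro drop_to_eqI) (auto simp: lower_eq[OF r])
    then show ?thesis using 1 by (simp add: \<A>_def)
  qed
qed

text \<open>The later entries see only the tail of the heights after both passes. Grouping by this
  tail lets \<open>two_step_identity\<close> act on one group at a time. The predicate
  \<open>B\<close> separates the two families compared there.\<close>

lemma sum_two_step:
  fixes f :: "nat set \<times> nat set \<Rightarrow> 'a::comm_ring_1"
  assumes hs: "hs \<noteq> []"
  shows "(\<Sum>P\<in>Pow {1..N}. if rest hs P = {} then
      (\<Sum>Q\<in>Pow {1..N}. if rest (final hs P) Q = {} \<and> B (P, Q) \<and> hd (final (final hs P) Q) = 0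
         then f (P, Q) * \<zeta> (tl (final (final hs P) Q)) else 0) else 0) =
    (\<Sum>ks\<in>(\<lambda>(P, Q). tl (final (final hs P) Q)) ` (Pow {1..N} \<times> Pow {1..N}).
       (\<Sum>V | V \<in> two_step N hs (0 # ks) \<and> B V. f V) * \<zeta> ks)"
proof -
  let ?U = "Pow {1..N} \<times> Pow {1..N}"
  let ?l = "\<lambda>(P, Q). tl (final (final hs P) Q)"
  let ?W = "{(P, Q) \<in> ?U. rest hs P = {} \<and> rest (final hs P) Q = {} \<and> B (P, Q) \<and>
    hd (final (final hs P) Q) = 0}"
  have ne: "final (final hs P) Q \<noteq> []" for P Q using hs by (cases hs) auto
  have "(\<Sum>P\<in>Pow {1..N}. if rest hs P = {} then
      (\<Sum>Q\<in>Pow {1..N}. if rest (final hs P) Q = {} \<and> B (P, Q) \<and> hd (final (final hs P) Q) = 0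
         then f (P, Q) * \<zeta> (tl (final (final hs P) Q)) else 0) else 0) =
     (\<Sum>P\<in>Pow {1..N}. \<Sum>Q\<in>Pow {1..N}. if (P, Q) \<in> ?W then f (P, Q) * \<zeta> (?l (P, Q)) else 0)"
    by (intro sum.cong refl) (auto intro!: sum.neutral sum.cong)
  also have "\<dots> = (\<Sum>V\<in>?U. if V \<in> ?W then f V * \<zeta> (?l V) else 0)"
    unfolding sum.cartesian_product by (intro sum.cong refl) (simp add: case_prod_beta)
  also have "\<dots> = (\<Sum>V\<in>{V \<in> ?U. V \<in> ?W}. f V * \<zeta> (?l V))"
    by (rule sum.inter_filter[symmetric]) simp
  also have "{V \<in> ?U. V \<in> ?W} = ?W" by auto
  also have "(\<Sum>V\<in>?W. f V * \<zeta> (?l V)) = (\<Sum>ks\<in>?l ` ?U. \<Sum>V | V \<in> ?W \<and> ?l V = ks. f V * \<zeta> (?l V))"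
  proof (rule sum.group[symmetric])
    show "finite ?W" by (rule finite_subset[of _ ?U]) auto
  qed auto
  also have "\<dots> = (\<Sum>ks\<in>?l ` ?U. (\<Sum>V | V \<in> two_step N hs (0 # ks) \<and> B V. f V) * \<zeta> ks)"
  proof (intro sum.cong refl)
    fix ks
    have eq: "{V. V \<in> ?W \<and> ?l V = ks} = {V. V \<in> two_step N hs (0 # ks) \<and> B V}"
    proof -
      have "hd (final (final hs P) Q) = 0 \<and> tl (final (final hs P) Q) = ks \<longleftrightarrow>
          final (final hs P) Q = 0 # ks" for P Q
        using ne[of P Q] by (cases "final (final hs P) Q") auto
      then show ?thesis by (auto simp: two_step_def)
    qed
    show "(\<Sum>V | V \<in> ?W \<and> ?l V = ks. f V * \<zeta> (?l V)) =
        (\<Sum>V | V \<in> two_step N hs (0 # ks) \<and> B V. f V) * \<zeta> ks"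
      unfolding sum_distrib_right by (rule sum.cong[OF eq]) (auto simp: two_step_def)
  qed
  finally show ?thesis .
qed

lemma Z_swap_base:
  fixes x :: "nat \<Rightarrow> 'a::comm_ring_1"
  assumes "1 \<le> t" "t \<notin> S" "Suc t \<in> S" "S' = insert t (S - {Suc t})"
    and "x' = x(t := x (Suc t), Suc t := x t)"
  shows "(x (Suc t) - x t) * Z x N S' (Suc t) hs =
    x (Suc t) * Z x N S (Suc t) hs - x t * Z x' N S (Suc t) hs"
proof (cases hs)
  case Nil
  obtain t0 where t0: "t = Suc t0" using assms(1) by (cases t) auto
  show ?thesis using assms by (simp add: Nil t0)
next
  case (Cons h hs0)
  obtain t0 where t0: "t = Suc t0" using assms(1) by (cases t) auto
  define \<zeta> where "\<zeta> = Z x N S t0"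
  have \<zeta>': "Z x N S' t0 = \<zeta>" "Z x' N S t0 = \<zeta>"
    unfolding \<zeta>_def by (intro ext Z_cong; use assms t0 in auto)+
  have S'_mem: "Suc t \<notin> S'" "t \<in> S'" using assms by auto
  define L where "L = (\<lambda>(P, Q). tl (final (final hs P) Q)) ` (Pow {1..N} \<times> Pow {1..N})"
  have S': "Z x N S' (Suc t) hs = (\<Sum>ks\<in>L. (\<Sum>V | V \<in> two_step N hs (0 # ks) \<and> True.
      x (Suc t) ^ card (fst V) * x t ^ card (snd V)) * \<zeta> ks)"
  proof -
    have "Z x N S' (Suc t) hs = (\<Sum>P\<in>Pow {1..N}. if rest hs P = {} then
      (\<Sum>Q\<in>Pow {1..N}. if rest (final hs P) Q = {} \<and> True \<and> hd (final (final hs P) Q) = 0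
         then (\<lambda>V. x (Suc t) ^ card (fst V) * x t ^ card (snd V)) (P, Q) * \<zeta> (tl (final (final hs P) Q)) else 0) else 0)"
      using S'_mem Cons unfolding t0
      by (auto simp: \<zeta>' sum_distrib_left mult.assoc intro!: sum.cong)
    also have "\<dots> = (\<Sum>ks\<in>L. (\<Sum>V | V \<in> two_step N hs (0 # ks) \<and> True.
      x (Suc t) ^ card (fst V) * x t ^ card (snd V)) * \<zeta> ks)"
      unfolding L_def by (rule sum_two_step) (simp add: Cons)
    finally show ?thesis .
  qed
  \<comment> \<open>For base \<open>t + 1\<close> the head is discarded before the rows of
    \<open>t\<close> are read. It may as well stay for that pass: at height \<open>0\<close> it
    consumes no row.\<close>
  have S: "Z z N S (Suc t) hs = (\<Sum>ks\<in>L. (\<Sum>V | V \<in> two_step N hs (0 # ks) \<and> drop_to (fst V) h = 0.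
      z (Suc t) ^ card (fst V) * z t ^ card (snd V)) * \<zeta> ks)" if z: "Z z N S t0 = \<zeta>" for z
  proof -
    have "Z z N S (Suc t) hs = (\<Sum>P\<in>Pow {1..N}. if rest hs P = {} then
      (\<Sum>Q\<in>Pow {1..N}. if rest (final hs P) Q = {} \<and> drop_to (fst (P, Q)) h = 0 \<and> hd (final (final hs P) Q) = 0
         then (\<lambda>V. z (Suc t) ^ card (fst V) * z t ^ card (snd V)) (P, Q) * \<zeta> (tl (final (final hs P) Q)) else 0) else 0)"
      using assms(2,3) Cons unfolding t0
      by (auto simp: z sum_distrib_left mult.assoc intro!: sum.cong)
    also have "\<dots> = (\<Sum>ks\<in>L. (\<Sum>V | V \<in> two_step N hs (0 # ks) \<and> drop_to (fst V) h = 0.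
      z (Suc t) ^ card (fst V) * z t ^ card (snd V)) * \<zeta> ks)"
      unfolding L_def by (rule sum_two_step) (simp add: Cons)
    finally show ?thesis .
  qed
  have x': "x' (Suc t) = x t" "x' t = x (Suc t)" using assms(5) by auto
  show ?thesis
    unfolding S' S[OF \<zeta>_def[symmetric]] S[OF \<zeta>'(2)] sum_distrib_left sum_subtractf[symmetric] x'
  proof (intro sum.cong refl)
    fix ks
    show "(x (Suc t) - x t) * ((\<Sum>V | V \<in> two_step N hs (0 # ks) \<and> True.
        x (Suc t) ^ card (fst V) * x t ^ card (snd V)) * \<zeta> ks) =
      x (Suc t) * ((\<Sum>V | V \<in> two_step N hs (0 # ks) \<and> drop_to (fst V) h = 0.
        x (Suc t) ^ card (fst V) * x t ^ card (snd V)) * \<zeta> ks) -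
      x t * ((\<Sum>V | V \<in> two_step N hs (0 # ks) \<and> drop_to (fst V) h = 0.
        x t ^ card (fst V) * x (Suc t) ^ card (snd V)) * \<zeta> ks)"
      using two_step_identity[of "x (Suc t)" "x t" N h hs0 ks] Cons
      by (simp add: mult.assoc[symmetric] left_diff_distrib[symmetric])
  qed
qed

text \<open>The entries above \<open>t + 1\<close> have the same rows and the same factors in all
  three terms, so the identity at \<open>t + 1\<close> is carried through their sums.\<close>

lemma Z_swap:
  fixes x :: "nat \<Rightarrow> 'a::comm_ring_1"
  assumes "1 \<le> t" "t \<notin> S" "Suc t \<in> S" "S' = insert t (S - {Suc t})"
    and x': "x' = x(t := x (Suc t), Suc t := x t)" and "Suc t \<le> v"
  shows "(x (Suc t) - x t) * Z x N S' v hs = x (Suc t) * Z x N S v hs - x t * Z x' N S v hs"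
  using \<open>Suc t \<le> v\<close>
proof (induction v arbitrary: hs rule: dec_induct)
  case base
  then show ?case by (rule Z_swap_base[OF assms(1-5)])
next
  case (step v)
  have 1: "Suc v \<in> S' \<longleftrightarrow> Suc v \<in> S" "x' (Suc v) = x (Suc v)" using assms step by auto
  show ?case
    unfolding Z.simps 1 sum_distrib_left sum_subtractf[symmetric]
    by (intro sum.cong refl) (auto simp: mult.left_commute[of _ "x _ ^ _"] step.IH right_diff_distrib[symmetric])
qed

section \<open>Flagged Jacobi--Trudi determinants\<close>

lemma geometric_fps_inverse:
  fixes a :: "'a::comm_ring_1"
  shows "(1 - fps_const a * fps_X) * Abs_fps (\<lambda>d. a ^ d) = 1"
proof (rule fps_ext)
  fix d
  show "fps_nth ((1 - fps_const a * fps_X) * Abs_fps (\<lambda>d. a ^ d)) d = fps_nth 1 d"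
    by (cases d) (simp_all add: left_diff_distrib mult.assoc fps_mult_fps_X_commute)
qed

text \<open>The complete homogeneous symmetric polynomial of degree \<open>d\<close> in the
  variables indexed by \<open>B\<close>. As a coefficient of a product of geometric series it loses
  a variable by multiplication with \<open>1 - x b * fps_X\<close>.\<close>

definition hc :: "(nat \<Rightarrow> 'a::comm_ring_1) \<Rightarrow> nat set \<Rightarrow> nat \<Rightarrow> 'a" where
  "hc x B d = fps_nth (\<Prod>i\<in>B. Abs_fps (\<lambda>d. x i ^ d)) d"

lemma hc_0 [simp]: "hc x B 0 = 1"
  unfolding hc_def by (induction B rule: infinite_finite_induct) simp_all

lemma hc_remove:
  assumes "finite B" "b \<in> B"
  shows "hc x (B - {b}) (Suc d) = hc x B (Suc d) - x b * hc x B d"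
proof -
  let ?G = "\<lambda>i. Abs_fps (\<lambda>d. x i ^ d)"
  have "(\<Prod>i\<in>B - {b}. ?G i) = (1 - fps_const (x b) * fps_X) * ?G b * (\<Prod>i\<in>B - {b}. ?G i)"
    by (simp add: geometric_fps_inverse)
  also have "\<dots> = (1 - fps_const (x b) * fps_X) * (\<Prod>i\<in>B. ?G i)"
    using assms by (simp add: prod.remove mult.assoc)
  finally show ?thesis
    unfolding hc_def by (simp add: left_diff_distrib mult.assoc fps_mult_fps_X_commute)
qed

lemma hc_single: "hc x {b} d = x b ^ d"
  by (simp add: hc_def)

text \<open>Partial fractions for two geometric series. It describes the effect of a Demazure
  operator on a single row of the determinant.\<close>

lemma hc_swap:
  assumes "finite B" "s \<notin> B" "t \<notin> B" "s \<noteq> t"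
  shows "(x s - x t) * hc x (insert s (insert t B)) d =
    x s * hc x (insert s B) d - x t * hc x (insert t B) d"
proof -
  let ?G = "\<lambda>i. Abs_fps (\<lambda>d. x i ^ d)"
  let ?c = "\<lambda>i. 1 - fps_const (x i) * fps_X"
  let ?P = "\<Prod>i\<in>B. ?G i"
  have "fps_const (x s - x t) * (?G s * (?G t * ?P)) =
      (fps_const (x s) * ?c t - fps_const (x t) * ?c s) * (?G s * (?G t * ?P))"
    by (simp add: algebra_simps flip: fps_const_sub)
  also have "\<dots> = fps_const (x s) * (?c t * ?G t) * (?G s * ?P) -
      fps_const (x t) * (?c s * ?G s) * (?G t * ?P)"
    by (simp only: left_diff_distrib right_diff_distrib mult_ac)
  also have "\<dots> = fps_const (x s) * (?G s * ?P) - fps_const (x t) * (?G t * ?P)"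
    by (simp add: geometric_fps_inverse)
  finally have "fps_nth (fps_const (x s - x t) * (?G s * (?G t * ?P))) d =
      fps_nth (fps_const (x s) * (?G s * ?P) - fps_const (x t) * (?G t * ?P)) d" by simp
  then show ?thesis
    unfolding hc_def using assms by (simp only: fps_mult_left_const_nth fps_sub_nth) simp
qed

lemma hc_reindex:
  assumes "inj_on \<sigma> B"
  shows "hc (x \<circ> \<sigma>) B d = hc x (\<sigma> ` B) d"
  unfolding hc_def using assms by (simp add: prod.reindex)

text \<open>The flag consists of the lower ends \<open>bs ! i\<close> of the variable ranges. The
  conditional supplies the value zero for complete symmetric polynomials of negative degree, which
  truncated subtraction would hide.\<close>

definition JT_mat :: "(nat \<Rightarrow> 'a::comm_ring_1) \<Rightarrow> nat \<Rightarrow> nat list \<Rightarrow> nat list \<Rightarrow> 'a mat" where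
  "JT_mat x n bs hs = mat (length hs) (length hs)
     (\<lambda>(i, j). if i \<le> hs ! i + j then hc x {bs ! i..n} (hs ! i + j - i) else 0)"

lemma JT_mat_carrier [simp]: "JT_mat x n bs hs \<in> carrier_mat (length hs) (length hs)"
  by (simp add: JT_mat_def)

text \<open>The first row involves only the variable \<open>v + 1\<close>, so its entries are
  consecutive powers. Subtracting \<open>x (Suc v)\<close> times each column from the next clears
  this row after its first entry, and in the other rows removes the variable
  \<open>v + 1\<close>.\<close>

lemma det_JT_mat_Cons:
  fixes x :: "nat \<Rightarrow> 'a::comm_ring_1"
  assumes "length bs = length hs" "\<And>b. b \<in> set bs \<Longrightarrow> b \<le> v"
  shows "det (JT_mat x (Suc v) (Suc v # bs) (h # hs)) = x (Suc v) ^ h * det (JT_mat x v bs hs)"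
proof -
  define m where "m = length hs"
  define A where "A = JT_mat x (Suc v) (Suc v # bs) (h # hs)"
  \<comment> \<open>The unitriangular matrix of these column operations.\<close>
  define U where "U = mat (Suc m) (Suc m) (\<lambda>(i, j). (if i = j then 1 else 0) +
    (if Suc i = j then - x (Suc v) else 0))"
  have A: "A \<in> carrier_mat (Suc m) (Suc m)" using JT_mat_carrier[of x "Suc v" "Suc v # bs" "h # hs"]
    by (simp add: A_def m_def)
  have U: "U \<in> carrier_mat (Suc m) (Suc m)" by (simp add: U_def)
  have "det U = 1"
  proof -
    have "upper_triangular U" by (auto simp: U_def)
    then have "det U = prod_list (diag_mat U)" using U by (rule det_upper_triangular)
    also have "\<dots> = 1" unfolding prod_list_diag_prod by (rule prod.neutral) (auto simp: U_def)
    finally show ?thesis .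
  qed
  then have "det A = det (A * U)" using det_mult[OF A U] by simp
  have AU: "A * U \<in> carrier_mat (Suc m) (Suc m)" using A U by simp
  have AU0: "(A * U) $$ (i, 0) = A $$ (i, 0)" if "i < Suc m" for i
  proof -
    have "(A * U) $$ (i, 0) = (\<Sum>k = 0..<Suc m. A $$ (i, k) * U $$ (k, 0))"
      using A U that by (simp add: scalar_prod_def)
    also have "\<dots> = (\<Sum>k = 0..<Suc m. if k = 0 then A $$ (i, 0) else 0)"
      by (rule sum.cong) (auto simp: U_def)
    finally show ?thesis by simp
  qed
  have AUS: "(A * U) $$ (i, Suc j) = A $$ (i, Suc j) - x (Suc v) * A $$ (i, j)"
    if "i < Suc m" "j < m" for i j
  proof -
    have "(A * U) $$ (i, Suc j) = (\<Sum>k = 0..<Suc m. A $$ (i, k) * U $$ (k, Suc j))"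
      using A U that by (simp add: scalar_prod_def)
    also have "\<dots> = (\<Sum>k = 0..<Suc m. (if k = Suc j then A $$ (i, Suc j) else 0) +
        (if k = j then - x (Suc v) * A $$ (i, j) else 0))"
      using that by (intro sum.cong) (auto simp: U_def)
    finally show ?thesis using that by (simp add: sum.distrib)
  qed
  have row0: "(A * U) $$ (0, j) = (if j = 0 then x (Suc v) ^ h else 0)" if "j < Suc m" for j
  proof (cases j)
    case 0
    then show ?thesis using AU0[of 0] by (simp add: A_def JT_mat_def hc_single)
  next
    case (Suc j')
    then show ?thesis using AUS[of 0 j'] that
      by (simp add: A_def JT_mat_def hc_single m_def)
  qed
  have "det (A * U) = (\<Sum>j<Suc m. (A * U) $$ (0, j) * cofactor (A * U) 0 j)"
    by (rule laplace_expansion_row[OF AU]) simp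
  also have "\<dots> = (\<Sum>j<Suc m. if j = 0 then x (Suc v) ^ h * cofactor (A * U) 0 0 else 0)"
    by (intro sum.cong) (auto simp: row0)
  also have "\<dots> = x (Suc v) ^ h * det (mat_delete (A * U) 0 0)"
    by (simp add: cofactor_def)
  also have "mat_delete (A * U) 0 0 = JT_mat x v bs hs"
  proof (rule eq_matI)
    fix i j assume "i < dim_row (JT_mat x v bs hs)" "j < dim_col (JT_mat x v bs hs)"
    then have ij: "i < m" "j < m" by (auto simp: JT_mat_def m_def)
    then have bi: "bs ! i \<le> v" using assms by (auto simp: m_def)
    then have B: "{bs ! i..Suc v} - {Suc v} = {bs ! i..v}" by auto
    have "mat_delete (A * U) 0 0 $$ (i, j) = (A * U) $$ (Suc i, Suc j)"
      using ij A U by (simp add: mat_delete_def)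
    also have "\<dots> = A $$ (Suc i, Suc j) - x (Suc v) * A $$ (Suc i, j)"
      using ij by (intro AUS) auto
    also have "\<dots> = JT_mat x v bs hs $$ (i, j)"
    proof -
      consider "hs ! i + j < i" | "hs ! i + j = i" | e where "hs ! i + j = i + Suc e"
        by (metis add_Suc_right less_imp_Suc_add linorder_less_linear)
      then show ?thesis
      proof cases
        case 3
        have "hc x {bs ! i..v} (Suc e) = hc x {bs ! i..Suc v} (Suc e) - x (Suc v) * hc x {bs ! i..Suc v} e"
          using hc_remove[of "{bs ! i..Suc v}" "Suc v" x e] bi B by simp
        then show ?thesis using 3 ij by (simp add: A_def JT_mat_def m_def)
      qed (use ij in \<open>auto simp: A_def JT_mat_def m_def\<close>)
    qed
    finally show "mat_delete (A * U) 0 0 $$ (i, j) = JT_mat x v bs hs $$ (i, j)" .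
  qed (use AU in \<open>auto simp: mat_delete_def JT_mat_def m_def\<close>)
  finally show ?thesis using \<open>det A = det (A * U)\<close> by (simp add: A_def)
qed

text \<open>Since \<open>t\<close> is not a base and \<open>t + 1\<close> is the base of row
  \<open>p\<close> alone, every other row contains both or neither of the two variables and is
  symmetric in them. Expansion along row \<open>p\<close> reduces the claim to
  \<open>hc_swap\<close>.\<close>

lemma det_JT_mat_swap:
  fixes x :: "nat \<Rightarrow> 'a::comm_ring_1"
  assumes len: "length bs = length hs" and p: "p < length bs" "bs ! p = Suc t"
    and t: "t \<notin> set bs" "Suc t \<le> n" and dist: "distinct bs"
    and x': "x' = x(t := x (Suc t), Suc t := x t)"
  shows "(x (Suc t) - x t) * det (JT_mat x n (bs[p := t]) hs) =
    x (Suc t) * det (JT_mat x n bs hs) - x t * det (JT_mat x' n bs hs)"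
proof -
  let ?A = "JT_mat x n (bs[p := t]) hs" and ?B = "JT_mat x n bs hs" and ?C = "JT_mat x' n bs hs"
  let ?m = "length hs"
  let ?\<tau> = "\<lambda>i. if i = t then Suc t else if i = Suc t then t else i"
  have x'\<tau>: "x' = x \<circ> ?\<tau>" using x' by auto
  have inj: "inj_on ?\<tau> B" for B by (rule inj_onI) (auto split: if_splits)
  have other: "hc x' {b..n} d = hc x {b..n} d" if "b \<noteq> Suc t" for b d
  proof -
    have "?\<tau> ` {b..n} = {b..n}"
    proof (cases "b \<le> t")
      case True
      then have "t \<in> {b..n}" "Suc t \<in> {b..n}" using t by auto
      then show ?thesis
        by (intro equalityI subsetI) (auto simp: image_iff split: if_splits intro: rev_bexI[of "?\<tau> _"])
    next
      case False
      then show ?thesis using that by (intro image_cong[THEN trans, OF refl _ image_ident]) auto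
    qed
    then show ?thesis unfolding x'\<tau> hc_reindex[OF inj] by simp
  qed
  have cof: "cofactor ?A p j = cofactor ?B p j" "cofactor ?C p j = cofactor ?B p j" for j
  proof -
    have "mat_delete ?A p j = mat_delete ?B p j"
      unfolding mat_delete_def JT_mat_def by (intro cong_mat) auto
    moreover have "mat_delete ?C p j = mat_delete ?B p j"
    proof (rule eq_matI)
      fix i k assume "i < dim_row (mat_delete ?B p j)" "k < dim_col (mat_delete ?B p j)"
      then have ik: "i < ?m - 1" "k < ?m - 1" by (auto simp: mat_delete_def JT_mat_def)
      define i' where "i' = (if i < p then i else Suc i)"
      have "i' < length bs" "i' \<noteq> p" using ik len by (auto simp: i'_def)
      then have "bs ! i' \<noteq> Suc t" using p dist nth_eq_iff_index_eq[of bs i' p] by auto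
      then show "mat_delete ?C p j $$ (i, k) = mat_delete ?B p j $$ (i, k)"
        using ik \<open>i' < length bs\<close> len
        by (simp add: mat_delete_def JT_mat_def i'_def[symmetric] other)
    qed (auto simp: mat_delete_def JT_mat_def)
    ultimately show "cofactor ?A p j = cofactor ?B p j" "cofactor ?C p j = cofactor ?B p j"
      by (simp_all add: cofactor_def)
  qed
  have row: "(x (Suc t) - x t) * ?A $$ (p, j) = x (Suc t) * ?B $$ (p, j) - x t * ?C $$ (p, j)"
    if "j < ?m" for j
  proof -
    let ?R = "{Suc (Suc t)..n}"
    have 1: "{t..n} = insert (Suc t) (insert t ?R)" "{Suc t..n} = insert (Suc t) ?R"
      using t by auto
    have 2: "?\<tau> ` {Suc t..n} = insert t ?R"
    proof -
      have R: "?\<tau> ` ?R = ?R" by (intro image_cong[THEN trans, OF refl _ image_ident]) auto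
      show ?thesis unfolding 1 image_insert R by simp
    qed
    have "(x (Suc t) - x t) * hc x {t..n} d = x (Suc t) * hc x {Suc t..n} d - x t * hc x' {Suc t..n} d" for d
      unfolding x'\<tau> hc_reindex[OF inj] 2 unfolding 1 by (rule hc_swap) auto
    then show ?thesis using that p len by (simp add: JT_mat_def)
  qed
  have pm: "p < ?m" using p len by simp
  show ?thesis
    unfolding laplace_expansion_row[OF JT_mat_carrier pm] cof sum_distrib_left sum_subtractf[symmetric]
  proof (intro sum.cong refl)
    fix j assume "j \<in> {..<?m}"
    then have "(x (Suc t) - x t) * ?A $$ (p, j) * cofactor ?B p j =
        (x (Suc t) * ?B $$ (p, j) - x t * ?C $$ (p, j)) * cofactor ?B p j"
      by (simp only: row lessThan_iff)
    then show "(x (Suc t) - x t) * (?A $$ (p, j) * cofactor ?B p j) =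
        x (Suc t) * (?B $$ (p, j) * cofactor ?B p j) - x t * (?C $$ (p, j) * cofactor ?B p j)"
      by (simp only: mult.assoc left_diff_distrib)
  qed
qed

section \<open>The generating function equals the determinant\<close>

lemma final_rest_id:
  assumes "\<And>k i. k \<in> set hs \<Longrightarrow> i \<in> R \<Longrightarrow> 1 \<le> i \<Longrightarrow> k < i"
  shows "final hs R = hs \<and> rest hs R = R"
  using assms
proof (induction hs)
  case (Cons k hs)
  have "drop_to R k = k"
    using Cons.prems[of k k] by (intro drop_to_eqI) (auto simp: Suc_le_eq)
  then show ?case using Cons by simp
qed simp

text \<open>The first column must be emptied at once, so it consumes exactly the rows
  \<open>1\<close> to \<open>h\<close>. No other particle is higher than \<open>h\<close>, so any
  further row would be left over; a single summand survives.\<close>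

lemma Z_Cons_top:
  assumes "Suc v \<in> S" "h \<le> N" "\<And>k. k \<in> set hs \<Longrightarrow> k \<le> h"
  shows "Z x N S (Suc v) (h # hs) = x (Suc v) ^ h * Z x N S v hs"
proof -
  let ?f = "\<lambda>P. if rest (h # hs) P = {} then
     x (Suc v) ^ card P * (if drop_to P h = 0 then Z x N S v (tl (final (h # hs) P)) else 0) else 0"
  have top: "rest (h # hs) {1..h} = {} \<and> drop_to {1..h} h = 0 \<and> final (h # hs) {1..h} = 0 # hs"
  proof -
    have "drop_to {1..h} h = 0" by (rule drop_to_eqI) auto
    moreover have "{1..h} - {0<..h} = {}" by auto
    ultimately show ?thesis using final_rest_id[of hs "{}"] by simp
  qed
  have "Z x N S (Suc v) (h # hs) = (\<Sum>P\<in>Pow {1..N}. ?f P)"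
    using assms(1) by (auto intro!: sum.cong)
  also have "\<dots> = (\<Sum>P\<in>{{1..h}}. ?f P)"
  proof (rule sum.mono_neutral_right)
    show "\<forall>P\<in>Pow {1..N} - {{1..h}}. ?f P = 0"
    proof
      fix P assume P: "P \<in> Pow {1..N} - {{1..h}}"
      have "P = {1..h}" if r: "rest (h # hs) P = {}" and d: "drop_to P h = 0"
      proof -
        have sub: "{0<..h} \<subseteq> P" using drop_to_run[of P h] d by simp
        let ?R = "P - {0<..h}"
        have "rest hs ?R = {}" using r d by simp
        moreover have "rest hs ?R = ?R"
          using final_rest_id[of hs ?R] assms(3) by (force simp: not_le)
        ultimately have "P \<subseteq> {0<..h}" by auto
        then show ?thesis using sub by auto
      qed
      then show "?f P = 0" using P by auto
    qed
  qed (use assms(2) in auto)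
  also have "\<dots> = x (Suc v) ^ h * Z x N S v hs"
  proof -
    have "rest (h # hs) {1..h} = {}" "drop_to {1..h} h = 0" "tl (final (h # hs) {1..h}) = hs"
      using top by (simp_all del: final.simps rest.simps)
    then show ?thesis by (simp del: final.simps rest.simps)
  qed
  finally show ?thesis .
qed

lemma Z_Nil:
  assumes "S \<inter> {1..v} = {}"
  shows "Z x N S v [] = 1"
  using assms
proof (induction v)
  case (Suc v)
  have "Suc v \<in> {1..Suc v}" by simp
  then have "Suc v \<notin> S" using Suc.prems by blast
  moreover have "S \<inter> {1..v} = {}" using Suc.prems by fastforce
  ultimately have "Z x N S (Suc v) [] = (\<Sum>P\<in>Pow {1..N}. if P = {} then 1 else 0)"
    using Suc.IH by (auto intro!: sum.cong)
  then show ?case by simp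
qed simp

text \<open>The dominant case: the bases form an interval ending at \<open>n\<close>, or there are
  none, and both sides lose the same power of the largest variable at each step.\<close>

lemma Z_eq_det_top:
  assumes "sorted_wrt (>) bs" "set bs \<subseteq> {1..n}" "sorted_wrt (\<ge>) hs" "length bs = length hs"
    "set hs \<subseteq> {..N}" "\<And>b. b \<in> set bs \<Longrightarrow> b < n \<Longrightarrow> Suc b \<in> set bs"
  shows "Z x N (set bs) n hs = det (JT_mat x n bs hs)"
  using assms
proof (induction n arbitrary: bs hs)
  case 0
  then show ?case by (simp add: JT_mat_def)
next
  case (Suc n)
  show ?case
  proof (cases bs)
    case Nil
    then show ?thesis using Suc.prems Z_Nil[of "{}" "Suc n" x N] by (simp add: JT_mat_def)
  next
    case (Cons b bs0)
    then obtain h hs0 where hs: "hs = h # hs0" using Suc.prems by (cases hs) auto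
    have b: "b = Suc n"
    proof (rule ccontr)
      assume "b \<noteq> Suc n"
      then have "b < Suc n" using Suc.prems Cons by auto
      then have "Suc b \<in> set bs0" using Suc.prems(6)[of b] Cons by auto
      then show False using Suc.prems(1) Cons by auto
    qed
    have lt: "b \<le> n" if "b \<in> set bs0" for b using Suc.prems(1) Cons b that by auto
    have IH: "Z x N (set bs0) n hs0 = det (JT_mat x n bs0 hs0)"
    proof (rule Suc.IH)
      show "Suc c \<in> set bs0" if "c \<in> set bs0" "c < n" for c
        using Suc.prems(6)[of c] that Cons b by auto
      show "set bs0 \<subseteq> {1..n}" using lt Suc.prems Cons by auto
    qed (use Suc.prems Cons hs in auto)
    have "Z x N (set bs) (Suc n) hs = x (Suc n) ^ h * Z x N (set bs) n hs0"
      unfolding hs by (rule Z_Cons_top) (use Suc.prems Cons hs b in auto)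
    also have "Z x N (set bs) n hs0 = Z x N (set bs0) n hs0"
      by (rule Z_cong) (auto simp: Cons b)
    also have "x (Suc n) ^ h * Z x N (set bs0) n hs0 = det (JT_mat x (Suc n) bs hs)"
      unfolding IH Cons b hs by (rule det_JT_mat_Cons[symmetric]) (use Suc.prems Cons hs lt in auto)
    finally show ?thesis .
  qed
qed

lemma sorted_wrt_greater_distinct: "sorted_wrt (>) bs \<Longrightarrow> distinct bs" for bs :: "nat list"
  by (induction bs) auto

text \<open>A base \<open>t\<close> with \<open>t + 1\<close> free is raised, which increases the
  sum of the bases, until no gap is left. The recursion refers to the assignment with two values
  exchanged, so \<open>x\<close> varies in the induction; injectivity of \<open>x\<close> and the
  integral domain allow the factor \<open>x (Suc t) - x t\<close> to be cancelled.\<close>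

lemma Z_eq_det:
  fixes x :: "nat \<Rightarrow> 'a::idom"
  assumes "inj_on x {1..n}" "sorted_wrt (>) bs" "set bs \<subseteq> {1..n}" "sorted_wrt (\<ge>) hs"
    "length bs = length hs" "set hs \<subseteq> {..N}"
  shows "Z x N (set bs) n hs = det (JT_mat x n bs hs)"
  using assms
proof (induction "length hs * n - sum_list bs" arbitrary: x bs rule: less_induct)
  case less
  show ?case
  proof (cases "\<forall>b\<in>set bs. b < n \<longrightarrow> Suc b \<in> set bs")
    case True
    then show ?thesis using less.prems by (intro Z_eq_det_top) auto
  next
    case False
    then obtain p where p: "p < length bs" "bs ! p < n" "Suc (bs ! p) \<notin> set bs"
      by (auto simp: in_set_conv_nth)
    define t where "t = bs ! p"
    define cs where "cs = bs[p := Suc t]"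
    define x' where "x' = x(t := x (Suc t), Suc t := x t)"
    have "t \<in> set bs" using p by (simp add: t_def)
    moreover from this have "t \<in> {1..n}" using less.prems(3) by blast
    ultimately have t: "1 \<le> t" "Suc t \<le> n" "t \<in> set bs" "Suc t \<notin> set bs"
      using p by (auto simp: t_def)
    have dist: "distinct bs" using less.prems(2) by (rule sorted_wrt_greater_distinct)
    have bs: "bs = cs[p := t]" by (simp add: cs_def t_def)
    have set_cs: "set cs = insert (Suc t) (set bs - {t})"
      unfolding cs_def using set_update_distinct[OF dist p(1)] by (simp add: t_def)
    have dist_cs: "distinct cs" unfolding cs_def using dist t by (simp add: distinct_list_update)
    have sorted_cs: "sorted_wrt (>) cs"
    proof (unfold sorted_wrt_iff_nth_less, intro allI impI)
      fix i j assume ij: "i < j" "j < length cs"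
      then have jl: "j < length bs" by (simp add: cs_def)
      have lt: "bs ! j < bs ! i" using less.prems(2) ij jl by (auto simp: sorted_wrt_iff_nth_less)
      have "bs ! i \<noteq> Suc t" using t(4) ij jl by (metis nth_mem order.strict_trans)
      then show "cs ! i > cs ! j" using lt ij jl p by (auto simp: cs_def nth_list_update t_def)
    qed
    have sub_cs: "set cs \<subseteq> {1..n}" using less.prems(3) t by (auto simp: set_cs)
    have "sum_list cs = Suc (sum_list bs)"
      using p by (simp add: cs_def sum_list_update t_def elem_le_sum_list)
    moreover have "sum_list cs \<le> length hs * n"
    proof -
      have "sum_list cs \<le> (\<Sum>i\<leftarrow>cs. n)"
        using sub_cs by (intro sum_list_mono[of cs "\<lambda>i. i" "\<lambda>_. n", simplified]) auto
      then show ?thesis using less.prems(5) by (simp add: sum_list_triv cs_def)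
    qed
    ultimately have meas: "length hs * n - sum_list cs < length hs * n - sum_list bs" by linarith
    have IH: "Z y N (set cs) n hs = det (JT_mat y n cs hs)" if "inj_on y {1..n}" for y :: "nat \<Rightarrow> 'a"
      by (rule less.hyps[OF meas that sorted_cs sub_cs]) (use less.prems in \<open>auto simp: cs_def\<close>)
    have injx': "inj_on x' {1..n}"
    proof (rule inj_onI)
      fix i j assume ij: "i \<in> {1..n}" "j \<in> {1..n}" "x' i = x' j"
      let ?\<tau> = "\<lambda>i. if i = t then Suc t else if i = Suc t then t else i"
      have "x (?\<tau> i) = x (?\<tau> j)" using ij(3) by (auto simp: x'_def)
      moreover have "?\<tau> i \<in> {1..n}" "?\<tau> j \<in> {1..n}" using ij t by auto
      ultimately have "?\<tau> i = ?\<tau> j" using less.prems(1) by (blast dest: inj_onD)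
      then show "i = j" by (auto split: if_splits)
    qed
    have neq: "x (Suc t) - x t \<noteq> 0"
      using less.prems(1) t inj_onD[of x "{1..n}" "Suc t" t] by auto
    have "(x (Suc t) - x t) * Z x N (set bs) n hs =
        x (Suc t) * Z x N (set cs) n hs - x t * Z x' N (set cs) n hs"
    proof (rule Z_swap[OF _ _ _ _ x'_def])
      show "set bs = insert t (set cs - {Suc t})" using t by (auto simp: set_cs)
    qed (use t in \<open>auto simp: set_cs\<close>)
    also have "\<dots> = x (Suc t) * det (JT_mat x n cs hs) - x t * det (JT_mat x' n cs hs)"
      using IH less.prems(1) injx' by simp
    also have "\<dots> = (x (Suc t) - x t) * det (JT_mat x n (cs[p := t]) hs)"
      by (rule det_JT_mat_swap[symmetric, OF _ _ _ _ _ dist_cs x'_def])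
        (use p t less.prems in \<open>auto simp: cs_def set_cs[unfolded cs_def]\<close>)
    finally show ?thesis using neq bs by simp
  qed
qed

section \<open>Skyline fillings as particle processes\<close>

text \<open>One pass seen from the columns: \<open>a\<close> and \<open>a'\<close> are the heights
  before and after, \<open>P\<close> the rows of the removed entry. The second interval includes its
  lower end because the column further right has priority and stops only at a row outside
  \<open>P\<close>, so columns to its left cannot use that row.\<close>

definition valid_step :: "nat set \<Rightarrow> (nat \<Rightarrow> nat) \<Rightarrow> (nat \<Rightarrow> nat) \<Rightarrow> nat set \<Rightarrow> bool" where
  "valid_step S a a' P \<longleftrightarrow> (\<forall>s\<in>S. a' s \<le> a s) \<and>
     (\<forall>i\<in>S. \<forall>j\<in>S. i < j \<longrightarrow> {a' i<..a i} \<inter> {a' j..a j} = {}) \<and>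
     P = (\<Union>s\<in>S. {a' s<..a s})"

text \<open>The rightmost column is forced to fall as \<open>drop_to\<close> prescribes, and the
  other columns satisfy the same condition for the rows it leaves. In particular \<open>P\<close>
  and the old heights determine the new ones.\<close>

lemma valid_step_iff:
  assumes "sorted_wrt (>) L"
  shows "valid_step (set L) a a' P \<longleftrightarrow> rest (map a L) P = {} \<and> map a' L = final (map a L) P"
  using assms
proof (induction L arbitrary: P)
  case Nil
  then show ?case by (auto simp: valid_step_def)
next
  case (Cons j L)
  let ?I = "{a' j<..a j}"
  have less: "i < j" if "i \<in> set L" for i using Cons.prems that by auto
  have IH: "valid_step (set L) a a' (P - ?I) \<longleftrightarrow>
      rest (map a L) (P - ?I) = {} \<and> map a' L = final (map a L) (P - ?I)"
    using Cons by auto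
  show ?case
  proof
    assume v: "valid_step (set (j # L)) a a' P"
    then have P: "P = ?I \<union> (\<Union>s\<in>set L. {a' s<..a s})" and le: "a' j \<le> a j"
      and dis: "\<And>i. i \<in> set L \<Longrightarrow> {a' i<..a i} \<inter> {a' j..a j} = {}"
      using less by (auto simp: valid_step_def)
    have "a' j \<notin> {a' i<..a i}" if "i \<in> set L" for i
    proof -
      have "a' j \<in> {a' j..a j}" using le by simp
      then show ?thesis using dis[OF that] by blast
    qed
    then have "a' j \<notin> P" by (auto simp: P)
    then have drop: "drop_to P (a j) = a' j" using le P by (intro drop_to_eqI) auto
    have "P - ?I = (\<Union>s\<in>set L. {a' s<..a s})"
    proof -
      have "?I \<inter> (\<Union>s\<in>set L. {a' s<..a s}) = {}" using dis by fastforce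
      then show ?thesis unfolding P by blast
    qed
    then have "valid_step (set L) a a' (P - ?I)" using v by (auto simp: valid_step_def)
    then show "rest (map a (j # L)) P = {} \<and> map a' (j # L) = final (map a (j # L)) P"
      using IH drop by simp
  next
    assume r: "rest (map a (j # L)) P = {} \<and> map a' (j # L) = final (map a (j # L)) P"
    then have drop: "drop_to P (a j) = a' j" by simp
    then have v: "valid_step (set L) a a' (P - ?I)" using IH r by simp
    have le: "a' j \<le> a j" and sub: "?I \<subseteq> P" and stop: "a' j = 0 \<or> a' j \<notin> P"
      using drop_to_le[of P "a j"] drop_to_run[of P "a j"] drop_to_stop[of P "a j"] drop by auto
    have PI: "P - ?I = (\<Union>s\<in>set L. {a' s<..a s})" using v by (simp add: valid_step_def)
    have dis: "{a' i<..a i} \<inter> {a' j..a j} = {}" if "i \<in> set L" for i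
    proof -
      have "{a' i<..a i} \<subseteq> P - ?I" using PI that by auto
      moreover have "a' j \<notin> {a' i<..a i}" using stop calculation by auto
      ultimately show ?thesis by fastforce
    qed
    have "P = ?I \<union> (P - ?I)" using sub by auto
    then have "P = (\<Union>s\<in>set (j # L). {a' s<..a s})" using PI by auto
    moreover have "{a' i<..a i} \<inter> {a' k..a k} = {}" if "i \<in> set (j # L)" "k \<in> set (j # L)" "i < k" for i k
    proof (cases "k = j")
      case True
      then show ?thesis using dis that by auto
    next
      case False
      then have "k \<in> set L" "i \<in> set L" using that less by fastforce+
      then show ?thesis using v that by (simp add: valid_step_def)
    qed
    ultimately show "valid_step (set (j # L)) a a' P"
      using v le by (auto simp: valid_step_def)
  qed
qed

abbreviation columns :: "nat set \<Rightarrow> (nat \<Rightarrow> nat) \<Rightarrow> (nat \<times> nat) set" where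
  "columns S a \<equiv> SIGMA s:S. {1..a s}"

text \<open>The skyline fillings with entries \<open>i\<close> replaced by \<open>n + 1 - i\<close> and empty columns removed. The last
  condition unifies both types of triples: entries above the top of column \<open>j\<close> count as infinite.\<close>

definition Fill :: "nat set \<Rightarrow> nat \<Rightarrow> (nat \<Rightarrow> nat) \<Rightarrow> (nat \<times> nat \<Rightarrow> nat) set" where
  "Fill S v a = {F \<in> extensional (columns S a).
     (\<forall>s\<in>S. \<forall>r\<in>{1..a s}. s \<le> F (s, r) \<and> F (s, r) \<le> v) \<and>
     (\<forall>s\<in>S. \<forall>r. 1 \<le> r \<and> r < a s \<longrightarrow> F (s, r) \<le> F (s, Suc r)) \<and>
     (\<forall>i\<in>S. \<forall>j\<in>S. i < j \<longrightarrow> (\<forall>r. 1 \<le> r \<and> r \<le> a i \<and> r \<le> a j \<longrightarrow>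
        F (i, r) < F (j, r) \<or> (r < a j \<and> F (j, Suc r) < F (i, r))))}"

lemma FillI:
  assumes "F \<in> extensional (columns S a)"
    "\<And>s r. s \<in> S \<Longrightarrow> 1 \<le> r \<Longrightarrow> r \<le> a s \<Longrightarrow> s \<le> F (s, r) \<and> F (s, r) \<le> v"
    "\<And>s r. s \<in> S \<Longrightarrow> 1 \<le> r \<Longrightarrow> r < a s \<Longrightarrow> F (s, r) \<le> F (s, Suc r)"
    "\<And>i j r. i \<in> S \<Longrightarrow> j \<in> S \<Longrightarrow> i < j \<Longrightarrow> 1 \<le> r \<Longrightarrow> r \<le> a i \<Longrightarrow> r \<le> a j \<Longrightarrow>
        F (i, r) < F (j, r) \<or> (r < a j \<and> F (j, Suc r) < F (i, r))"
  shows "F \<in> Fill S v a"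
  using assms unfolding Fill_def by simp

lemma FillD:
  assumes "F \<in> Fill S v a"
  shows "F \<in> extensional (columns S a)"
    "\<And>s r. s \<in> S \<Longrightarrow> 1 \<le> r \<Longrightarrow> r \<le> a s \<Longrightarrow> s \<le> F (s, r) \<and> F (s, r) \<le> v"
    "\<And>s r. s \<in> S \<Longrightarrow> 1 \<le> r \<Longrightarrow> r < a s \<Longrightarrow> F (s, r) \<le> F (s, Suc r)"
    "\<And>i j r. i \<in> S \<Longrightarrow> j \<in> S \<Longrightarrow> i < j \<Longrightarrow> 1 \<le> r \<Longrightarrow> r \<le> a i \<Longrightarrow> r \<le> a j \<Longrightarrow>
        F (i, r) < F (j, r) \<or> (r < a j \<and> F (j, Suc r) < F (i, r))"
  using assms unfolding Fill_def by simp_all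

lemma Fill_mono:
  assumes F: "F \<in> Fill S v a" and "s \<in> S" "1 \<le> r" "r \<le> r'" "r' \<le> a s"
  shows "F (s, r) \<le> F (s, r')"
  using assms(4,5)
proof (induction r' rule: dec_induct)
  case (step q)
  then show ?case using FillD(3)[OF F assms(2), of q] assms(3) by simp
qed simp

lemma finite_Fill:
  assumes "finite S"
  shows "finite (Fill S v a)"
proof (rule finite_subset)
  show "Fill S v a \<subseteq> columns S a \<rightarrow>\<^sub>E {..v}"
    using FillD(1,2) by (auto simp: PiE_def)
  show "finite (columns S a \<rightarrow>\<^sub>E {..v})"
    using assms by (intro finite_PiE) auto
qed

definition new_rows :: "nat set \<Rightarrow> nat \<Rightarrow> (nat \<Rightarrow> nat) \<Rightarrow> (nat \<times> nat \<Rightarrow> nat) \<Rightarrow> nat set" where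
  "new_rows S v a F = {r. \<exists>s\<in>S. 1 \<le> r \<and> r \<le> a s \<and> F (s, r) = v}"

definition old_height :: "nat \<Rightarrow> (nat \<Rightarrow> nat) \<Rightarrow> (nat \<times> nat \<Rightarrow> nat) \<Rightarrow> nat \<Rightarrow> nat" where
  "old_height v a F s = card {r \<in> {1..a s}. F (s, r) \<le> v}"

lemma old_height_iff:
  assumes F: "F \<in> Fill S w a" and s: "s \<in> S" and r: "1 \<le> r" "r \<le> a s"
  shows "F (s, r) \<le> v \<longleftrightarrow> r \<le> old_height v a F s"
proof
  let ?A = "{r \<in> {1..a s}. F (s, r) \<le> v}"
  assume "F (s, r) \<le> v"
  then have "F (s, q) \<le> v" if "1 \<le> q" "q \<le> r" for q
    using Fill_mono[OF F s that r(2)] by simp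
  then have "{1..r} \<subseteq> ?A" using r by auto
  then have "card {1..r} \<le> card ?A" by (intro card_mono) auto
  then show "r \<le> old_height v a F s" by (simp add: old_height_def)
next
  let ?A = "{r \<in> {1..a s}. F (s, r) \<le> v}"
  assume le: "r \<le> old_height v a F s"
  show "F (s, r) \<le> v"
  proof (rule ccontr)
    assume "\<not> F (s, r) \<le> v"
    then have "?A \<subseteq> {1..<r}"
      using Fill_mono[OF F s r(1)] by (force simp: not_le)
    then have "card ?A \<le> card {1..<r}" by (intro card_mono) auto
    then show False using le r by (simp add: old_height_def)
  qed
qed

lemma old_height_le: "old_height v a F s \<le> a s"
proof -
  have "card {r \<in> {1..a s}. F (s, r) \<le> v} \<le> card {1..a s}" by (rule card_mono) auto
  then show ?thesis by (simp add: old_height_def)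
qed

lemma valid_step_Fill:
  assumes F: "F \<in> Fill S (Suc v) a"
  shows "valid_step S a (old_height v a F) (new_rows S (Suc v) a F)"
  unfolding valid_step_def
proof (intro conjI ballI impI)
  let ?h = "old_height v a F"
  show "?h s \<le> a s" for s by (rule old_height_le)
  have new: "F (s, r) = Suc v \<longleftrightarrow> ?h s < r" if "s \<in> S" "1 \<le> r" "r \<le> a s" for s r
    using old_height_iff[OF F that, of v] FillD(2)[OF F that] by auto
  show "{?h i<..a i} \<inter> {?h j..a j} = {}" if ij: "i \<in> S" "j \<in> S" "i < j" for i j
  proof (rule ccontr)
    assume "{?h i<..a i} \<inter> {?h j..a j} \<noteq> {}"
    then obtain r where r: "?h i < r" "r \<le> a i" "?h j \<le> r" "r \<le> a j" by auto
    have Fi: "F (i, r) = Suc v" using new[of i r] ij r by simp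
    have "F (j, r) \<le> Suc v" using FillD(2)[OF F ij(2), of r] r by simp
    \<comment> \<open>\<open>F (i, r)\<close> has the maximal value, so only the second alternative
      of the triple condition is left; it places an old entry in row \<open>r + 1\<close> of column
      \<open>j\<close>, above its old height.\<close>
    then have "r < a j" "F (j, Suc r) \<le> v" using FillD(4)[OF F ij, of r] Fi r by auto
    then show False using old_height_iff[OF F ij(2), of "Suc r" v] r by simp
  qed
  show "new_rows S (Suc v) a F = (\<Union>s\<in>S. {?h s<..a s})"
    using new by (fastforce simp: new_rows_def)
qed

lemma restrict_Fill:
  assumes F: "F \<in> Fill S (Suc v) a" and h: "\<And>s. s \<in> S \<Longrightarrow> a' s = old_height v a F s"
  shows "restrict F (columns S a') \<in> Fill S v a'"
proof (rule FillI)
  let ?F = "restrict F (columns S a')"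
  have le: "a' s \<le> a s" if "s \<in> S" for s using h[OF that] old_height_le by simp
  have val: "F (s, r) \<le> v \<longleftrightarrow> r \<le> a' s" if "s \<in> S" "1 \<le> r" "r \<le> a s" for s r
    using old_height_iff[OF F that] h that by simp
  show "s \<le> ?F (s, r) \<and> ?F (s, r) \<le> v" if "s \<in> S" "1 \<le> r" "r \<le> a' s" for s r
    using that FillD(2)[OF F, of s r] val[of s r] le[of s] by simp
  show "?F (s, r) \<le> ?F (s, Suc r)" if "s \<in> S" "1 \<le> r" "r < a' s" for s r
    using that FillD(3)[OF F, of s r] le[of s] by simp
  show "?F (i, r) < ?F (j, r) \<or> r < a' j \<and> ?F (j, Suc r) < ?F (i, r)"
    if ij: "i \<in> S" "j \<in> S" "i < j" "1 \<le> r" "r \<le> a' i" "r \<le> a' j" for i j r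
  proof -
    have "F (i, r) < F (j, r) \<or> r < a j \<and> F (j, Suc r) < F (i, r)"
      using FillD(4)[OF F ij(1-4)] le[of i] le[of j] ij by simp
    moreover have "F (i, r) \<le> v" using val[of i r] le[of i] ij by simp
    ultimately show ?thesis using val[of j "Suc r"] ij by auto
  qed
qed simp

lemma extend_Fill:
  assumes F: "F \<in> Fill S v a'" and step: "valid_step S a a' P"
    and top: "\<And>s. s \<in> S \<Longrightarrow> a s > 0 \<Longrightarrow> s \<le> Suc v"
  defines "G \<equiv> \<lambda>c\<in>columns S a. if c \<in> columns S a' then F c else Suc v"
  shows "G \<in> Fill S (Suc v) a" "\<And>s. s \<in> S \<Longrightarrow> old_height v a G s = a' s"
    "restrict G (columns S a') = F" "new_rows S (Suc v) a G = P"
proof -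
  have le: "a' s \<le> a s" if "s \<in> S" for s using step that by (simp add: valid_step_def)
  have G: "G (s, r) = (if r \<le> a' s then F (s, r) else Suc v)" if "s \<in> S" "1 \<le> r" "r \<le> a s" for s r
    using that by (simp add: G_def)
  have small: "F (s, r) \<le> v" if "s \<in> S" "1 \<le> r" "r \<le> a' s" for s r
    using FillD(2)[OF F that] by simp
  show mem: "G \<in> Fill S (Suc v) a"
  proof (rule FillI)
    show "G \<in> extensional (columns S a)" by (simp add: G_def)
    show "s \<le> G (s, r) \<and> G (s, r) \<le> Suc v" if "s \<in> S" "1 \<le> r" "r \<le> a s" for s r
      using G[OF that] FillD(2)[OF F, of s r] top[of s] that by auto
    show "G (s, r) \<le> G (s, Suc r)" if "s \<in> S" "1 \<le> r" "r < a s" for s r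
      using G[of s r] G[of s "Suc r"] small[of s r] FillD(3)[OF F, of s r] that by auto
    show "G (i, r) < G (j, r) \<or> r < a j \<and> G (j, Suc r) < G (i, r)"
      if ij: "i \<in> S" "j \<in> S" "i < j" "1 \<le> r" "r \<le> a i" "r \<le> a j" for i j r
    proof (cases "r \<le> a' i")
      case True
      have Gi: "G (i, r) = F (i, r)" "F (i, r) \<le> v" using G[of i r] small[of i r] True ij by auto
      show ?thesis
      proof (cases "r \<le> a' j")
        case rj: True
        then have "F (i, r) < F (j, r) \<or> r < a' j \<and> F (j, Suc r) < F (i, r)"
          using FillD(4)[OF F ij(1-4)] True by simp
        then show ?thesis using Gi G[of j r] G[of j "Suc r"] rj le[of j] ij by auto
      next
        case False
        then show ?thesis using Gi G[of j r] ij by simp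
      qed
    next
      case False
      then have "r \<in> {a' i<..a i}" using ij by simp
      moreover have "{a' i<..a i} \<inter> {a' j..a j} = {}" using step ij by (simp add: valid_step_def)
      \<comment> \<open>Strict because of the closed lower end in \<open>valid_step\<close>; hence
        the next cell up in column \<open>j\<close> is still old and carries a smaller
        entry.\<close>
      ultimately have "r < a' j" using ij by force
      then have "G (j, Suc r) = F (j, Suc r)" "F (j, Suc r) \<le> v" "r < a j"
        using G[of j "Suc r"] small[of j "Suc r"] le[of j] ij by auto
      then show ?thesis using G[of i r] False ij by simp
    qed
  qed
  have val: "G (s, r) \<le> v \<longleftrightarrow> r \<le> a' s" if "s \<in> S" "1 \<le> r" "r \<le> a s" for s r
    using G[OF that] small that by auto
  show oh: "old_height v a G s = a' s" if "s \<in> S" for s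
  proof -
    have "{r \<in> {1..a s}. G (s, r) \<le> v} = {1..a' s}" using val[OF that] le[OF that] by auto
    then show ?thesis by (simp add: old_height_def)
  qed
  show "restrict G (columns S a') = F"
  proof
    fix c
    show "restrict G (columns S a') c = F c"
    proof (cases "c \<in> columns S a'")
      case True
      then have "c \<in> columns S a" using le by force
      then show ?thesis using True by (simp add: G_def)
    next
      case False
      then have "F c = undefined" by (rule extensional_arb[OF FillD(1)[OF F]])
      then show ?thesis using False by (simp only: restrict_apply if_False)
    qed
  qed
  have "new_rows S (Suc v) a G = (\<Union>s\<in>S. {old_height v a G s<..a s})"
    using valid_step_Fill[OF mem] by (simp add: valid_step_def)
  also have "\<dots> = P" using step by (simp add: valid_step_def oh)
  finally show "new_rows S (Suc v) a G = P" .
qed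

section \<open>Removing the largest entry from a filling\<close>

abbreviation desc :: "nat set \<Rightarrow> nat list" where
  "desc S \<equiv> rev (sorted_list_of_set S)"

lemma desc_sorted: "sorted_wrt (>) (desc S)"
  using strict_sorted_list_of_set[of S] by (simp add: sorted_wrt_rev)

lemma desc_insert_greater:
  assumes "finite S" "\<And>s. s \<in> S \<Longrightarrow> s < m"
  shows "desc (insert m S) = m # desc S"
proof -
  have "sorted_list_of_set (insert m S) = sorted_list_of_set S @ [m]"
  proof (rule sorted_distinct_set_unique)
    show "sorted (sorted_list_of_set S @ [m])"
      using assms by (auto simp: sorted_append intro: less_imp_le)
    show "distinct (sorted_list_of_set S @ [m])" using assms by auto
    show "set (sorted_list_of_set (insert m S)) = set (sorted_list_of_set S @ [m])"
      using assms(1) by (simp only: set_sorted_list_of_set finite_insert set_append) simp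
  qed (rule sorted_sorted_list_of_set distinct_sorted_list_of_set)+
  then show ?thesis by simp
qed

lemma valid_step_subset:
  assumes "T \<subseteq> S" and zero: "\<And>s. s \<in> S - T \<Longrightarrow> a s = 0"
  shows "valid_step S a a' P \<longleftrightarrow> valid_step T a a' P \<and> (\<forall>s\<in>S - T. a' s = 0)"
proof -
  have U: "(\<Union>s\<in>S. {a' s<..a s}) = (\<Union>s\<in>T. {a' s<..a s})"
  proof -
    have "{a' s<..a s} = {}" if "s \<in> S - T" for s using zero[OF that] by simp
    then show ?thesis using assms(1) by blast
  qed
  show ?thesis
  proof
    assume v: "valid_step S a a' P"
    have "a' s = 0" if "s \<in> S - T" for s
      using v zero[OF that] that unfolding valid_step_def by (metis DiffD1 le_zero_eq)
    moreover have "valid_step T a a' P"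
      unfolding valid_step_def
    proof (intro conjI)
      show "P = (\<Union>s\<in>T. {a' s<..a s})" using v U by (simp only: valid_step_def)
    qed (use v assms(1) in \<open>simp_all add: valid_step_def subset_eq\<close>)
    ultimately show "valid_step T a a' P \<and> (\<forall>s\<in>S - T. a' s = 0)" by blast
  next
    assume v: "valid_step T a a' P \<and> (\<forall>s\<in>S - T. a' s = 0)"
    have "a' s \<le> a s" if "s \<in> S" for s
      using v that unfolding valid_step_def by (cases "s \<in> T") auto
    moreover have "{a' i<..a i} \<inter> {a' j..a j} = {}" if ij: "i \<in> S" "j \<in> S" "i < j" for i j
    proof -
      consider "i \<in> T" "j \<in> T" | "i \<in> S - T" | "j \<in> S - T" using ij by blast
      then show ?thesis
      proof cases
        case 1
        then show ?thesis using v ij by (simp add: valid_step_def)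
      next
        case 2
        then show ?thesis using zero[of i] by simp
      next
        case 3
        then have "a' j = 0" "a j = 0" using zero[of j] v by blast+
        then show ?thesis by simp
      qed
    qed
    moreover have "P = (\<Union>s\<in>S. {a' s<..a s})" using v U by (simp only: valid_step_def)
    ultimately show "valid_step S a a' P" by (simp only: valid_step_def) simp
  qed
qed

text \<open>No row contains the removed entry twice, so counting its rows counts its cells.\<close>

lemma card_columns_diff:
  assumes step: "valid_step S a a' P"
  shows "card (columns S a - columns S a') = card P"
proof -
  have P: "(\<Union>s\<in>S. {a' s<..a s}) = P" using step by (simp add: valid_step_def)
  have eq: "columns S a - columns S a' = (SIGMA s:S. {a' s<..a s})" by auto
  have "inj_on snd (SIGMA s:S. {a' s<..a s})"
  proof (rule inj_onI, clarify)
    fix i j r q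
    assume ij: "i \<in> S" "r \<in> {a' i<..a i}" "j \<in> S" "q \<in> {a' j<..a j}" "snd (i, r) = snd (j, q)"
    have dis: "{a' p<..a p} \<inter> {a' q..a q} = {}" if "p \<in> S" "q \<in> S" "p < q" for p q
      using step that by (simp add: valid_step_def)
    have "r \<in> {a' i..a i}" "r \<in> {a' j..a j}" "r \<in> {a' j<..a j}" using ij by auto
    then have "\<not> i < j" "\<not> j < i" using dis ij by blast+
    then show "i = j \<and> r = q" using ij(5) by simp
  qed
  then have "card (SIGMA s:S. {a' s<..a s}) = card (snd ` (SIGMA s:S. {a' s<..a s}))"
    by (simp add: card_image)
  also have "snd ` (SIGMA s:S. {a' s<..a s}) = P" by (simp only: snd_image_Sigma P)
  finally show ?thesis unfolding eq .
qed

text \<open>Prescribing the rows of the largest entry prescribes the heights below it by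
  \<open>valid_step_iff\<close>. Deleting these cells and refilling them are then mutually
  inverse.\<close>

lemma restrict_step:
  assumes S: "finite S" and step: "valid_step S a a' P"
    and top: "\<And>s. s \<in> S \<Longrightarrow> a s > 0 \<Longrightarrow> s \<le> Suc v"
  shows "(\<Sum>F | F \<in> Fill S (Suc v) a \<and> new_rows S (Suc v) a F = P. \<Prod>c\<in>columns S a. x (F c)) =
    x (Suc v) ^ card P * (\<Sum>F\<in>Fill S v a'. \<Prod>c\<in>columns S a'. (x (F c) :: 'a::comm_ring_1))"
proof -
  let ?L = "sorted_list_of_set S"
  let ?G = "\<lambda>F. \<lambda>c\<in>columns S a. if c \<in> columns S a' then F c else Suc v"
  have le: "a' s \<le> a s" if "s \<in> S" for s using step that by (simp add: valid_step_def)
  have heights: "old_height v a F s = a' s"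
    if F: "F \<in> Fill S (Suc v) a" "new_rows S (Suc v) a F = P" and s: "s \<in> S" for F s
  proof -
    have "valid_step (set (desc S)) a (old_height v a F) P"
      using valid_step_Fill[OF F(1)] F(2) S by simp
    moreover have "valid_step (set (desc S)) a a' P" using step S by simp
    ultimately have "map (old_height v a F) (desc S) = map a' (desc S)"
      unfolding valid_step_iff[OF desc_sorted] by simp
    then show ?thesis using s S by simp
  qed
  have finC: "finite (columns S b)" for b using S by simp
  have sub: "columns S a' \<subseteq> columns S a" using le by force
  have cardP: "card (columns S a - columns S a') = card P"
    by (rule card_columns_diff[OF step])
  have "(\<Sum>F | F \<in> Fill S (Suc v) a \<and> new_rows S (Suc v) a F = P. \<Prod>c\<in>columns S a. x (F c)) =
      (\<Sum>F\<in>Fill S v a'. x (Suc v) ^ card P * (\<Prod>c\<in>columns S a'. x (F c)))"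
  proof (rule sum.reindex_bij_witness[of _ ?G "\<lambda>F. restrict F (columns S a')"])
    fix F assume "F \<in> {F. F \<in> Fill S (Suc v) a \<and> new_rows S (Suc v) a F = P}"
    then have F: "F \<in> Fill S (Suc v) a" "new_rows S (Suc v) a F = P" by auto
    show "restrict F (columns S a') \<in> Fill S v a'"
      by (rule restrict_Fill[OF F(1)]) (simp only: heights[OF F])
    have new: "F c = Suc v" if "c \<in> columns S a - columns S a'" for c
    proof -
      obtain s r where c: "c = (s, r)" by (cases c)
      have sr: "s \<in> S" "1 \<le> r" "r \<le> a s" "\<not> r \<le> a' s" using that by (auto simp: c)
      then have "\<not> F (s, r) \<le> v" using old_height_iff[OF F(1)] heights[OF F] by simp
      then show ?thesis using FillD(2)[OF F(1) sr(1-3)] c by simp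
    qed
    show "?G (restrict F (columns S a')) = F"
    proof (rule extensionalityI[of _ "columns S a"])
      show "F \<in> extensional (columns S a)" by (rule FillD(1)[OF F(1)])
      show "?G (restrict F (columns S a')) c = F c" if "c \<in> columns S a" for c
        using that new[of c] by (cases "c \<in> columns S a'") auto
    qed simp
    have "(\<Prod>c\<in>columns S a. x (F c)) =
        (\<Prod>c\<in>columns S a - columns S a'. x (F c)) * (\<Prod>c\<in>columns S a'. x (F c))"
      by (rule prod.subset_diff[OF sub finC])
    also have "(\<Prod>c\<in>columns S a - columns S a'. x (F c)) = x (Suc v) ^ card P"
    proof -
      have "(\<Prod>c\<in>columns S a - columns S a'. x (F c)) = (\<Prod>c\<in>columns S a - columns S a'. x (Suc v))"
        by (rule prod.cong[OF refl]) (simp only: new)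
      then show ?thesis by (simp only: prod_constant cardP)
    qed
    finally show "x (Suc v) ^ card P * (\<Prod>c\<in>columns S a'. x (restrict F (columns S a') c)) =
        (\<Prod>c\<in>columns S a. x (F c))" by (simp cong: prod.cong)
  next
    fix F assume F: "F \<in> Fill S v a'"
    note e = extend_Fill[OF F step top]
    show "?G F \<in> {F. F \<in> Fill S (Suc v) a \<and> new_rows S (Suc v) a F = P}"
      using e(1,4) by (intro CollectI conjI)
    show "restrict (?G F) (columns S a') = F" by (rule e(3))
  qed
  then show ?thesis by (simp only: sum_distrib_left)
qed

lemma sum_Fill_eq_Z:
  fixes x :: "nat \<Rightarrow> 'a::comm_ring_1"
  assumes "finite S" "\<And>s. s \<in> S \<Longrightarrow> 1 \<le> s" "\<And>s. s \<in> S \<Longrightarrow> a s > 0 \<Longrightarrow> s \<le> v"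
    "\<And>s. s \<in> S \<Longrightarrow> a s \<le> N"
  shows "(\<Sum>F\<in>Fill S v a. \<Prod>c\<in>columns S a. x (F c)) = Z x N S v (map a (desc (S \<inter> {1..v})))"
  using assms(3,4)
proof (induction v arbitrary: a)
  case 0
  then have "a s = 0" if "s \<in> S" for s using assms(2)[OF that] that by fastforce
  then have cols: "columns S a = {}" by auto
  have F: "Fill S 0 a = {\<lambda>_. undefined}"
    unfolding Fill_def cols extensional_empty using \<open>\<And>s. s \<in> S \<Longrightarrow> a s = 0\<close> by auto
  then show ?case unfolding F cols by simp
next
  case (Suc v)
  let ?T = "S \<inter> {1..Suc v}" and ?T' = "S \<inter> {1..v}"
  let ?L = "desc ?T"
  let ?W = "\<lambda>F. \<Prod>c\<in>columns S a. x (F c)"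
  have finT: "finite ?T" by simp
  have valid_T: "valid_step S a a' P \<longleftrightarrow> rest (map a ?L) P = {} \<and> map a' ?L = final (map a ?L) P \<and>
      (\<forall>s\<in>S - ?T. a' s = 0)" for a' P
  proof -
    have zero: "a s = 0" if "s \<in> S - ?T" for s
      using Suc.prems(1)[of s] assms(2)[of s] that by auto
    have "valid_step S a a' P \<longleftrightarrow> valid_step ?T a a' P \<and> (\<forall>s\<in>S - ?T. a' s = 0)"
      using zero by (intro valid_step_subset) auto
    moreover have "set ?L = ?T" using finT by simp
    then have "valid_step ?T a a' P \<longleftrightarrow> rest (map a ?L) P = {} \<and> map a' ?L = final (map a ?L) P"
      using valid_step_iff[OF desc_sorted, of ?T a a' P] by (simp only:)
    ultimately show ?thesis by blast
  qed
  \<comment> \<open>The list produced by the particles, read as a height function on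
    \<open>S\<close>; the value \<open>0\<close> off \<open>?T\<close> matches the columns that are
    already empty.\<close>
  define h where "h P s = (if s \<in> ?T then the (map_of (zip ?L (final (map a ?L) P)) s) else 0)" for P s
  have len: "length (final hs P) = length hs" for hs P
    by (induction hs arbitrary: P) auto
  have map_h: "map (h P) ?L = final (map a ?L) P" for P
  proof (rule nth_equalityI)
    fix i assume "i < length (map (h P) ?L)"
    then have i: "i < length ?L" by simp
    then have "?L ! i \<in> ?T" using nth_mem[OF i] by simp
    moreover have "map_of (zip ?L (final (map a ?L) P)) (?L ! i) = Some (final (map a ?L) P ! i)"
      by (rule map_of_zip_nth) (use i in \<open>auto simp: len\<close>)
    ultimately show "map (h P) ?L ! i = final (map a ?L) P ! i" using i by (simp add: h_def)
  qed (simp add: len)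
  have h_step: "valid_step S a (h P) P" if "rest (map a ?L) P = {}" for P
  proof -
    have "\<forall>s\<in>S - ?T. h P s = 0" by (auto simp: h_def)
    then show ?thesis unfolding valid_T using that map_h by blast
  qed
  \<comment> \<open>All entries of the column with base \<open>v + 1\<close> are at least
    \<open>v + 1\<close>, so this column must be empty once \<open>v + 1\<close> has been removed.
    This is the test on the head in \<open>Z\<close>.\<close>
  define C where "C P \<longleftrightarrow> rest (map a ?L) P = {} \<and> (Suc v \<in> S \<longrightarrow> h P (Suc v) = 0)" for P
  have new_C: "new_rows S (Suc v) a F \<in> {P \<in> Pow {1..N}. C P}" if F: "F \<in> Fill S (Suc v) a" for F
  proof -
    let ?P = "new_rows S (Suc v) a F"
    have v: "valid_step S a (old_height v a F) ?P" by (rule valid_step_Fill[OF F])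
    then have r: "rest (map a ?L) ?P = {}" "map (old_height v a F) ?L = final (map a ?L) ?P"
      unfolding valid_T by auto
    have "h ?P (Suc v) = 0" if "Suc v \<in> S"
    proof -
      have "Suc v \<in> set ?L" using that by simp
      moreover have "map (h ?P) ?L = map (old_height v a F) ?L" by (simp only: map_h r(2))
      ultimately have "h ?P (Suc v) = old_height v a F (Suc v)" unfolding map_eq_conv by blast
      also have "\<dots> = 0"
      proof -
        have "\<not> F (Suc v, r) \<le> v" if "r \<in> {1..a (Suc v)}" for r
          using FillD(2)[OF F \<open>Suc v \<in> S\<close>, of r] that by simp
        then have "{r \<in> {1..a (Suc v)}. F (Suc v, r) \<le> v} = {}" by blast
        then show ?thesis by (simp only: old_height_def card.empty)
      qed
      finally show ?thesis .
    qed
    moreover have "?P \<subseteq> {1..N}"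
    proof
      fix r assume "r \<in> ?P"
      then obtain s where "s \<in> S" "1 \<le> r" "r \<le> a s" unfolding new_rows_def by blast
      then show "r \<in> {1..N}" using Suc.prems(2)[of s] by simp
    qed
    ultimately show ?thesis using r(1) unfolding C_def by blast
  qed
  have step_eq: "(\<Sum>F | F \<in> Fill S (Suc v) a \<and> new_rows S (Suc v) a F = P. ?W F) =
      x (Suc v) ^ card P * Z x N S v (map (h P) (desc ?T'))" if P: "P \<in> Pow {1..N}" "C P" for P
  proof -
    have step: "valid_step S a (h P) P" using P h_step unfolding C_def by blast
    have le: "h P s \<le> a s" if "s \<in> S" for s using step that by (simp add: valid_step_def)
    have "(\<Sum>F | F \<in> Fill S (Suc v) a \<and> new_rows S (Suc v) a F = P. ?W F) =
        x (Suc v) ^ card P * (\<Sum>F\<in>Fill S v (h P). \<Prod>c\<in>columns S (h P). x (F c))"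
      by (rule restrict_step[OF assms(1) step]) (rule Suc.prems(1))
    also have "(\<Sum>F\<in>Fill S v (h P). \<Prod>c\<in>columns S (h P). x (F c)) = Z x N S v (map (h P) (desc ?T'))"
    proof (rule Suc.IH)
      fix s assume s: "s \<in> S"
      show "h P s \<le> N" using le[OF s] Suc.prems(2)[OF s] by simp
      assume "h P s > 0"
      then have "h P s \<noteq> 0" by (rule gr_implies_not0)
      moreover have "Suc v \<in> S \<longrightarrow> h P (Suc v) = 0" using P(2) unfolding C_def by (rule conjunct2)
      ultimately have "s \<noteq> Suc v" using s by metis
      moreover have "s \<in> ?T"
      proof (rule ccontr)
        assume "s \<notin> ?T"
        then have "h P s = 0" by (simp only: h_def if_False)
        then show False using \<open>h P s \<noteq> 0\<close> by blast
      qed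
      ultimately show "s \<le> v" by simp
    qed
    finally show ?thesis .
  qed
  have Z_eq: "Z x N S (Suc v) (map a ?L) = (\<Sum>P\<in>Pow {1..N}. if C P then
      x (Suc v) ^ card P * Z x N S v (map (h P) (desc ?T')) else 0)"
  proof (cases "Suc v \<in> S")
    case True
    then have T: "?T = insert (Suc v) ?T'" by auto
    have L: "?L = Suc v # desc ?T'" unfolding T by (rule desc_insert_greater) auto
    have fin: "final (map a ?L) P = h P (Suc v) # map (h P) (desc ?T')" for P
      using map_h[of P] by (simp only: L list.map)
    have ne: "map a ?L \<noteq> []" by (simp only: L list.map list.distinct not_False_eq_True)
    show ?thesis
      unfolding Z.simps
    proof (rule sum.cong[OF refl], goal_cases)
      case (1 P)
      show ?case
        by (cases "rest (map a ?L) P = {}"; cases "h P (Suc v) = 0")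
          (simp_all only: fin list.sel C_def True ne simp_thms if_True if_False mult_zero_right)
    qed
  next
    case False
    then have T: "?T = ?T'" by (auto simp: le_Suc_eq)
    have fin: "final (map a ?L) P = map (h P) (desc ?T')" for P
      using map_h[of P] by (simp only: T)
    show ?thesis
      unfolding Z.simps
    proof (rule sum.cong[OF refl], goal_cases)
      case (1 P)
      show ?case
        by (cases "rest (map a ?L) P = {}") (simp_all only: fin C_def False simp_thms if_True if_False)
    qed
  qed
  have "(\<Sum>F\<in>Fill S (Suc v) a. ?W F) =
      (\<Sum>P\<in>{P \<in> Pow {1..N}. C P}. \<Sum>F | F \<in> Fill S (Suc v) a \<and> new_rows S (Suc v) a F = P. ?W F)"
    by (rule sum.group[symmetric]) (use finite_Fill[OF assms(1)] new_C in auto)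
  also have "\<dots> = (\<Sum>P\<in>{P \<in> Pow {1..N}. C P}. x (Suc v) ^ card P * Z x N S v (map (h P) (desc ?T')))"
    by (intro sum.cong refl step_eq) auto
  also have "\<dots> = Z x N S (Suc v) (map a ?L)"
    unfolding Z_eq by (rule sum.inter_filter) simp
  finally show ?case .
qed

section \<open>From skyline fillings to complemented fillings\<close>

lemma card_rank_le:
  assumes "S \<subseteq> {1..n::nat}"
  shows "card {s \<in> S. s \<le> i} \<le> i"
proof -
  have "{s \<in> S. s \<le> i} \<subseteq> {1..i}" using assms by auto
  then have "card {s \<in> S. s \<le> i} \<le> card {1..i}" by (rule card_mono[rotated]) simp
  then show ?thesis by simp
qed

lemma skip_comp_pos: "i \<in> S \<Longrightarrow> 1 \<le> skip_comp S i"
  by (simp add: skip_comp_def)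

lemma skip_comp_notin: "i \<notin> S \<Longrightarrow> skip_comp S i = 0"
  by (simp add: skip_comp_def)

text \<open>Between \<open>i\<close> and \<open>j\<close> the rank grows by at most
  \<open>j - i\<close>. This monotonicity makes the height lists sorted, and leaves type A triples
  among nonempty columns only at equal heights.\<close>

lemma skip_comp_mono:
  assumes "S \<subseteq> {1..n}" "i \<in> S" "j \<in> S" "i \<le> j"
  shows "skip_comp S i \<le> skip_comp S j"
proof -
  have "{s \<in> S. s \<le> j} \<subseteq> {s \<in> S. s \<le> i} \<union> {i<..j}" by auto
  moreover have fin: "finite {s \<in> S. s \<le> i}" by (rule finite_subset[of _ "{..i}"]) auto
  ultimately have "card {s \<in> S. s \<le> j} \<le> card ({s \<in> S. s \<le> i} \<union> {i<..j})"
    by (intro card_mono) auto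
  also have "\<dots> \<le> card {s \<in> S. s \<le> i} + card {i<..j}" by (rule card_Un_le)
  finally have "card {s \<in> S. s \<le> j} \<le> card {s \<in> S. s \<le> i} + (j - i)" by simp
  then show ?thesis using assms card_rank_le[OF assms(1), of i] card_rank_le[OF assms(1), of j]
    by (simp add: skip_comp_def)
qed

lemma SSK_le_basement:
  assumes F: "F \<in> SSK n \<gamma>" and i: "i \<in> {1..n}" and "r \<le> \<gamma> i"
  shows "F (i, r) \<le> n - i + 1"
  using assms(3)
proof (induction r)
  case 0
  then show ?case using F i by (simp add: SSK_def)
next
  case (Suc r)
  then have "(i, Suc r) \<in> skyline_cells n \<gamma>" using i by (simp add: skyline_cells_def)
  then have "F (i, Suc r) \<le> F (i, r)" using F by (simp add: SSK_def)
  then show ?case using Suc by simp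
qed

lemma skyline_tripleA:
  assumes "i \<in> {1..n}" "j \<in> {1..n}" "i < j" "\<gamma> j \<le> \<gamma> i" "Suc r \<le> \<gamma> j"
  shows "((i, Suc r), (j, Suc r), (i, r)) \<in> skyline_triples n \<gamma>"
proof -
  have "{(i, Suc r), (j, Suc r), (i, r)} \<subseteq> aug_diagram n \<gamma>"
    using assms by (auto simp: aug_diagram_def)
  then show ?thesis
    unfolding skyline_triples_def mem_Collect_eq case_prod_conv
    using assms by (intro conjI exI[of _ i] exI[of _ j] exI[of _ r]) simp_all
qed

lemma skyline_tripleB:
  assumes "i \<in> {1..n}" "j \<in> {1..n}" "i < j" "\<gamma> i < \<gamma> j" "r \<le> \<gamma> i"
  shows "((j, Suc r), (i, r), (j, r)) \<in> skyline_triples n \<gamma>"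
proof -
  have "{(j, Suc r), (i, r), (j, r)} \<subseteq> aug_diagram n \<gamma>"
    using assms by (auto simp: aug_diagram_def)
  then show ?thesis
    unfolding skyline_triples_def mem_Collect_eq case_prod_conv
    using assms by (intro conjI exI[of _ i] exI[of _ j] exI[of _ r]) simp_all
qed

text \<open>For columns of different heights the condition of \<open>Fill\<close> is the type B
  condition. For equal heights the first alternative always holds: the left entry exceeds the right
  one in the basement, and excluding type A triples carries this upwards row by row, before
  complementation.\<close>

lemma SSK_to_Fill:
  assumes S: "S \<subseteq> {1..n}" and \<gamma>: "\<And>i. i \<in> {1..n} \<Longrightarrow> \<gamma> i = skip_comp S i" and F: "F \<in> SSK n \<gamma>"
  shows "(\<lambda>c\<in>columns S (skip_comp S). n + 1 - F c) \<in> Fill S n (skip_comp S)"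
proof (rule FillI)
  let ?g = "skip_comp S"
  let ?F = "\<lambda>c\<in>columns S ?g. n + 1 - F c"
  have base: "F (i, 0) = n - i + 1" if "i \<in> S" for i using F S that by (auto simp: SSK_def)
  have pos: "F (i, r) \<ge> 1" if "i \<in> S" "r \<le> ?g i" for i r
  proof (cases r)
    case 0
    then show ?thesis using base that by simp
  next
    case (Suc q)
    then have "(i, r) \<in> skyline_cells n \<gamma>" using that S \<gamma>[of i] by (auto simp: skyline_cells_def)
    then show ?thesis using F by (simp add: SSK_def)
  qed
  have dec: "F (i, Suc r) \<le> F (i, r)" if "i \<in> S" "Suc r \<le> ?g i" for i r
  proof -
    have "(i, Suc r) \<in> skyline_cells n \<gamma>" using that S \<gamma>[of i] by (auto simp: skyline_cells_def)
    then show ?thesis using F by (simp add: SSK_def)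
  qed
  have bound: "F (i, r) \<le> n - i + 1" if "i \<in> S" "r \<le> ?g i" for i r
    using SSK_le_basement[OF F, of i r] S \<gamma>[of i] that by auto
  have triple: "\<not> (F a \<le> F b \<and> F b \<le> F c)" if "(a, b, c) \<in> skyline_triples n \<gamma>" for a b c
    using F that by (auto simp: SSK_def)
  show "?F \<in> extensional (columns S ?g)" by simp
  show "s \<le> ?F (s, r) \<and> ?F (s, r) \<le> n" if "s \<in> S" "1 \<le> r" "r \<le> ?g s" for s r
    using that bound[of s r] pos[of s r] S by fastforce
  show "?F (s, r) \<le> ?F (s, Suc r)" if "s \<in> S" "1 \<le> r" "r < ?g s" for s r
    using that dec[of s r] by simp
  show "?F (i, r) < ?F (j, r) \<or> r < ?g j \<and> ?F (j, Suc r) < ?F (i, r)"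
    if ij: "i \<in> S" "j \<in> S" "i < j" "1 \<le> r" "r \<le> ?g i" "r \<le> ?g j" for i j r
  proof -
    have n: "i \<in> {1..n}" "j \<in> {1..n}" using ij S by auto
    have le: "?g i \<le> ?g j" using skip_comp_mono[OF S ij(1,2)] ij(3) by simp
    have Fij: "F (i, r) \<le> n" "F (j, r) \<le> n" "F (i, r) \<ge> 1" "F (j, r) \<ge> 1"
      using bound[OF ij(1,5)] bound[OF ij(2,6)] pos[OF ij(1,5)] pos[OF ij(2,6)] n by auto
    show ?thesis
    proof (cases "?g i = ?g j")
      case True
      have "q \<le> ?g j \<Longrightarrow> F (j, q) < F (i, q)" for q
      proof (induction q)
        case 0
        then show ?case using base[OF ij(1)] base[OF ij(2)] ij(3) n by simp
      next
        case (Suc q)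
        then have IH: "F (j, q) < F (i, q)" by simp
        have "((i, Suc q), (j, Suc q), (i, q)) \<in> skyline_triples n \<gamma>"
          using Suc.prems True n \<gamma> ij(3) by (intro skyline_tripleA) simp_all
        then have "\<not> (F (i, Suc q) \<le> F (j, Suc q) \<and> F (j, Suc q) \<le> F (i, q))" by (rule triple)
        moreover have "F (j, Suc q) \<le> F (j, q)" using dec[OF ij(2)] Suc.prems by simp
        ultimately show ?case using IH by linarith
      qed
      then have "F (j, r) < F (i, r)" using ij by simp
      then show ?thesis using ij Fij by auto
    next
      case False
      then have lt: "?g i < ?g j" using le by simp
      have "((j, Suc r), (i, r), (j, r)) \<in> skyline_triples n \<gamma>"
        using lt n \<gamma> ij by (intro skyline_tripleB) simp_all
      then have "\<not> (F (j, Suc r) \<le> F (i, r) \<and> F (i, r) \<le> F (j, r))" by (rule triple)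
      then have "F (j, r) < F (i, r) \<or> F (i, r) < F (j, Suc r)" by linarith
      moreover have "F (j, Suc r) \<le> F (j, r)" using dec[OF ij(2)] lt ij by simp
      ultimately show ?thesis using ij lt Fij by auto
    qed
  qed
qed

text \<open>The converse also has to treat the triples that meet an empty column or the basement, on
  which \<open>Fill\<close> is silent.\<close>

lemma Fill_to_SSK:
  assumes S: "S \<subseteq> {1..n}" and \<gamma>: "\<And>i. i \<in> {1..n} \<Longrightarrow> \<gamma> i = skip_comp S i"
    and F: "F \<in> Fill S n (skip_comp S)"
  shows "(\<lambda>c\<in>aug_diagram n \<gamma>. if snd c = 0 then n - fst c + 1 else n + 1 - F c) \<in> SSK n \<gamma>"
proof -
  let ?g = "skip_comp S"
  let ?F = "\<lambda>c\<in>aug_diagram n \<gamma>. if snd c = 0 then n - fst c + 1 else n + 1 - F c"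
  have F0: "?F (i, 0) = n - i + 1" if "i \<in> {1..n}" for i using that by (simp add: aug_diagram_def)
  have FS: "?F (i, r) = n + 1 - F (i, r)" if "i \<in> {1..n}" "1 \<le> r" "r \<le> \<gamma> i" for i r
    using that by (simp add: aug_diagram_def)
  have inS: "i \<in> S" if "i \<in> {1..n}" "0 < \<gamma> i" for i
    using that \<gamma>[of i] skip_comp_notin[of i S] by fastforce
  have bnd: "i \<le> F (i, r)" "F (i, r) \<le> n" if "i \<in> {1..n}" "1 \<le> r" "r \<le> \<gamma> i" for i r
    using FillD(2)[OF F, of i r] inS[of i] \<gamma>[of i] that by auto
  have mono: "\<gamma> i \<le> \<gamma> j" if "i \<in> {1..n}" "j \<in> {1..n}" "0 < \<gamma> i" "0 < \<gamma> j" "i < j" for i j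
    using skip_comp_mono[OF S, of i j] inS \<gamma> that by simp
  have fill: "F (i, r) < F (j, r) \<or> r < \<gamma> j \<and> F (j, Suc r) < F (i, r)"
    if "i \<in> {1..n}" "j \<in> {1..n}" "i < j" "1 \<le> r" "r \<le> \<gamma> i" "r \<le> \<gamma> j" for i j r
    using FillD(4)[OF F, of i j r] inS[of i] inS[of j] \<gamma> that by auto
  have inc: "F (i, r) \<le> F (i, Suc r)" if "i \<in> {1..n}" "1 \<le> r" "r < \<gamma> i" for i r
    using FillD(3)[OF F, of i r] inS[of i] \<gamma> that by auto
  show ?thesis
    unfolding SSK_def
  proof (intro CollectI conjI ballI allI impI)
    show "?F \<in> extensional (aug_diagram n \<gamma>)" by simp
    show "?F (i, 0) = n - i + 1" if "i \<in> {1..n}" for i by (rule F0[OF that])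
    show "1 \<le> ?F c" if c: "c \<in> skyline_cells n \<gamma>" for c
    proof -
      obtain i r where c': "c = (i, r)" "i \<in> {1..n}" "1 \<le> r" "r \<le> \<gamma> i"
        using c by (auto simp: skyline_cells_def)
      then show ?thesis using FS[OF c'(2-4)] bnd[OF c'(2-4)] by simp
    qed
    show "?F (i, Suc r) \<le> ?F (i, r)" if "(i, Suc r) \<in> skyline_cells n \<gamma>" for i r
    proof -
      have i: "i \<in> {1..n}" "Suc r \<le> \<gamma> i" using that by (auto simp: skyline_cells_def)
      show ?thesis
      proof (cases r)
        case 0
        then show ?thesis using FS[of i "Suc r"] F0[OF i(1)] bnd[of i "Suc r"] i by simp
      next
        case (Suc q)
        then show ?thesis using FS[of i "Suc r"] FS[of i r] inc[of i r] i by simp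
      qed
    qed
    fix t assume tri: "t \<in> skyline_triples n \<gamma>"
    obtain a b c where t: "t = (a, b, c)" by (cases t)
    note tri' = tri[unfolded t skyline_triples_def mem_Collect_eq case_prod_conv]
    have sub: "{a, b, c} \<subseteq> aug_diagram n \<gamma>" using tri' by (rule conjunct1)
    obtain i j r where "i < j" and cases: "\<gamma> j \<le> \<gamma> i \<and> a = (i, Suc r) \<and> b = (j, Suc r) \<and> c = (i, r) \<or>
        \<gamma> i < \<gamma> j \<and> a = (j, Suc r) \<and> b = (i, r) \<and> c = (j, r)"
      using conjunct2[OF tri'] by (elim exE conjE)
    from cases have "\<not> (?F a \<le> ?F b \<and> ?F b \<le> ?F c)"
    proof (elim disjE conjE)
      assume A: "\<gamma> j \<le> \<gamma> i" "a = (i, Suc r)" "b = (j, Suc r)" "c = (i, r)"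
      have ij: "i \<in> {1..n}" "j \<in> {1..n}" "Suc r \<le> \<gamma> i" "Suc r \<le> \<gamma> j"
        using sub by (auto simp: A aug_diagram_def)
      have eq: "\<gamma> i = \<gamma> j" using mono[of i j] A(1) ij \<open>i < j\<close> by simp
      \<comment> \<open>Downward induction from the common top, where the second alternative is
        impossible. Below it, \<open>F (i, q) \<le> F (i, Suc q) < F (j, Suc q)\<close> excludes the
        second alternative again.\<close>
      have "F (i, q) < F (j, q)" if "Suc r \<le> q" "q \<le> \<gamma> j" for q
        using that(2,1)
      proof (induction q rule: inc_induct)
        case base
        then show ?case using fill[of i j "\<gamma> j"] ij eq \<open>i < j\<close> by auto
      next
        case (step q)
        then have IH: "F (i, Suc q) < F (j, Suc q)" by simp
        have "F (i, q) \<le> F (i, Suc q)" using inc[of i q] step ij eq by simp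
        then show ?case using IH fill[of i j q] step ij eq \<open>i < j\<close> by auto
      qed
      then have "F (i, Suc r) < F (j, Suc r)" using ij by simp
      then show ?thesis using A FS[of i "Suc r"] FS[of j "Suc r"] bnd[of i "Suc r"] bnd[of j "Suc r"] ij
        by auto
    next
      assume B: "\<gamma> i < \<gamma> j" "a = (j, Suc r)" "b = (i, r)" "c = (j, r)"
      have ij: "i \<in> {1..n}" "j \<in> {1..n}" "r \<le> \<gamma> i" "Suc r \<le> \<gamma> j"
        using sub by (auto simp: B aug_diagram_def)
      show ?thesis
      proof (cases r)
        \<comment> \<open>In the basement, entries decrease strictly from left to right, so
          \<open>b \<le> c\<close> fails. This covers the triples of type B with an empty column
          \<open>i\<close>.\<close>
        case 0
        then show ?thesis using B F0[OF ij(1)] F0[OF ij(2)] ij \<open>i < j\<close> by auto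
      next
        case (Suc q)
        then have r: "1 \<le> r" by simp
        have "F (i, r) < F (j, r) \<or> F (j, Suc r) < F (i, r)" using fill[of i j r] r ij \<open>i < j\<close> by auto
        moreover have rj: "r \<le> \<gamma> j" "1 \<le> Suc r" using ij by auto
        ultimately show ?thesis
          unfolding B FS[OF ij(1) r ij(3)] FS[OF ij(2) r rj(1)] FS[OF ij(2) rj(2) ij(4)]
          using bnd(2)[OF ij(1) r ij(3)] bnd(2)[OF ij(2) r rj(1)] bnd(2)[OF ij(2) rj(2) ij(4)]
          by linarith
      qed
    qed
    then show "case t of (a, b, c) \<Rightarrow> \<not> (?F a \<le> ?F b \<and> ?F b \<le> ?F c)" using t by simp
  qed
qed

lemma prod_power_card:
  fixes f :: "nat \<Rightarrow> 'a::comm_monoid_mult"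
  assumes "finite C" "\<And>c. c \<in> C \<Longrightarrow> F c \<in> I" "finite I"
  shows "(\<Prod>i\<in>I. f i ^ card {c \<in> C. F c = i}) = (\<Prod>c\<in>C. f (F c))"
proof -
  have "(\<Prod>c\<in>C. f (F c)) = (\<Prod>i\<in>I. \<Prod>c\<in>{c \<in> C. F c = i}. f (F c))"
    by (rule prod.group[symmetric]) (use assms in auto)
  also have "\<dots> = (\<Prod>i\<in>I. f i ^ card {c \<in> C. F c = i})"
  proof (rule prod.cong[OF refl])
    fix i
    have "(\<Prod>c\<in>{c \<in> C. F c = i}. f (F c)) = (\<Prod>c\<in>{c \<in> C. F c = i}. f i)" by (rule prod.cong) auto
    then show "(\<Prod>c\<in>{c \<in> C. F c = i}. f (F c)) = f i ^ card {c \<in> C. F c = i}" by simp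
  qed
  finally show ?thesis by simp
qed

text \<open>The reversal in the definition of the characters cancels the one applied to the skip
  composition, so the shape is the skip composition itself. The substitution of
  \<open>X (n - i + 1)\<close> is absorbed by complementing the entries.\<close>

lemma rev_demazure_eq_Fill:
  assumes S: "S \<subseteq> {1..n}"
  shows "rev_demazure n (rev_comp n (skip_comp S)) =
    (\<Sum>F\<in>Fill S n (skip_comp S). \<Prod>c\<in>columns S (skip_comp S). X (F c))"
proof -
  let ?g = "skip_comp S"
  define \<gamma> where "\<gamma> = rev_comp n (rev_comp n ?g)"
  have \<gamma>: "\<gamma> i = ?g i" if "i \<in> {1..n}" for i using that by (auto simp: \<gamma>_def rev_comp_def)
  let ?\<Phi> = "\<lambda>F. \<lambda>c\<in>columns S ?g. n + 1 - F c"
  let ?\<Psi> = "\<lambda>F. \<lambda>c\<in>aug_diagram n \<gamma>. if snd c = 0 then n - fst c + 1 else n + 1 - F c"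
  have cells: "skyline_cells n \<gamma> = columns S ?g"
  proof -
    have "i \<in> S" if "1 \<le> r" "r \<le> ?g i" for i r using skip_comp_notin[of i S] that by fastforce
    then show ?thesis using S \<gamma> by (auto simp: skyline_cells_def)
  qed
  have aug: "(i, r) \<in> columns S ?g \<longleftrightarrow> (i, r) \<in> aug_diagram n \<gamma> \<and> r \<noteq> 0" for i r
    unfolding cells[symmetric] by (auto simp: skyline_cells_def aug_diagram_def)
  have finC: "finite (columns S ?g)" using finite_subset[OF S] by simp
  have "rev_demazure n (rev_comp n ?g) =
      (\<Sum>F\<in>SSK n \<gamma>. \<Prod>i\<in>{1..n}. X (n - i + 1) ^ card {c \<in> columns S ?g. F c = i})"
    by (simp add: rev_demazure_def demazure_def flip: \<gamma>_def add: cells)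
  also have "\<dots> = (\<Sum>F\<in>Fill S n ?g. \<Prod>c\<in>columns S ?g. X (F c))"
  proof (rule sum.reindex_bij_witness[of _ ?\<Psi> ?\<Phi>])
    fix F assume F: "F \<in> SSK n \<gamma>"
    have val: "1 \<le> F c" "F c \<le> n" if "c \<in> columns S ?g" for c
    proof -
      show "1 \<le> F c" using F that unfolding SSK_def cells by blast
      obtain i r where c: "c = (i, r)" "i \<in> S" "r \<le> ?g i" using \<open>c \<in> columns S ?g\<close> by auto
      have i: "i \<in> {1..n}" using c S by auto
      have "F c \<le> n - i + 1" using SSK_le_basement[OF F i, of r] c \<gamma>[OF i] by simp
      then show "F c \<le> n" using i unfolding atLeastAtMost_iff by linarith
    qed
    show "?\<Phi> F \<in> Fill S n ?g" by (rule SSK_to_Fill[OF S \<gamma> F])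
    show "?\<Psi> (?\<Phi> F) = F"
    proof (rule extensionalityI[of _ "aug_diagram n \<gamma>"])
      show "F \<in> extensional (aug_diagram n \<gamma>)" using F by (simp add: SSK_def)
      fix c assume c: "c \<in> aug_diagram n \<gamma>"
      obtain i r where ir: "c = (i, r)" by (cases c)
      show "?\<Psi> (?\<Phi> F) c = F c"
      proof (cases "r = 0")
        case True
        then show ?thesis using c ir F by (auto simp: SSK_def aug_diagram_def)
      next
        case False
        then have "c \<in> columns S ?g" using aug c ir by blast
        then show ?thesis using c ir False val[of c] by simp
      qed
    qed simp
    have "(\<Prod>i\<in>{1..n}. X (n - i + 1) ^ card {c \<in> columns S ?g. F c = i}) =
        (\<Prod>c\<in>columns S ?g. X (n - F c + 1))"
      using val by (intro prod_power_card finC) auto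
    also have "\<dots> = (\<Prod>c\<in>columns S ?g. X (?\<Phi> F c))"
      using val by (intro prod.cong refl) (simp add: Suc_diff_le)
    finally show "(\<Prod>c\<in>columns S ?g. X (?\<Phi> F c)) =
        (\<Prod>i\<in>{1..n}. X (n - i + 1) ^ card {c \<in> columns S ?g. F c = i})" by simp
  next
    fix F assume F: "F \<in> Fill S n ?g"
    show "?\<Psi> F \<in> SSK n \<gamma>" by (rule Fill_to_SSK[OF S \<gamma> F])
    show "?\<Phi> (?\<Psi> F) = F"
    proof (rule extensionalityI[of _ "columns S ?g"])
      show "F \<in> extensional (columns S ?g)" by (rule FillD(1)[OF F])
      fix c assume c: "c \<in> columns S ?g"
      obtain i r where ir: "c = (i, r)" by (cases c)
      have "i \<in> S" "1 \<le> r" "r \<le> ?g i" using c ir by auto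
      then have "F c \<le> n" using FillD(2)[OF F, of i r] ir by simp
      moreover have "c \<in> aug_diagram n \<gamma>" "r \<noteq> 0" using aug c ir by blast+
      ultimately show "?\<Phi> (?\<Psi> F) c = F c" using c ir by simp
    qed simp
  qed
  finally show ?thesis .
qed

section \<open>Membership in the ideal\<close>

abbreviation polys :: "nat \<Rightarrow> rpoly set" where
  "polys n \<equiv> carrier (poly_ring n)"

lemma poly_ring_sel:
  "x \<otimes>\<^bsub>poly_ring n\<^esub> y = x * y" "\<one>\<^bsub>poly_ring n\<^esub> = 1" "\<zero>\<^bsub>poly_ring n\<^esub> = 0"
  "x \<oplus>\<^bsub>poly_ring n\<^esub> y = x + y"
  by (simp_all add: poly_ring_def)

lemma polys_iff: "p \<in> polys n \<longleftrightarrow> (\<forall>m\<in>Poly_Mapping.keys p. Poly_Mapping.keys m \<subseteq> {1..n})"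
  by (simp add: poly_ring_def)

lemma polys_0 [simp]: "0 \<in> polys n" and polys_1 [simp]: "1 \<in> polys n"
  by (simp_all add: polys_iff)

lemma polys_add: "p \<in> polys n \<Longrightarrow> q \<in> polys n \<Longrightarrow> p + q \<in> polys n"
  using cring.cring_simprules(1)[OF cring_poly_ring, of p n q] by (simp add: poly_ring_sel)

lemma polys_mult: "p \<in> polys n \<Longrightarrow> q \<in> polys n \<Longrightarrow> p * q \<in> polys n"
  using cring.cring_simprules(5)[OF cring_poly_ring, of p n q] by (simp add: poly_ring_sel)

lemma polys_uminus: "p \<in> polys n \<Longrightarrow> - p \<in> polys n"
  by (simp add: polys_iff)

lemma polys_sum: "(\<And>i. i \<in> A \<Longrightarrow> f i \<in> polys n) \<Longrightarrow> sum f A \<in> polys n"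
  by (induction A rule: infinite_finite_induct) (auto intro: polys_add)

lemma polys_prod: "(\<And>i. i \<in> A \<Longrightarrow> f i \<in> polys n) \<Longrightarrow> prod f A \<in> polys n"
  by (induction A rule: infinite_finite_induct) (auto intro: polys_mult)

lemma polys_power: "p \<in> polys n \<Longrightarrow> p ^ k \<in> polys n"
  by (induction k) (auto intro: polys_mult)

lemma polys_X: "i \<in> {1..n} \<Longrightarrow> X i \<in> polys n"
  by (simp add: polys_iff X_def)

lemma genideal_zero_add_mult:
  assumes "A \<subseteq> polys n"
  shows "0 \<in> genideal (poly_ring n) A"
    "p \<in> genideal (poly_ring n) A \<Longrightarrow> q \<in> genideal (poly_ring n) A \<Longrightarrow> p + q \<in> genideal (poly_ring n) A"
    "p \<in> genideal (poly_ring n) A \<Longrightarrow> c \<in> polys n \<Longrightarrow> c * p \<in> genideal (poly_ring n) A"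
proof -
  interpret R: cring "poly_ring n" by (rule cring_poly_ring)
  interpret ideal "genideal (poly_ring n) A" "poly_ring n" by (rule R.genideal_ideal[OF assms])
  show "0 \<in> genideal (poly_ring n) A" using zero_closed by (simp add: poly_ring_sel)
  show "p + q \<in> genideal (poly_ring n) A" if "p \<in> genideal (poly_ring n) A" "q \<in> genideal (poly_ring n) A"
    using a_closed[OF that] by (simp add: poly_ring_sel)
  show "c * p \<in> genideal (poly_ring n) A" if "p \<in> genideal (poly_ring n) A" "c \<in> polys n"
    using I_l_closed[OF that] by (simp add: poly_ring_sel)
qed

lemma genideal_sum:
  assumes "A \<subseteq> polys n" "\<And>i. i \<in> B \<Longrightarrow> f i \<in> genideal (poly_ring n) A"
  shows "sum f B \<in> genideal (poly_ring n) A"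
  using assms(2)
  by (induction B rule: infinite_finite_induct) (auto intro: genideal_zero_add_mult[OF assms(1)])

lemma genideal_superset:
  assumes "A \<subseteq> polys n"
  shows "A \<subseteq> genideal (poly_ring n) A"
proof -
  interpret R: cring "poly_ring n" by (rule cring_poly_ring)
  show ?thesis by (rule R.genideal_self[OF assms])
qed

lemma genideal_subsetI:
  assumes "A \<subseteq> T" "T \<subseteq> polys n" "0 \<in> T" "\<And>p q. p \<in> T \<Longrightarrow> q \<in> T \<Longrightarrow> p + q \<in> T"
    "\<And>p c. p \<in> T \<Longrightarrow> c \<in> polys n \<Longrightarrow> c * p \<in> T"
  shows "genideal (poly_ring n) A \<subseteq> T"
proof -
  interpret R: cring "poly_ring n" by (rule cring_poly_ring)
  have "ideal T (poly_ring n)"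
  proof (rule idealI)
    show "ring (poly_ring n)" by (rule R.ring_axioms)
    show "subgroup T (add_monoid (poly_ring n))"
    proof
      show "T \<subseteq> carrier (add_monoid (poly_ring n))" using assms(2) by simp
      show "x \<otimes>\<^bsub>add_monoid (poly_ring n)\<^esub> y \<in> T" if "x \<in> T" "y \<in> T" for x y
        using assms(4)[OF that] by (simp add: poly_ring_sel)
      show "\<one>\<^bsub>add_monoid (poly_ring n)\<^esub> \<in> T" using assms(3) by (simp add: poly_ring_sel)
      show "inv\<^bsub>add_monoid (poly_ring n)\<^esub> x \<in> T" if x: "x \<in> T" for x
      proof -
        have xc: "x \<in> polys n" using x assms(2) by auto
        have "- x \<in> T" using assms(5)[OF x, of "- 1"] polys_uminus[OF polys_1] by simp
        moreover have "\<ominus>\<^bsub>poly_ring n\<^esub> x = - x"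
          by (rule R.minus_equality) (use xc polys_uminus in \<open>auto simp: poly_ring_sel\<close>)
        ultimately show ?thesis by (simp add: a_inv_def)
      qed
    qed
    show "x \<otimes>\<^bsub>poly_ring n\<^esub> a \<in> T" if "a \<in> T" "x \<in> polys n" for a x
      using assms(5)[OF that] by (simp add: poly_ring_sel)
    show "a \<otimes>\<^bsub>poly_ring n\<^esub> x \<in> T" if "a \<in> T" "x \<in> polys n" for a x
      using assms(5)[OF that] by (simp add: poly_ring_sel mult.commute)
  qed
  then show ?thesis using assms(1) by (rule R.genideal_minimal)
qed

section \<open>Symmetric functions and the ideal\<close>

lemma polys_hc:
  assumes "B \<subseteq> {1..n}"
  shows "hc X B d \<in> polys n"
proof -
  have "finite B" using assms by (rule finite_subset) simp
  then have "fps_nth (\<Prod>i\<in>B. Abs_fps (\<lambda>d. X i ^ d)) d \<in> polys n"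
    using assms
  proof (induction B arbitrary: d rule: finite_induct)
    case empty
    then show ?case by (cases d) auto
  next
    case (insert b B)
    have "X b ^ i \<in> polys n" for i using insert.prems by (intro polys_power polys_X) auto
    then show ?case using insert by (auto simp: fps_mult_nth intro!: polys_sum polys_mult)
  qed
  then show ?thesis by (simp add: hc_def)
qed

lemma polys_det:
  assumes "M \<in> carrier_mat m m" "\<And>i j. i < m \<Longrightarrow> j < m \<Longrightarrow> M $$ (i, j) \<in> polys n"
  shows "det M \<in> polys n"
proof -
  have sgn: "signof p \<in> polys n" for p :: "nat \<Rightarrow> nat" by (auto simp: sign_def intro: polys_uminus)
  show ?thesis
    unfolding det_def'[OF assms(1)]
  proof (rule polys_sum, rule polys_mult[OF sgn], rule polys_prod)
    fix p i assume "p \<in> {p. p permutes {0..<m}}" "i \<in> {0..<m}"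
    then have "p i < m" "i < m" using permutes_in_image[of p "{0..<m}" i] by auto
    then show "M $$ (i, p i) \<in> polys n" using assms(2) by simp
  qed
qed

lemma subsets_card_0:
  assumes "finite A"
  shows "{B. B \<subseteq> A \<and> card B = 0} = {{}}"
proof -
  have "B = {}" if "B \<subseteq> A" "card B = 0" for B
    using finite_subset[OF that(1) assms] that(2) by simp
  then show ?thesis by auto
qed

lemma prod_one_minus_nth:
  fixes x :: "nat \<Rightarrow> 'a::comm_ring_1"
  assumes "finite A"
  shows "fps_nth (\<Prod>i\<in>A. 1 - fps_const (x i) * fps_X) d =
    (-1) ^ d * (\<Sum>B | B \<subseteq> A \<and> card B = d. \<Prod>i\<in>B. x i)"
  using assms
proof (induction A arbitrary: d rule: finite_induct)
  case empty
  have eq: "{B. B \<subseteq> {} \<and> card B = d} = (if d = 0 then {{}} else {})" for d and B :: "nat set" by auto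
  show ?case unfolding eq by simp
next
  case (insert a A)
  let ?P = "\<Prod>i\<in>A. 1 - fps_const (x i) * fps_X"
  let ?E = "\<lambda>A d. \<Sum>B | B \<subseteq> A \<and> card B = d. \<Prod>i\<in>B. x i"
  show ?case
  proof (cases d)
    case 0
    note eq = subsets_card_0
    show ?thesis
      using insert.IH[of 0] insert.hyps unfolding 0 eq[OF insert.hyps(1)] eq[OF finite.insertI[OF insert.hyps(1)]]
      by simp
  next
    case (Suc e)
    have "fps_nth (\<Prod>i\<in>insert a A. 1 - fps_const (x i) * fps_X) d = fps_nth ?P (Suc e) - x a * fps_nth ?P e"
      using insert Suc by (simp add: left_diff_distrib mult.assoc fps_mult_fps_X_commute)
    also have "\<dots> = (-1) ^ Suc e * (?E A (Suc e) + x a * ?E A e)"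
      unfolding insert.IH by (simp add: algebra_simps)
    also have "?E A (Suc e) + x a * ?E A e = ?E (insert a A) (Suc e)"
    proof -
      let ?N = "{B. B \<subseteq> A \<and> card B = Suc e}" and ?M = "{B. B \<subseteq> A \<and> card B = e}"
      have fin: "finite B" if "B \<subseteq> A" for B using that insert.hyps(1) finite_subset by blast
      have "{B. B \<subseteq> insert a A \<and> card B = Suc e} = ?N \<union> insert a ` ?M"
      proof (intro equalityI subsetI)
        fix B assume B: "B \<in> {B. B \<subseteq> insert a A \<and> card B = Suc e}"
        show "B \<in> ?N \<union> insert a ` ?M"
        proof (cases "a \<in> B")
          case True
          then have "B = insert a (B - {a})" "B - {a} \<in> ?M" using B by auto
          then show ?thesis by blast
        qed (use B in auto)
      next
        fix B assume "B \<in> ?N \<union> insert a ` ?M"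
        then consider "B \<in> ?N" | C where "C \<in> ?M" "B = insert a C" by blast
        then show "B \<in> {B. B \<subseteq> insert a A \<and> card B = Suc e}"
        proof cases
          case 2
          then have "a \<notin> C" "finite C" using insert.hyps(2) fin by auto
          then show ?thesis using 2 by auto
        qed auto
      qed
      moreover have "?N \<inter> insert a ` ?M = {}" using insert.hyps(2) by auto
      moreover have "finite ?N" "finite (insert a ` ?M)" using insert.hyps(1) by auto
      ultimately have "?E (insert a A) (Suc e) = ?E A (Suc e) + (\<Sum>B\<in>insert a ` ?M. \<Prod>i\<in>B. x i)"
        by (simp add: sum.union_disjoint)
      also have "(\<Sum>B\<in>insert a ` ?M. \<Prod>i\<in>B. x i) = (\<Sum>B\<in>?M. \<Prod>i\<in>insert a B. x i)"
      proof (rule sum.reindex[unfolded o_def], rule inj_onI)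
        fix B C assume BC: "B \<in> ?M" "C \<in> ?M" "insert a B = insert a C"
        have "a \<notin> B" "a \<notin> C" using BC(1,2) insert.hyps(2) by auto
        then show "B = C" using BC(3) by (simp add: insert_ident)
      qed
      also have "\<dots> = (\<Sum>B\<in>?M. x a * (\<Prod>i\<in>B. x i))"
      proof (rule sum.cong[OF refl])
        fix B assume "B \<in> ?M"
        then have "a \<notin> B" "finite B" using insert.hyps(2) fin by auto
        then show "(\<Prod>i\<in>insert a B. x i) = x a * (\<Prod>i\<in>B. x i)" by simp
      qed
      finally show ?thesis by (simp add: sum_distrib_left)
    qed
    finally show ?thesis using Suc by simp
  qed
qed

text \<open>Multiplying the product of all \<open>1 - X i * fps_X\<close> by the geometric series
  for \<open>i \<ge> b\<close> leaves the factors with \<open>i < b\<close>. These have degree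
  \<open>b - 1\<close> in \<open>fps_X\<close>, so the coefficient at \<open>b\<close>
  vanishes.\<close>

lemma elem_sym_hc_relation:
  assumes "1 \<le> b" "b \<le> n"
  shows "(\<Sum>c=0..b. (-1) ^ c * elem_sym n c * hc X {b..n} (b - c)) = 0"
proof -
  let ?c = "\<lambda>i. 1 - fps_const (X i) * fps_X" and ?G = "\<lambda>i. Abs_fps (\<lambda>d. X i ^ d)"
  have "(\<Prod>i\<in>{1..<b}. ?c i) * (\<Prod>i\<in>{b..n}. ?c i) = (\<Prod>i\<in>{1..<b} \<union> {b..n}. ?c i)"
    by (rule prod.union_disjoint[symmetric]) auto
  also have "{1..<b} \<union> {b..n} = {1..n}"
    using assms by auto
  finally have split: "(\<Prod>i\<in>{1..<b}. ?c i) * (\<Prod>i\<in>{b..n}. ?c i) = (\<Prod>i\<in>{1..n}. ?c i)" .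
  have "(\<Prod>i\<in>{b..n}. ?c i) * (\<Prod>i\<in>{b..n}. ?G i) = (\<Prod>i\<in>{b..n}. 1)"
    unfolding prod.distrib[symmetric] by (rule prod.cong[OF refl]) (rule geometric_fps_inverse)
  then have inv: "(\<Prod>i\<in>{b..n}. ?c i) * (\<Prod>i\<in>{b..n}. ?G i) = 1" by (simp only: prod.neutral_const)
  have none: "{B. B \<subseteq> {1..<b} \<and> card B = b} = {}"
  proof -
    have "card B \<noteq> b" if "B \<subseteq> {1..<b}" for B
      using card_mono[OF _ that] assms by simp
    then show ?thesis by blast
  qed
  have "(\<Sum>c=0..b. (-1) ^ c * elem_sym n c * hc X {b..n} (b - c)) =
      fps_nth ((\<Prod>i\<in>{1..n}. ?c i) * (\<Prod>i\<in>{b..n}. ?G i)) b"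
    unfolding fps_mult_nth hc_def elem_sym_def prod_one_minus_nth[OF finite_atLeastAtMost] ..
  also have "\<dots> = fps_nth (\<Prod>i\<in>{1..<b}. ?c i) b"
    unfolding split[symmetric] mult.assoc inv by (simp only: mult_1_right)
  also have "\<dots> = 0"
    unfolding prod_one_minus_nth[OF finite_atLeastLessThan] none by (simp only: sum.empty mult_zero_right)
  finally show ?thesis .
qed

lemma elem_sym_0: "elem_sym n 0 = 1"
proof -
  have eq: "{A. A \<subseteq> {1..n} \<and> card A = 0} = {{}}" by (rule subsets_card_0) simp
  show ?thesis unfolding elem_sym_def eq by simp
qed

lemma polys_elem_sym: "elem_sym n d \<in> polys n"
  unfolding elem_sym_def by (intro polys_sum polys_prod polys_X) auto

lemma I_ideal_gens: "{X i ^ k | i. i \<in> {1..n}} \<union> {elem_sym n d | d. d \<in> {n - k + 1..n}} \<subseteq> polys n"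
proof (intro Un_least subsetI)
  fix p assume "p \<in> {X i ^ k | i. i \<in> {1..n}}"
  then obtain i where "p = X i ^ k" "i \<in> {1..n}" by blast
  then show "p \<in> polys n" by (simp only: polys_power polys_X)
next
  fix p assume "p \<in> {elem_sym n d | d. d \<in> {n - k + 1..n}}"
  then show "p \<in> polys n" using polys_elem_sym by blast
qed

text \<open>The columns of the matrix satisfy a linear relation, with coefficients the signed
  \<open>e\<^sub>0, \<dots>, e\<^sub>m\<^sub>-\<^sub>1\<close>, modulo the ideal; as \<open>e\<^sub>0 = 1\<close>, its determinant vanishes modulo the ideal.\<close>

lemma det_JT_mat_in_I_ideal:
  fixes bs hs :: "nat list"
  defines "m \<equiv> length hs"
  assumes "length bs = m" "m = n - k + 1" "set bs \<subseteq> {1..n}"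
    and hs: "\<And>i. i < m \<Longrightarrow> hs ! i + m = bs ! i + i + 1"
  shows "det (JT_mat X n bs hs) \<in> I_ideal n k"
proof -
  let ?M = "JT_mat X n bs hs"
  define v where "v j = (-1) ^ (m - 1 - j) * elem_sym n (m - 1 - j)" for j
  have M: "?M \<in> carrier_mat m m" by (simp add: m_def)
  have m: "m \<ge> 1" using assms(3) by linarith
  have b: "1 \<le> bs ! i" "bs ! i \<le> n" if "i < m" for i
  proof -
    have "bs ! i \<in> set bs" using that assms(2) by simp
    then have "bs ! i \<in> {1..n}" using assms(4) by (rule subsetD[rotated])
    then show "1 \<le> bs ! i" "bs ! i \<le> n" by simp_all
  qed
  have polysM: "?M $$ (i, j) \<in> polys n" if "i < m" "j < m" for i j
  proof -
    have "{bs ! i..n} \<subseteq> {1..n}" using b(1)[OF that(1)] by (simp add: atLeastatMost_subset_iff)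
    then show ?thesis using that polys_hc by (simp add: JT_mat_def m_def)
  qed
  have cof: "cofactor ?M i j \<in> polys n" if "i < m" "j < m" for i j
    unfolding cofactor_def
  proof (rule polys_mult)
    show "(- 1) ^ (i + j) \<in> polys n" by (intro polys_power polys_uminus polys_1)
    show "det (mat_delete ?M i j) \<in> polys n"
    proof (rule polys_det[OF mat_delete_carrier[OF M]])
      fix k l assume "k < m - 1" "l < m - 1"
      then show "mat_delete ?M i j $$ (k, l) \<in> polys n"
        using polysM M by (simp add: mat_delete_def)
    qed
  qed
  have row: "(\<Sum>j<m. ?M $$ (i, j) * v j) \<in> I_ideal n k" if i: "i < m" for i
  proof -
    let ?b = "bs ! i"
    let ?t = "\<lambda>c. (-1) ^ c * elem_sym n c * hc X {?b..n} (?b - c)"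
    have "(\<Sum>j<m. ?M $$ (i, j) * v j) = (\<Sum>c<m. if c \<le> ?b then ?t c else 0)"
    proof (rule sum.reindex_bij_witness[of _ "\<lambda>c. m - 1 - c" "\<lambda>j. m - 1 - j"])
      fix j assume j: "j \<in> {..<m}"
      define c where "c = m - 1 - j"
      have c: "j + c + 1 = m" using j by (auto simp: c_def)
      \<comment> \<open>The special shape enters here: with \<open>c\<close> counted from the last
        column, the entry of row \<open>i\<close> has degree \<open>?b - c\<close>, as in
        \<open>elem_sym_hc_relation\<close>.\<close>
      have "hs ! i + j + c = ?b + i" using hs[OF i] c by simp
      then have "i \<le> hs ! i + j \<longleftrightarrow> c \<le> ?b" "c \<le> ?b \<Longrightarrow> hs ! i + j - i = ?b - c" by linarith+
      then show "(if m - 1 - j \<le> ?b then ?t (m - 1 - j) else 0) = ?M $$ (i, j) * v j"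
        using i j unfolding c_def[symmetric] v_def by (simp add: JT_mat_def m_def[symmetric] mult.commute)
    qed auto
    also have "\<dots> = (\<Sum>c\<in>{c \<in> {..<m}. c \<le> ?b}. ?t c)" by (rule sum.inter_filter[symmetric]) simp
    \<comment> \<open>The matrix supplies the terms with \<open>c < m\<close>. The remaining ones
      contain \<open>elem_sym n c\<close> with \<open>c \<ge> n - k + 1\<close>, which are
      generators of the ideal.\<close>
    also have "\<dots> = - (\<Sum>c\<in>{m..?b}. ?t c)"
    proof -
      have "{c \<in> {..<m}. c \<le> ?b} \<union> {m..?b} = {0..?b}" by auto
      then have "0 = (\<Sum>c\<in>{c \<in> {..<m}. c \<le> ?b} \<union> {m..?b}. ?t c)"
        using elem_sym_hc_relation[OF b[OF i]] by simp
      also have "\<dots> = (\<Sum>c\<in>{c \<in> {..<m}. c \<le> ?b}. ?t c) + (\<Sum>c\<in>{m..?b}. ?t c)"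
        by (rule sum.union_disjoint) auto
      finally show ?thesis by (simp add: eq_neg_iff_add_eq_0)
    qed
    also have "\<dots> = (\<Sum>c\<in>{m..?b}. (- ((-1) ^ c) * hc X {?b..n} (?b - c)) * elem_sym n c)"
      by (simp add: sum_negf mult_ac)
    also have "\<dots> \<in> I_ideal n k"
      unfolding I_ideal_def
    proof (rule genideal_sum[OF I_ideal_gens], rule genideal_zero_add_mult(3)[OF I_ideal_gens])
      fix c assume c: "c \<in> {m..?b}"
      have "elem_sym n c \<in> {elem_sym n d | d. d \<in> {n - k + 1..n}}"
        using c b[OF i] assms(3) by auto
      then show "elem_sym n c \<in> genideal (poly_ring n)
          ({X i ^ k | i. i \<in> {1..n}} \<union> {elem_sym n d | d. d \<in> {n - k + 1..n}})"
        using genideal_superset[OF I_ideal_gens] by blast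
      show "- ((-1) ^ c) * hc X {?b..n} (?b - c) \<in> polys n"
        using b[OF i] by (intro polys_mult polys_uminus polys_power polys_1 polys_hc) auto
    qed
    finally show ?thesis .
  qed
  \<comment> \<open>Cramer's rule: the last coordinate of \<open>adj_mat ?M * ?M * v\<close> is the
    determinant times \<open>v (m - 1) = elem_sym n 0 = 1\<close>.\<close>
  have "det ?M = (\<Sum>j<m. (adj_mat ?M * ?M) $$ (m - 1, j) * v j)"
  proof -
    have "(\<Sum>j<m. (adj_mat ?M * ?M) $$ (m - 1, j) * v j) =
        (\<Sum>j<m. if j = m - 1 then det ?M * v (m - 1) else 0)"
      unfolding adj_mat(3)[OF M] using m by (intro sum.cong) auto
    also have "\<dots> = det ?M" using m by (simp add: v_def elem_sym_0)
    finally show ?thesis by simp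
  qed
  also have "\<dots> = (\<Sum>j<m. \<Sum>i<m. cofactor ?M i (m - 1) * (?M $$ (i, j) * v j))"
  proof (rule sum.cong[OF refl])
    fix j assume "j \<in> {..<m}"
    then have "(adj_mat ?M * ?M) $$ (m - 1, j) = (\<Sum>i<m. cofactor ?M i (m - 1) * ?M $$ (i, j))"
      using m M by (simp add: scalar_prod_def adj_mat_def atLeast0LessThan)
    then show "(adj_mat ?M * ?M) $$ (m - 1, j) * v j = (\<Sum>i<m. cofactor ?M i (m - 1) * (?M $$ (i, j) * v j))"
      by (simp add: sum_distrib_right mult.assoc)
  qed
  also have "\<dots> = (\<Sum>i<m. cofactor ?M i (m - 1) * (\<Sum>j<m. ?M $$ (i, j) * v j))"
    by (subst sum.swap) (simp add: sum_distrib_left)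
  also have "\<dots> \<in> I_ideal n k"
    unfolding I_ideal_def
  proof (rule genideal_sum[OF I_ideal_gens], rule genideal_zero_add_mult(3)[OF I_ideal_gens])
    fix i assume "i \<in> {..<m}"
    then have i: "i < m" by simp
    show "(\<Sum>j<m. ?M $$ (i, j) * v j) \<in> genideal (poly_ring n)
        ({X i ^ k | i. i \<in> {1..n}} \<union> {elem_sym n d | d. d \<in> {n - k + 1..n}})"
      using row[OF i] unfolding I_ideal_def .
    show "cofactor ?M i (m - 1) \<in> polys n" using cof[OF i] m by simp
  qed
  finally show ?thesis .
qed

lemma X_inj: "inj X"
proof (rule injI)
  fix i j assume "X i = X j"
  then have "Poly_Mapping.keys (X i) = Poly_Mapping.keys (X j)" by (rule arg_cong)
  then have "Poly_Mapping.single i (1::nat) = Poly_Mapping.single j 1" by (simp add: X_def)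
  then have "Poly_Mapping.keys (Poly_Mapping.single i (1::nat)) = Poly_Mapping.keys (Poly_Mapping.single j (1::nat))"
    by (rule arg_cong)
  then show "i = j" by simp
qed

lemma rev_demazure_in_I_ideal:
  assumes S: "S \<subseteq> {1..n}" and card: "card S = n - k + 1"
  shows "rev_demazure n (rev_comp n (skip_comp S)) \<in> I_ideal n k"
proof -
  let ?g = "skip_comp S" and ?bs = "desc S"
  let ?hs = "map ?g ?bs" and ?m = "card S"
  have fin: "finite S" using S finite_subset by blast
  have len: "length ?bs = ?m" using fin by simp
  have sorted: "sorted_wrt (>) ?bs" by (rule desc_sorted)
  have S': "S \<inter> {1..n} = S" using S by auto
  define N where "N = Max (insert 0 (?g ` S))"
  have N: "?g s \<le> N" if "s \<in> S" for s using that fin by (auto simp: N_def)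
  \<comment> \<open>In decreasing order the entry at position \<open>i\<close> has rank
    \<open>?m - i\<close> in \<open>S\<close>. This turns the formula for the skip composition into
    the relation between heights and bases required for membership in the ideal.\<close>
  have rank: "card {s \<in> S. s \<le> ?bs ! i} = ?m - i" if i: "i < ?m" for i
  proof -
    have "{s \<in> S. s \<le> ?bs ! i} = set (drop i ?bs)"
    proof (intro equalityI subsetI)
      fix s assume "s \<in> {s \<in> S. s \<le> ?bs ! i}"
      then have "s \<in> set ?bs" "s \<le> ?bs ! i" using fin by auto
      then obtain j where j: "j < ?m" "s = ?bs ! j" unfolding in_set_conv_nth len by blast
      have "i \<le> j"
      proof (rule ccontr)
        assume "\<not> i \<le> j"
        then have "?bs ! j > ?bs ! i" using sorted i len by (simp add: sorted_wrt_iff_nth_less)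
        then show False using \<open>s \<le> ?bs ! i\<close> j by simp
      qed
      then have "s = drop i ?bs ! (j - i)" "j - i < length (drop i ?bs)" using j len by auto
      then show "s \<in> set (drop i ?bs)" by (simp only: nth_mem)
    next
      fix s assume s: "s \<in> set (drop i ?bs)"
      then have "s \<in> S" using set_drop_subset[of i ?bs] fin by auto
      obtain j where "j < length (drop i ?bs)" "s = drop i ?bs ! j" using s unfolding in_set_conv_nth by blast
      then have j: "i + j < ?m" "s = ?bs ! (i + j)" using len by auto
      have "s \<le> ?bs ! i"
      proof (cases "j = 0")
        case False
        then have "?bs ! (i + j) < ?bs ! i" using sorted j len by (simp add: sorted_wrt_iff_nth_less)
        then show ?thesis using j by simp
      qed (use j in simp)
      then show "s \<in> {s \<in> S. s \<le> ?bs ! i}" using \<open>s \<in> S\<close> by simp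
    qed
    moreover have "distinct ?bs" by (rule sorted_wrt_greater_distinct[OF sorted])
    ultimately show ?thesis by (simp add: distinct_card len del: drop_rev)
  qed
  have "rev_demazure n (rev_comp n ?g) = Z X N S n (map ?g (desc (S \<inter> {1..n})))"
    unfolding rev_demazure_eq_Fill[OF S]
    by (rule sum_Fill_eq_Z) (use fin S N in auto)
  also have "\<dots> = det (JT_mat X n ?bs ?hs)"
  proof -
    have "Z X N (set ?bs) n ?hs = det (JT_mat X n ?bs ?hs)"
    proof (rule Z_eq_det)
      show "inj_on X {1..n}" using X_inj by (rule inj_on_subset) simp
      show "sorted_wrt (>) ?bs" by (rule desc_sorted)
      show "set ?bs \<subseteq> {1..n}" using S fin by simp
      show "sorted_wrt (\<ge>) ?hs"
        unfolding sorted_wrt_iff_nth_less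
      proof (intro allI impI)
        fix i j assume ij: "i < j" "j < length ?hs"
        have "?bs ! j < ?bs ! i" using sorted ij by (simp add: sorted_wrt_iff_nth_less)
        moreover have "?bs ! i \<in> S" "?bs ! j \<in> S" using nth_mem[of i ?bs] nth_mem[of j ?bs] ij fin by auto
        ultimately have "?g (?bs ! j) \<le> ?g (?bs ! i)" using skip_comp_mono[OF S] by simp
        then show "?hs ! j \<le> ?hs ! i" using ij by simp
      qed
      show "set ?hs \<subseteq> {..N}" using N fin by auto
    qed simp
    then show ?thesis unfolding S' using fin by simp
  qed
  also have "\<dots> \<in> I_ideal n k"
  proof (rule det_JT_mat_in_I_ideal)
    show "length ?bs = length ?hs" by simp
    show "length ?hs = n - k + 1" using len card by simp
    show "set ?bs \<subseteq> {1..n}" using S fin by simp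
    fix i assume "i < length ?hs"
    then have i: "i < ?m" using len by simp
    have "?bs ! i \<in> S" using nth_mem[of i ?bs] i len fin by auto
    then show "?hs ! i + length ?hs = ?bs ! i + i + 1"
      using rank[OF i] card_rank_le[OF S, of "?bs ! i"] i len by (simp add: skip_comp_def)
  qed
  finally show ?thesis .
qed

section \<open>Leading monomials and reducedness\<close>

abbreviation (input) K_poly :: "nat \<Rightarrow> nat set \<Rightarrow> rpoly" where
  "K_poly n S \<equiv> rev_demazure n (rev_comp n (skip_comp S))"

definition fill_wt :: "(nat \<times> nat) set \<Rightarrow> (nat \<times> nat \<Rightarrow> nat) \<Rightarrow> (nat \<Rightarrow>\<^sub>0 nat)" where
  "fill_wt C F = (\<Sum>c\<in>C. Poly_Mapping.single (F c) 1)"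

lemma lookup_fill_wt:
  "finite C \<Longrightarrow> Poly_Mapping.lookup (fill_wt C F) t = card {c \<in> C. F c = t}"
  unfolding fill_wt_def lookup_sum
  by (simp add: lookup_single when_def sum.If_cases Int_def conj_commute)

lemma prod_X: "(\<Prod>c\<in>C. X (F c)) = Poly_Mapping.single (fill_wt C F) 1"
proof (induction C rule: infinite_finite_induct)
  case (insert c C)
  then show ?case by (simp add: fill_wt_def X_def mult_single)
qed (simp_all add: fill_wt_def)

lemma X_power: "X i ^ k = Poly_Mapping.single (Poly_Mapping.single i k) 1"
  by (induction k) (simp_all add: X_def mult_single flip: single_add)

definition base_fill :: "nat set \<Rightarrow> nat \<times> nat \<Rightarrow> nat" where
  "base_fill S = (\<lambda>c\<in>columns S (skip_comp S). fst c)"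

definition skip_exp :: "nat set \<Rightarrow> (nat \<Rightarrow>\<^sub>0 nat)" where
  "skip_exp S = fill_wt (columns S (skip_comp S)) (base_fill S)"

lemma base_fill_Fill: "S \<subseteq> {1..n} \<Longrightarrow> base_fill S \<in> Fill S n (skip_comp S)"
  by (rule FillI) (auto simp: base_fill_def)

lemma lookup_skip_exp:
  assumes "finite S"
  shows "Poly_Mapping.lookup (skip_exp S) t = skip_comp S t"
proof -
  let ?C = "columns S (skip_comp S)"
  have "{c \<in> ?C. base_fill S c = t} = {t} \<times> {1..skip_comp S t}"
    using skip_comp_notin[of t S] by (cases "t \<in> S") (auto simp: base_fill_def)
  then show ?thesis using assms by (simp add: skip_exp_def lookup_fill_wt card_cartesian_product_singleton)
qed

text \<open>Let \<open>i\<close> be the first column in which some entry differs from its base.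
  Entries are at least their bases, so the exponents of smaller variables agree with those of
  \<open>base_fill\<close>, while the variable \<open>i\<close> loses at least one occurrence and
  gains none.\<close>

lemma fill_wt_less_skip_exp:
  assumes S: "S \<subseteq> {1..n}" and F: "F \<in> Fill S n (skip_comp S)" and ne: "F \<noteq> base_fill S"
  shows "fill_wt (columns S (skip_comp S)) F < skip_exp S"
proof -
  let ?C = "columns S (skip_comp S)"
  have finS: "finite S" using S finite_subset by blast
  then have finC: "finite ?C" by simp
  have ge: "fst c \<le> F c" if "c \<in> ?C" for c
    using FillD(2)[OF F, of "fst c" "snd c"] that by (cases c) simp
  define B where "B = {fst c | c. c \<in> ?C \<and> F c \<noteq> fst c}"
  have "B \<noteq> {}"
  proof
    assume "B = {}"
    then have "F c = base_fill S c" if "c \<in> ?C" for c using that by (auto simp: B_def base_fill_def)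
    then have "F = base_fill S"
      using FillD(1)[OF F] by (intro extensionalityI[of _ ?C]) (auto simp: base_fill_def)
    then show False using ne by simp
  qed
  have "B \<subseteq> S" by (auto simp: B_def)
  then have finB: "finite B" using finS finite_subset by blast
  define i where "i = Min B"
  have "i \<in> B" using finB \<open>B \<noteq> {}\<close> by (simp add: i_def)
  then obtain c0 where c0: "c0 \<in> ?C" "F c0 \<noteq> fst c0" "fst c0 = i" by (auto simp: B_def)
  have below: "F c = fst c" if "c \<in> ?C" "fst c < i" for c
  proof (rule ccontr)
    assume "F c \<noteq> fst c"
    then have "fst c \<in> B" using that by (auto simp: B_def)
    then have "i \<le> fst c" using finB by (simp add: i_def)
    then show False using that by simp
  qed
  show ?thesis
    unfolding monomial_less_iff_lex
  proof (intro exI[of _ i] conjI allI impI)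
    fix j assume j: "j < i"
    have "{c \<in> ?C. F c = j} = {c \<in> ?C. base_fill S c = j}"
    proof (intro Collect_cong conj_cong refl)
      fix c assume c: "c \<in> ?C"
      show "F c = j \<longleftrightarrow> base_fill S c = j"
      proof (cases "fst c < i")
        case True
        then show ?thesis using below[OF c] c by (simp add: base_fill_def)
      next
        case False
        then show ?thesis using ge[OF c] j c by (simp add: base_fill_def)
      qed
    qed
    then show "Poly_Mapping.lookup (fill_wt ?C F) j = Poly_Mapping.lookup (skip_exp S) j"
      using finC by (simp add: lookup_fill_wt skip_exp_def)
  next
    have "{c \<in> ?C. F c = i} \<subset> {c \<in> ?C. base_fill S c = i}"
    proof (rule psubsetI)
      show "{c \<in> ?C. F c = i} \<subseteq> {c \<in> ?C. base_fill S c = i}"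
      proof
        fix c assume "c \<in> {c \<in> ?C. F c = i}"
        then have c: "c \<in> ?C" "F c = i" by auto
        have "fst c = i" using below[OF c(1)] ge[OF c(1)] c(2) by (cases "fst c < i") auto
        then show "c \<in> {c \<in> ?C. base_fill S c = i}" using c by (simp add: base_fill_def)
      qed
      have "c0 \<in> {c \<in> ?C. base_fill S c = i}" "c0 \<notin> {c \<in> ?C. F c = i}"
        using c0 by (simp_all add: base_fill_def)
      then show "{c \<in> ?C. F c = i} \<noteq> {c \<in> ?C. base_fill S c = i}" by blast
    qed
    then have "card {c \<in> ?C. F c = i} < card {c \<in> ?C. base_fill S c = i}"
      using finC by (intro psubset_card_mono) auto
    then show "Poly_Mapping.lookup (fill_wt ?C F) i < Poly_Mapping.lookup (skip_exp S) i"
      using finC by (simp add: lookup_fill_wt skip_exp_def)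
  qed
qed

lemma lookup_K_poly:
  assumes S: "S \<subseteq> {1..n}"
  shows "Poly_Mapping.lookup (K_poly n S) m =
    of_nat (card {F \<in> Fill S n (skip_comp S). fill_wt (columns S (skip_comp S)) F = m})"
proof -
  have "finite (Fill S n (skip_comp S))" using S finite_subset by (intro finite_Fill) blast
  then show ?thesis
    unfolding rev_demazure_eq_Fill[OF S] prod_X lookup_sum
    by (simp add: lookup_single when_def sum.If_cases Int_def conj_commute)
qed

lemma keys_K_poly:
  assumes S: "S \<subseteq> {1..n}"
  shows "Poly_Mapping.keys (K_poly n S) = fill_wt (columns S (skip_comp S)) ` Fill S n (skip_comp S)"
proof -
  have "finite (Fill S n (skip_comp S))" using S finite_subset by (intro finite_Fill) blast
  then show ?thesis
    by (auto simp: in_keys_iff lookup_K_poly[OF S] card_eq_0_iff)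
qed

lemma lead_K_poly:
  assumes S: "S \<subseteq> {1..n}"
  shows "lead_exp (K_poly n S) = skip_exp S" "lead_coef (K_poly n S) = 1" "K_poly n S \<noteq> 0"
proof -
  let ?wt = "fill_wt (columns S (skip_comp S))"
  have finF: "finite (Fill S n (skip_comp S))" using S finite_subset by (intro finite_Fill) blast
  have base: "base_fill S \<in> Fill S n (skip_comp S)" by (rule base_fill_Fill[OF S])
  have le: "?wt F \<le> skip_exp S" if "F \<in> Fill S n (skip_comp S)" for F
    using fill_wt_less_skip_exp[OF S that] by (cases "F = base_fill S") (auto simp: skip_exp_def)
  show lead: "lead_exp (K_poly n S) = skip_exp S"
    unfolding lead_exp_def keys_K_poly[OF S]
    by (rule Max_eqI) (use finF le base in \<open>auto simp: skip_exp_def\<close>)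
  have "{F \<in> Fill S n (skip_comp S). ?wt F = skip_exp S} = {base_fill S}"
  proof (intro equalityI subsetI)
    fix F assume "F \<in> {F \<in> Fill S n (skip_comp S). ?wt F = skip_exp S}"
    then show "F \<in> {base_fill S}" using fill_wt_less_skip_exp[OF S, of F] by auto
  qed (use base in \<open>auto simp: skip_exp_def\<close>)
  then show "lead_coef (K_poly n S) = 1"
    by (simp add: lead_coef_def lead lookup_K_poly[OF S])
  then show "K_poly n S \<noteq> 0" by (auto simp: lead_coef_def)
qed

section \<open>Bounds on exponents and divisibility of skip monomials\<close>

lemma skip_comp_less:
  assumes S: "S \<subseteq> {1..n - 1}" and card: "card S = n - k + 1" and "k \<le> n" "s \<in> S"
  shows "skip_comp S s < k"
proof -
  have fin: "finite S" using S finite_subset by blast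
  have "S = {s' \<in> S. s' \<le> s} \<union> {s' \<in> S. s < s'}" by auto
  then have "card S = card ({s' \<in> S. s' \<le> s} \<union> {s' \<in> S. s < s'})" by (rule arg_cong)
  also have "\<dots> = card {s' \<in> S. s' \<le> s} + card {s' \<in> S. s < s'}"
    using fin by (intro card_Un_disjoint) auto
  \<comment> \<open>Since \<open>n\<close> is excluded, at most \<open>n - 1 - s\<close> elements
    lie above \<open>s\<close>. This keeps the part below \<open>k\<close>; an element
    \<open>n\<close> of \<open>S\<close> would have part \<open>k\<close>.\<close>
  also have "card {s' \<in> S. s < s'} \<le> card {s<..n - 1}" using S by (intro card_mono) auto
  finally have "n - k + 1 \<le> card {s' \<in> S. s' \<le> s} + (n - 1 - s)" using card by simp
  moreover have "1 \<le> s" "s \<le> n - 1" using S assms(4) by auto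
  moreover have "card {s' \<in> S. s' \<le> s} \<le> s" by (rule card_rank_le[OF S])
  ultimately show ?thesis using assms(3,4) by (simp add: skip_comp_def)
qed

text \<open>Either \<open>F (i, r) < F (j, r)\<close>, or
  \<open>F (j, r) \<le> F (j, Suc r) < F (i, r)\<close>.\<close>

lemma Fill_row_inj:
  assumes S: "S \<subseteq> {1..n}" and F: "F \<in> Fill S n (skip_comp S)"
    and ij: "i \<in> S" "j \<in> S" "i < j" "1 \<le> r" "r \<le> skip_comp S i"
  shows "F (i, r) \<noteq> F (j, r)"
proof -
  have rj: "r \<le> skip_comp S j" using skip_comp_mono[OF S ij(1,2)] ij by simp
  from FillD(4)[OF F ij rj] FillD(3)[OF F ij(2,4)] show ?thesis by auto
qed

text \<open>Equal entries lie in different rows, and there are at most \<open>k - 1\<close>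
  rows.\<close>

lemma K_poly_exponent_less:
  assumes S: "S \<subseteq> {1..n - 1}" and card: "card S = n - k + 1" and k: "1 \<le> k" "k \<le> n"
    and m: "m \<in> Poly_Mapping.keys (K_poly n S)"
  shows "Poly_Mapping.lookup m t < k"
proof -
  let ?C = "columns S (skip_comp S)"
  have S': "S \<subseteq> {1..n}" by (rule order_trans[OF S]) (simp add: atLeastatMost_subset_iff)
  have finC: "finite ?C" using finite_subset[OF S] by simp
  obtain F where F: "F \<in> Fill S n (skip_comp S)" "m = fill_wt ?C F"
    using m unfolding keys_K_poly[OF S'] by blast
  have "inj_on snd {c \<in> ?C. F c = t}"
  proof (rule inj_onI)
    fix c d assume cd: "c \<in> {c \<in> ?C. F c = t}" "d \<in> {c \<in> ?C. F c = t}" "snd c = snd d"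
    obtain i r where c: "c = (i, r)" by (cases c)
    obtain j where d: "d = (j, r)" using cd(3) c by (cases d) auto
    have ij: "i \<in> S" "j \<in> S" "1 \<le> r" "r \<le> skip_comp S i" "r \<le> skip_comp S j" "F (i, r) = F (j, r)"
      using cd c d by auto
    have "\<not> i < j" "\<not> j < i"
      using Fill_row_inj[OF S' F(1) ij(1,2) _ ij(3,4)] Fill_row_inj[OF S' F(1) ij(2,1) _ ij(3,5)] ij(6) by auto
    then show "c = d" using c d by simp
  qed
  then have "card {c \<in> ?C. F c = t} = card (snd ` {c \<in> ?C. F c = t})" by (simp add: card_image)
  also have "snd ` {c \<in> ?C. F c = t} \<subseteq> {1..k - 1}"
  proof
    fix r assume "r \<in> snd ` {c \<in> ?C. F c = t}"
    then obtain c where "c \<in> ?C" "r = snd c" by blast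
    then show "r \<in> {1..k - 1}" using skip_comp_less[OF S card k(2), of "fst c"] by (cases c) auto
  qed
  then have "card (snd ` {c \<in> ?C. F c = t}) \<le> card {1..k - 1}" by (intro card_mono) auto
  finally show ?thesis using k F finC by (simp add: lookup_fill_wt)
qed

definition below :: "nat set \<Rightarrow> nat \<Rightarrow> int" where
  "below S v = int (card {s \<in> S. s \<le> v})"

lemma below_Suc:
  "below S (Suc v) = below S v + (if Suc v \<in> S then 1 else 0)"
proof -
  have eq: "{s \<in> S. s \<le> Suc v} = (if Suc v \<in> S then insert (Suc v) {s \<in> S. s \<le> v} else {s \<in> S. s \<le> v})"
    by (auto simp: le_Suc_eq)
  have "finite {s \<in> S. s \<le> v}" by (rule finite_subset[of _ "{..v}"]) auto
  then show ?thesis unfolding below_def eq by simp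
qed

lemma below_bound: "S \<subseteq> {1..n} \<Longrightarrow> below S v \<le> int v"
  using card_rank_le[of S n v] by (simp add: below_def)

text \<open>Abel summation, with all terms moved so that no division by \<open>2\<close> occurs.\<close>

lemma sum_skip_comp:
  assumes S: "S \<subseteq> {1..n}"
  shows "2 * (\<Sum>t\<le>v. int (skip_comp S t)) + 2 * (\<Sum>u<v. below S u) + below S v * (below S v - 1) =
    2 * int v * below S v"
proof (induction v)
  case 0
  have "{s \<in> S. s \<le> 0} = {}" using S by auto
  then have "below S 0 = 0" by (simp add: below_def)
  moreover have "0 \<notin> S" using S by auto
  ultimately show ?case by (simp add: skip_comp_notin)
next
  case (Suc v)
  show ?case
  proof (cases "Suc v \<in> S")
    case True
    have "int (skip_comp S (Suc v)) = int (Suc v) - below S (Suc v) + 1"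
      using True card_rank_le[OF S, of "Suc v"] by (simp add: skip_comp_def below_def)
    then show ?thesis using Suc True by (simp add: below_Suc algebra_simps)
  next
    case False
    then show ?thesis using Suc by (simp add: below_Suc skip_comp_notin algebra_simps)
  qed
qed

text \<open>At the first \<open>v\<close> with \<open>below T v > below S v\<close> the difference
  is one, and \<open>sum_skip_comp\<close> makes the partial sum of \<open>T\<close> exceed that of
  \<open>S\<close> by at least \<open>v - below S v > 0\<close>. So
  \<open>below T \<le> below S\<close>. At \<open>n\<close> the counts agree, and comparing the full
  sums gives the reverse inequality for the accumulated counts, hence equality everywhere.\<close>

lemma skip_dominance:
  assumes S: "S \<subseteq> {1..n}" and T: "T \<subseteq> {1..n}" and card: "card T = card S"
    and le: "\<And>v. (\<Sum>t\<le>v. int (skip_comp T t)) \<le> (\<Sum>t\<le>v. int (skip_comp S t))"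
  shows "T = S"
proof -
  have dom: "below T v \<le> below S v" for v
  proof (induction v rule: less_induct)
    case (less v)
    show ?case
    proof (rule ccontr)
      assume gt: "\<not> below T v \<le> below S v"
      obtain u where v: "v = Suc u"
      proof (cases v)
        case 0
        have "{s \<in> T. s \<le> 0} = {}" using T by auto
        then have "below T v = 0" by (simp add: below_def 0)
        moreover have "0 \<le> below S v" by (simp add: below_def)
        ultimately show ?thesis using gt by simp
      qed
      have "below T v \<le> below S v + 1"
        using less[of u] v below_Suc[of T u] below_Suc[of S u] by (auto split: if_splits)
      then have eq: "below T v = below S v + 1" using gt by simp
      have "(\<Sum>u<v. below T u) \<le> (\<Sum>u<v. below S u)" using less by (intro sum_mono) auto
      moreover have "below T v \<le> int v" by (rule below_bound[OF T])
      moreover note sum_skip_comp[OF S, of v] sum_skip_comp[OF T, of v, unfolded eq] le[of v]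
      ultimately show False by (simp add: algebra_simps eq)
    qed
  qed
  have "{s \<in> S. s \<le> n} = S" "{s \<in> T. s \<le> n} = T" using S T by auto
  then have n: "below T n = below S n" using card by (simp add: below_def)
  have "(\<Sum>u<n. below S u) \<le> (\<Sum>u<n. below T u)"
    using sum_skip_comp[OF S, of n] sum_skip_comp[OF T, of n] le[of n] n by simp
  then have "(\<Sum>u<n. below S u - below T u) \<le> 0" by (simp add: sum_subtractf)
  moreover have nonneg: "\<And>u. u \<in> {..<n} \<Longrightarrow> 0 \<le> below S u - below T u" using dom by simp
  moreover have "0 \<le> (\<Sum>u<n. below S u - below T u)" by (rule sum_nonneg[OF nonneg])
  ultimately have "(\<Sum>u<n. below S u - below T u) = 0" by simp
  then have "below S u = below T u" if "u < n" for u
    using that sum_nonneg_eq_0_iff[OF finite_lessThan nonneg] by simp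
  then have eq: "below S u = below T u" if "u \<le> n" for u
    using that n by (cases "u = n") auto
  have "Suc u \<in> S \<longleftrightarrow> Suc u \<in> T" if "Suc u \<le> n" for u
    using eq[of u] eq[of "Suc u"] that below_Suc[of S u] below_Suc[of T u] by (auto split: if_splits)
  then have "u \<in> S \<longleftrightarrow> u \<in> T" if "u \<in> {1..n}" for u using that by (cases u) auto
  then show ?thesis using S T by blast
qed

text \<open>A cell with entry at most \<open>v\<close> lies in a column with base at most
  \<open>v\<close>. So the partial exponent sums of \<open>m\<close> are bounded by those of
  \<open>skip_exp S\<close>, and divisibility by \<open>skip_exp T\<close> would transfer the bound
  to \<open>T\<close>.\<close>

lemma K_poly_not_dvd:
  assumes S: "S \<subseteq> {1..n}" and T: "T \<subseteq> {1..n}" and card: "card T = card S" and "T \<noteq> S"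
    and m: "m \<in> Poly_Mapping.keys (K_poly n S)"
  shows "\<not> mon_dvd (skip_exp T) m"
proof
  assume "mon_dvd (skip_exp T) m"
  then obtain c where c: "m = skip_exp T + c" by (auto simp: mon_dvd_def)
  let ?C = "columns S (skip_comp S)"
  have fin: "finite S" "finite T" using S T finite_subset by blast+
  then have finC: "finite ?C" by simp
  obtain F where F: "F \<in> Fill S n (skip_comp S)" "m = fill_wt ?C F"
    using m unfolding keys_K_poly[OF S] by blast
  have "(\<Sum>t\<le>v. skip_comp T t) \<le> (\<Sum>t\<le>v. skip_comp S t)" for v
  proof -
    have "(\<Sum>t\<le>v. skip_comp T t) \<le> (\<Sum>t\<le>v. card {c \<in> ?C. F c = t})"
    proof (rule sum_mono)
      fix t
      have "skip_comp T t \<le> Poly_Mapping.lookup m t"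
        unfolding c lookup_add lookup_skip_exp[OF fin(2)] by simp
      then show "skip_comp T t \<le> card {c \<in> ?C. F c = t}"
        unfolding F(2) lookup_fill_wt[OF finC] .
    qed
    also have "\<dots> = card (\<Union>t\<le>v. {c \<in> ?C. F c = t})"
      using finC by (intro card_UN_disjoint[symmetric]) auto
    also have "\<dots> \<le> card (\<Union>t\<le>v. {t} \<times> {1..skip_comp S t})"
    proof (rule card_mono)
      show "(\<Union>t\<le>v. {c \<in> ?C. F c = t}) \<subseteq> (\<Union>t\<le>v. {t} \<times> {1..skip_comp S t})"
      proof
        fix d assume "d \<in> (\<Union>t\<le>v. {c \<in> ?C. F c = t})"
        then have d: "d \<in> ?C" "F d \<le> v" by auto
        then have "fst d \<le> F d" using FillD(2)[OF F(1), of "fst d" "snd d"] by (cases d) simp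
        then show "d \<in> (\<Union>t\<le>v. {t} \<times> {1..skip_comp S t})" using d by (cases d) auto
      qed
    qed auto
    also have "\<dots> = (\<Sum>t\<le>v. card ({t} \<times> {1..skip_comp S t}))"
      by (rule card_UN_disjoint) auto
    also have "\<dots> = (\<Sum>t\<le>v. skip_comp S t)" by simp
    finally show ?thesis .
  qed
  then have "(\<Sum>t\<le>v. int (skip_comp T t)) \<le> (\<Sum>t\<le>v. int (skip_comp S t))" for v
    by (simp flip: of_nat_sum)
  then show False using skip_dominance[OF S T card] assms(4) by blast
qed

section \<open>Counting standard monomials\<close>

text \<open>\<open>passed 0\<close> counts the positions not selected when a set \<open>S\<close> with skip monomial dividing the given
  one is built greedily from left to right.\<close>

fun passed :: "nat \<Rightarrow> nat list \<Rightarrow> nat" where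
  "passed z [] = z"
| "passed z (a # as) = passed (if z < a then z else Suc z) as"

lemma passed_snoc: "passed z (as @ [a]) = (if passed z as < a then passed z as else Suc (passed z as))"
  by (induction as arbitrary: z) auto

lemma passed_ge: "z \<le> passed z as"
  by (induction as arbitrary: z) (auto intro: order_trans[rotated] Suc_leD)

definition words :: "nat \<Rightarrow> nat \<Rightarrow> nat list set" where
  "words k n = {xs. set xs \<subseteq> {..<k} \<and> length xs = n}"

lemma finite_words: "finite (words k n)"
  unfolding words_def by (rule finite_lists_length_eq) simp

lemma card_words_Suc:
  "card {xs \<in> words k (Suc n). P xs} = (\<Sum>a<k. card {xs \<in> words k n. P (a # xs)})"
proof -
  have "{xs \<in> words k (Suc n). P xs} = (\<Union>a<k. (#) a ` {xs \<in> words k n. P (a # xs)})"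
  proof (intro equalityI subsetI)
    fix xs assume "xs \<in> {xs \<in> words k (Suc n). P xs}"
    then show "xs \<in> (\<Union>a<k. (#) a ` {xs \<in> words k n. P (a # xs)})"
      by (cases xs) (auto simp: words_def)
  qed (auto simp: words_def)
  also have "card \<dots> = (\<Sum>a<k. card ((#) a ` {xs \<in> words k n. P (a # xs)}))"
    using finite_words by (intro card_UN_disjoint) auto
  also have "\<dots> = (\<Sum>a<k. card {xs \<in> words k n. P (a # xs)})"
    by (intro sum.cong refl card_image) auto
  finally show ?thesis .
qed

text \<open>The \<open>z + 1\<close> letters up to \<open>z\<close> raise the counter, the other
  \<open>k - 1 - z\<close> letters keep it.\<close>

lemma card_words_passed_Suc:
  assumes "z < k"
  shows "card {xs \<in> words k (Suc n). k \<le> passed z xs} =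
    Suc z * card {xs \<in> words k n. k \<le> passed (Suc z) xs} + (k - 1 - z) * card {xs \<in> words k n. k \<le> passed z xs}"
proof -
  have "{..<k} = {..z} \<union> {z<..<k}" using assms by auto
  moreover have "{..z} \<inter> {z<..<k} = {}" by auto
  ultimately have "card {xs \<in> words k (Suc n). k \<le> passed z xs} =
      (\<Sum>a\<le>z. card {xs \<in> words k n. k \<le> passed z (a # xs)}) +
      (\<Sum>a\<in>{z<..<k}. card {xs \<in> words k n. k \<le> passed z (a # xs)})"
    unfolding card_words_Suc by (simp add: sum.union_disjoint)
  also have "(\<Sum>a\<le>z. card {xs \<in> words k n. k \<le> passed z (a # xs)}) =
      (\<Sum>a\<le>z. card {xs \<in> words k n. k \<le> passed (Suc z) xs})"
    by (rule sum.cong) auto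
  also have "(\<Sum>a\<in>{z<..<k}. card {xs \<in> words k n. k \<le> passed z (a # xs)}) =
      (\<Sum>a\<in>{z<..<k}. card {xs \<in> words k n. k \<le> passed z xs})"
    by (rule sum.cong) auto
  finally show ?thesis by simp
qed

text \<open>Here \<open>z\<close> is the number of letters allowed to be missing. Any letter may
  precede a word that misses at most \<open>z\<close> letters; before a word missing exactly
  \<open>z + 1\<close>, only one of these \<open>z + 1\<close> letters helps.\<close>

lemma card_words_image_Suc:
  assumes "z < k"
  shows "card {xs \<in> words k (Suc n). k - z \<le> card (set xs)} =
    Suc z * card {xs \<in> words k n. k - Suc z \<le> card (set xs)} +
    (k - 1 - z) * card {xs \<in> words k n. k - z \<le> card (set xs)}"
proof -
  let ?A = "{xs \<in> words k n. k - z \<le> card (set xs)}"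
  let ?B = "{xs \<in> words k n. card (set xs) = k - Suc z}"
  have fin: "finite ?A" "finite ?B" using finite_words by auto
  have AB: "{xs \<in> words k n. k - Suc z \<le> card (set xs)} = ?A \<union> ?B" using assms by auto
  have disj: "?A \<inter> ?B = {}" using assms by auto
  have inner: "card {a \<in> {..<k}. k - z \<le> card (set (a # xs))} =
      (if xs \<in> ?A then k else if xs \<in> ?B then Suc z else 0)" if w: "xs \<in> words k n" for xs
  proof -
    have sub: "set xs \<subseteq> {..<k}" using w by (simp add: words_def)
    consider "xs \<in> ?A" | "xs \<in> ?B" "xs \<notin> ?A" | "card (set xs) < k - Suc z"
      using w assms by fastforce
    then show ?thesis
    proof cases
      case 1
      then have "k - z \<le> card (set (a # xs))" for a
        using card_insert_le[of "set xs" a] by (simp add: card_insert_if)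
      then have "{a \<in> {..<k}. k - z \<le> card (set (a # xs))} = {..<k}" by blast
      then show ?thesis using 1 by simp
    next
      case 2
      then have c: "card (set xs) = k - Suc z" by simp
      have "{a \<in> {..<k}. k - z \<le> card (set (a # xs))} = {..<k} - set xs"
        using c assms by (auto simp: card_insert_if split: if_splits)
      also have "card \<dots> = Suc z" using sub c assms by (simp add: card_Diff_subset)
      finally show ?thesis using 2 by simp
    next
      case 3
      have "\<not> k - z \<le> card (set (a # xs))" for a
      proof -
        have "card (set (a # xs)) \<le> Suc (card (set xs))" by (simp add: card_insert_if)
        then show ?thesis using 3 by linarith
      qed
      then have "{a \<in> {..<k}. k - z \<le> card (set (a # xs))} = {}" by blast
      then show ?thesis using 3 by auto
    qed
  qed
  have "card {xs \<in> words k (Suc n). k - z \<le> card (set xs)} =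
      (\<Sum>a<k. \<Sum>xs\<in>words k n. if k - z \<le> card (set (a # xs)) then 1 else 0)"
    unfolding card_words_Suc using finite_words by (simp add: sum.If_cases Int_def conj_commute)
  also have "\<dots> = (\<Sum>xs\<in>words k n. \<Sum>a<k. if k - z \<le> card (set (a # xs)) then 1 else 0)"
    by (rule sum.swap)
  also have "\<dots> = (\<Sum>xs\<in>words k n. card {a \<in> {..<k}. k - z \<le> card (set (a # xs))})"
    by (intro sum.cong refl) (simp add: sum.If_cases Int_def)
  also have "\<dots> = (\<Sum>xs\<in>words k n. (if xs \<in> ?A then k else 0) + (if xs \<in> ?B then Suc z else 0))"
  proof (intro sum.cong refl)
    fix xs assume xs: "xs \<in> words k n"
    have "\<not> (xs \<in> ?A \<and> xs \<in> ?B)" using disj by blast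
    then show "card {a \<in> {..<k}. k - z \<le> card (set (a # xs))} =
        (if xs \<in> ?A then k else 0) + (if xs \<in> ?B then Suc z else 0)"
      unfolding inner[OF xs]
      by (cases "xs \<in> ?A"; cases "xs \<in> ?B") (simp_all only: if_True if_False add_0_right add_0_left simp_thms)
  qed
  also have "\<dots> = k * card ?A + Suc z * card ?B"
  proof -
    have "(\<Sum>x\<in>W. if x \<in> A then c else 0) = c * card A" if "finite W" "A \<subseteq> W"
      for W A :: "nat list set" and c :: nat
      using that by (simp add: sum.If_cases Int_absorb1)
    note this[OF finite_words]
    moreover have "?A \<subseteq> words k n" "?B \<subseteq> words k n" by auto
    ultimately show ?thesis by (simp only: sum.distrib)
  qed
  also have "\<dots> = Suc z * (card ?A + card ?B) + (k - 1 - z) * card ?A"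
  proof -
    have "k = Suc z + (k - 1 - z)" using assms by simp
    then have "k * card ?A = Suc z * card ?A + (k - 1 - z) * card ?A"
      by (metis add_mult_distrib)
    then show ?thesis by (simp add: add_mult_distrib2)
  qed
  also have "card ?A + card ?B = card (?A \<union> ?B)" by (rule card_Un_disjoint[symmetric, OF fin disj])
  finally show ?thesis unfolding AB .
qed

text \<open>Both sides obey the same recursion in \<open>n\<close>, the left one by removing the first letter
  and the right one by counting the letters that may be prepended.\<close>

lemma card_passed_eq_card_image:
  "z \<le> k \<Longrightarrow> card {xs \<in> words k n. k \<le> passed z xs} = card {xs \<in> words k n. k - z \<le> card (set xs)}"
proof (induction n arbitrary: z)
  case 0
  have "words k 0 = {[]}" by (auto simp: words_def)
  then have "xs = []" if "xs \<in> words k 0" for xs using that by simp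
  then have "{xs \<in> words k 0. k \<le> passed z xs} = {xs \<in> words k 0. k - z \<le> card (set xs)}"
    by fastforce
  then show ?case by (simp only:)
next
  case (Suc n)
  show ?case
  proof (cases "z = k")
    case True
    have "k \<le> passed k xs" for xs by (rule passed_ge)
    then show ?thesis by (simp add: True)
  next
    case False
    then have z: "z < k" using Suc.prems by simp
    then show ?thesis
      unfolding card_words_passed_Suc[OF z] card_words_image_Suc[OF z]
      using Suc.IH[of z] Suc.IH[of "Suc z"] by simp
  qed
qed

text \<open>If \<open>z\<close> positions have been passed over, selecting the next position gives
  it the part \<open>z + 1\<close>, which is admissible exactly if \<open>z < g\<close>. Fewer than
  \<open>k\<close> rejected positions mean at least \<open>n - k + 1\<close> selected ones.\<close>

lemma greedy_skip_comp:
  fixes g :: "nat \<Rightarrow> nat"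
  assumes k: "1 \<le> k" "k \<le> n" and few: "passed 0 (map g [1..<Suc n]) < k"
  shows "\<exists>S. S \<subseteq> {1..n} \<and> card S = n - k + 1 \<and> (\<forall>s\<in>S. skip_comp S s \<le> g s)"
proof -
  define z where "z i = passed 0 (map g [1..<Suc i])" for i
  have z0: "z 0 = 0" by (simp add: z_def)
  have zS: "z (Suc i) = (if z i < g (Suc i) then z i else Suc (z i))" for i
    by (simp add: z_def passed_snoc)
  define R where "R = {Suc i | i. i < n \<and> z i < g (Suc i)}"
  define c where "c i = card {s \<in> R. s \<le> i}" for i
  have R: "R \<subseteq> {1..n}" by (auto simp: R_def)
  have cS: "c (Suc i) = c i + (if Suc i \<in> R then 1 else 0)" for i
  proof -
    have eq: "{s \<in> R. s \<le> Suc i} = (if Suc i \<in> R then insert (Suc i) {s \<in> R. s \<le> i} else {s \<in> R. s \<le> i})"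
      by (auto simp: le_Suc_eq)
    have "finite {s \<in> R. s \<le> i}" by (rule finite_subset[of _ "{..i}"]) auto
    then show ?thesis unfolding c_def eq by simp
  qed
  have c0: "c 0 = 0"
  proof -
    have "{s \<in> R. s \<le> 0} = {}" using R by auto
    then show ?thesis unfolding c_def by simp
  qed
  have cz: "c i + z i = i" if "i \<le> n" for i
    using that
  proof (induction i)
    case 0
    then show ?case by (simp add: c0 z0)
  next
    case (Suc i)
    moreover have "Suc i \<in> R \<longleftrightarrow> z i < g (Suc i)" using Suc.prems by (auto simp: R_def)
    ultimately show ?case by (simp add: cS zS)
  qed
  have "n - k + 1 \<le> c n" using cz[of n] few k by (simp add: z_def)
  \<comment> \<open>The count rises by at most one per position, so it attains every smaller value.
    Cutting the selection at such a position keeps the ranks, hence the parts, of what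
    remains.\<close>
  have "\<exists>v\<le>n. c v = m" if "m \<le> c n" for m
    using that
  proof (induction "c n - m" arbitrary: m)
    case 0
    then show ?case by (intro exI[of _ n]) simp
  next
    case (Suc d)
    then have "d = c n - Suc m" "Suc m \<le> c n" by linarith+
    then obtain v where v: "v \<le> n" "c v = Suc m" using Suc.hyps(1) by blast
    define u where "u = (LEAST u. c u = Suc m)"
    have u: "c u = Suc m" unfolding u_def by (rule LeastI[of _ v]) (rule v)
    have uv: "u \<le> v" unfolding u_def by (rule Least_le) (rule v)
    obtain w where w: "u = Suc w" using u c0 by (cases u) auto
    have "c w \<noteq> Suc m" using not_less_Least[of w "\<lambda>u. c u = Suc m"] w by (simp add: u_def[symmetric])
    then have "c w = m" using u cS[of w] w by (auto split: if_splits)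
    then show ?case using uv v w by (intro exI[of _ w]) simp
  qed
  then obtain v where v: "v \<le> n" "c v = n - k + 1" using \<open>n - k + 1 \<le> c n\<close> by blast
  define S where "S = {s \<in> R. s \<le> v}"
  have "skip_comp S s \<le> g s" if s: "s \<in> S" for s
  proof -
    have "s \<in> R" "s \<le> v" using s by (auto simp: S_def)
    then obtain i where i: "s = Suc i" "i < n" "z i < g (Suc i)" by (auto simp: R_def)
    have "{s' \<in> S. s' \<le> s} = {s' \<in> R. s' \<le> s}" using \<open>s \<le> v\<close> by (auto simp: S_def)
    then have "skip_comp S s = s - c s + 1" using s by (simp add: skip_comp_def c_def)
    also have "s - c s = z s" using cz[of s] i by simp
    also have "z s = z i" using i by (simp add: zS)
    finally show ?thesis using i by simp
  qed
  then show ?thesis using v R by (intro exI[of _ S]) (auto simp: S_def c_def)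
qed

section \<open>Vanishing on the surjective words\<close>

definition monomials :: "nat \<Rightarrow> (nat \<Rightarrow>\<^sub>0 nat) set" where
  "monomials n = {m. Poly_Mapping.keys m \<subseteq> {1..n}}"

definition deg :: "nat \<Rightarrow> (nat \<Rightarrow>\<^sub>0 nat) \<Rightarrow> nat" where
  "deg n m = (\<Sum>i\<in>{1..n}. Poly_Mapping.lookup m i)"

definition mval :: "nat \<Rightarrow> nat list \<Rightarrow> (nat \<Rightarrow>\<^sub>0 nat) \<Rightarrow> rat" where
  "mval n ys m = (\<Prod>i\<in>{1..n}. of_nat (ys ! (i - 1)) ^ Poly_Mapping.lookup m i)"

lemma deg_add: "deg n (a + b) = deg n a + deg n b"
  by (simp add: deg_def lookup_add sum.distrib)

lemma mval_add: "mval n ys (a + b) = mval n ys a * mval n ys b"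
  by (simp add: mval_def lookup_add power_add prod.distrib)

lemma mval_0 [simp]: "mval n ys 0 = 1"
  by (simp add: mval_def)

lemma deg_single: "i \<in> {1..n} \<Longrightarrow> deg n (Poly_Mapping.single i e) = e"
  by (simp add: deg_def lookup_single when_def)

lemma mval_single:
  assumes "i \<in> {1..n}"
  shows "mval n ys (Poly_Mapping.single i e) = of_nat (ys ! (i - 1)) ^ e"
proof -
  have "mval n ys (Poly_Mapping.single i e) = (\<Prod>j\<in>{1..n}. if j = i then of_nat (ys ! (i - 1)) ^ e else 1)"
    unfolding mval_def by (intro prod.cong) (auto simp: lookup_single when_def)
  then show ?thesis using assms by simp
qed

lemma monomials_add: "a \<in> monomials n \<Longrightarrow> b \<in> monomials n \<Longrightarrow> a + b \<in> monomials n"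
  using Poly_Mapping.keys_add[of a b] by (auto simp: monomials_def)

lemma monomials_single: "i \<in> {1..n} \<Longrightarrow> Poly_Mapping.single i e \<in> monomials n"
  by (simp add: monomials_def)

lemma polys_keys: "p \<in> polys n \<Longrightarrow> m \<in> Poly_Mapping.keys p \<Longrightarrow> m \<in> monomials n"
  by (simp add: polys_iff monomials_def)

lemma polys_single: "m \<in> monomials n \<Longrightarrow> Poly_Mapping.single m c \<in> polys n"
  by (simp add: polys_iff monomials_def)

definition hom_part :: "nat \<Rightarrow> nat \<Rightarrow> rpoly \<Rightarrow> nat list \<Rightarrow> rat" where
  "hom_part n d p ys = (\<Sum>m\<in>Poly_Mapping.keys p. if deg n m = d then Poly_Mapping.lookup p m * mval n ys m else 0)"

lemma hom_part_add: "hom_part n d (p + q) ys = hom_part n d p ys + hom_part n d q ys"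
  unfolding hom_part_def
  by (rule setsum_keys_plus_distrib) (simp_all add: distrib_right)

lemma hom_part_0 [simp]: "hom_part n d 0 ys = 0"
  by (simp add: hom_part_def)

lemma hom_part_sum: "hom_part n d (sum f A) ys = (\<Sum>i\<in>A. hom_part n d (f i) ys)"
  by (induction A rule: infinite_finite_induct) (simp_all add: hom_part_add)

lemma hom_part_single:
  "hom_part n d (Poly_Mapping.single m c) ys = (if deg n m = d then c * mval n ys m else 0)"
  by (simp add: hom_part_def)

lemma poly_as_sum: "p = (\<Sum>m\<in>Poly_Mapping.keys p. Poly_Mapping.single m (Poly_Mapping.lookup p m))"
  for p :: rpoly
proof (rule poly_mapping_eqI)
  fix k
  have "(\<Sum>m\<in>Poly_Mapping.keys p. Poly_Mapping.lookup p m when m = k) =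
      (\<Sum>m\<in>Poly_Mapping.keys p. if m = k then Poly_Mapping.lookup p k else 0)"
    by (intro sum.cong) auto
  then show "Poly_Mapping.lookup p k =
      Poly_Mapping.lookup (\<Sum>m\<in>Poly_Mapping.keys p. Poly_Mapping.single m (Poly_Mapping.lookup p m)) k"
    by (simp add: lookup_sum lookup_single in_keys_iff)
qed

lemma hom_part_mult_single:
  "hom_part n d (Poly_Mapping.single b r * p) ys =
    (if deg n b \<le> d then r * mval n ys b * hom_part n (d - deg n b) p ys else 0)"
proof -
  have "Poly_Mapping.single b r * p =
      (\<Sum>m\<in>Poly_Mapping.keys p. Poly_Mapping.single (b + m) (r * Poly_Mapping.lookup p m))"
    by (subst poly_as_sum[of p]) (simp add: sum_distrib_left mult_single)
  then have "hom_part n d (Poly_Mapping.single b r * p) ys = (\<Sum>m\<in>Poly_Mapping.keys p.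
      if deg n b + deg n m = d then r * Poly_Mapping.lookup p m * (mval n ys b * mval n ys m) else 0)"
    by (simp add: hom_part_sum hom_part_single deg_add mval_add cong: if_cong)
  also have "\<dots> = (if deg n b \<le> d then r * mval n ys b * hom_part n (d - deg n b) p ys else 0)"
    unfolding hom_part_def by (auto simp: sum_distrib_left intro!: sum.cong)
  finally show ?thesis .
qed

section \<open>Functions on the points and their filtration by degree\<close>

lemma vector_space_fun: "vector_space (\<lambda>(c::rat) h x. c * h x)"
  by unfold_locales (auto simp: fun_eq_iff algebra_simps)

interpretation fv: vector_space "\<lambda>(c::rat) (h :: nat list \<Rightarrow> rat) x. c * h x"
  by (rule vector_space_fun)

definition points :: "nat \<Rightarrow> nat \<Rightarrow> nat list set" where
  "points k n = {xs \<in> words k n. k \<le> card (set xs)}"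

lemma points_iff: "ys \<in> points k n \<longleftrightarrow> length ys = n \<and> set ys = {..<k}"
proof
  assume ys: "ys \<in> points k n"
  then have sub: "set ys \<subseteq> {..<k}" by (auto simp: points_def words_def)
  moreover have "card {..<k} \<le> card (set ys)" using ys by (simp add: points_def)
  ultimately have "set ys = {..<k}" by (intro card_seteq) auto
  then show "length ys = n \<and> set ys = {..<k}" using ys by (simp add: points_def words_def)
qed (auto simp: points_def words_def)

text \<open>Extension by zero realises the functions on the points inside one vector space of total
  functions.\<close>

definition on_points :: "nat \<Rightarrow> nat \<Rightarrow> (nat list \<Rightarrow> rat) \<Rightarrow> nat list \<Rightarrow> rat" where
  "on_points k n h = (\<lambda>ys. if ys \<in> points k n then h ys else 0)"

abbreviation mfun :: "nat \<Rightarrow> nat \<Rightarrow> (nat \<Rightarrow>\<^sub>0 nat) \<Rightarrow> nat list \<Rightarrow> rat" where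
  "mfun k n m \<equiv> on_points k n (\<lambda>ys. mval n ys m)"

definition low_span :: "nat \<Rightarrow> nat \<Rightarrow> nat \<Rightarrow> (nat list \<Rightarrow> rat) set" where
  "low_span k n d = fv.span (mfun k n ` {m \<in> monomials n. deg n m < d})"

lemma sum_fun_apply: "(\<Sum>i\<in>A. F i) x = (\<Sum>i\<in>A. F i x)" for F :: "'i \<Rightarrow> 'b \<Rightarrow> 'c::comm_monoid_add"
  by (induction A rule: infinite_finite_induct) auto

lemma on_points_sum: "on_points k n (\<lambda>ys. \<Sum>i\<in>A. f i ys) = (\<Sum>i\<in>A. on_points k n (f i))"
  by (rule ext) (simp add: on_points_def sum_fun_apply)

lemma on_points_sum_mfun_in_span:
  assumes "\<And>i. i \<in> A \<Longrightarrow> m i \<in> B"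
  shows "on_points k n (\<lambda>ys. \<Sum>i\<in>A. c i * mval n ys (m i)) \<in> fv.span (mfun k n ` B)"
proof -
  have "on_points k n (\<lambda>ys. \<Sum>i\<in>A. c i * mval n ys (m i)) =
      (\<Sum>i\<in>A. on_points k n (\<lambda>ys. c i * mval n ys (m i)))" by (rule on_points_sum)
  also have "\<dots> = (\<Sum>i\<in>A. (\<lambda>ys. c i * mfun k n (m i) ys))"
    by (intro sum.cong) (auto simp: on_points_def fun_eq_iff)
  also have "\<dots> \<in> fv.span (mfun k n ` B)"
    by (intro fv.span_sum fv.span_scale fv.span_base imageI assms)
  finally show ?thesis .
qed

lemma low_span_mult:
  assumes "h \<in> low_span k n d" "b \<in> monomials n"
  shows "(\<lambda>ys. mval n ys b * h ys) \<in> low_span k n (d + deg n b)"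
  using assms(1) unfolding low_span_def
proof (induction rule: fv.span_induct_alt)
  case base
  have "(\<lambda>ys. mval n ys b * (0 :: nat list \<Rightarrow> rat) ys) = 0" by (simp add: fun_eq_iff)
  then show ?case using fv.span_zero by simp
next
  case (step c h g)
  then obtain m where m: "m \<in> monomials n" "deg n m < d" "h = mfun k n m" by auto
  have "(\<lambda>ys. mval n ys b * ((\<lambda>x. c * h x) + g) ys) =
      (\<lambda>ys. c * mfun k n (b + m) ys) + (\<lambda>ys. mval n ys b * g ys)"
    by (auto simp: fun_eq_iff m(3) on_points_def mval_add algebra_simps)
  also have "\<dots> \<in> fv.span (mfun k n ` {m \<in> monomials n. deg n m < d + deg n b})"
  proof (rule fv.span_add)
    show "(\<lambda>ys. c * mfun k n (b + m) ys) \<in> fv.span (mfun k n ` {m \<in> monomials n. deg n m < d + deg n b})"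
      using m assms(2) by (intro fv.span_scale fv.span_base imageI) (auto simp: monomials_add deg_add)
  qed (rule step)
  finally show ?case .
qed

text \<open>Polynomials each of whose homogeneous parts is, on the points, a combination of monomials of
  smaller degree; that is, the top components of polynomials vanishing on the points.\<close>

definition top_ideal :: "nat \<Rightarrow> nat \<Rightarrow> rpoly set" where
  "top_ideal n k = {p \<in> polys n. \<forall>d. on_points k n (hom_part n d p) \<in> low_span k n d}"

lemma top_ideal_add:
  assumes "p \<in> top_ideal n k" "q \<in> top_ideal n k"
  shows "p + q \<in> top_ideal n k"
proof -
  have "on_points k n (hom_part n d (p + q)) \<in> low_span k n d" for d
  proof -
    have "on_points k n (hom_part n d (p + q)) = on_points k n (hom_part n d p) + on_points k n (hom_part n d q)"
      by (auto simp: on_points_def fun_eq_iff hom_part_add)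
    then show ?thesis using assms by (simp add: top_ideal_def low_span_def fv.span_add)
  qed
  then show ?thesis using assms polys_add by (simp add: top_ideal_def)
qed

lemma top_ideal_0: "0 \<in> top_ideal n k"
proof -
  have "on_points k n (hom_part n d 0) = 0" for d by (auto simp: on_points_def fun_eq_iff)
  then show ?thesis by (simp add: top_ideal_def low_span_def fv.span_zero)
qed

lemma top_ideal_mult_single:
  assumes p: "p \<in> top_ideal n k" and b: "b \<in> monomials n"
  shows "Poly_Mapping.single b r * p \<in> top_ideal n k"
proof -
  have "on_points k n (hom_part n d (Poly_Mapping.single b r * p)) \<in> low_span k n d" for d
  proof (cases "deg n b \<le> d")
    case True
    let ?h = "on_points k n (hom_part n (d - deg n b) p)"
    have "on_points k n (hom_part n d (Poly_Mapping.single b r * p)) = (\<lambda>ys. r * (mval n ys b * ?h ys))"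
      using True by (auto simp: on_points_def fun_eq_iff hom_part_mult_single)
    moreover have "(\<lambda>ys. mval n ys b * ?h ys) \<in> low_span k n (d - deg n b + deg n b)"
      using p by (intro low_span_mult b) (simp add: top_ideal_def)
    then have "(\<lambda>ys. r * (mval n ys b * ?h ys)) \<in> low_span k n d"
      using True unfolding low_span_def by (intro fv.span_scale) simp
    ultimately show ?thesis by simp
  next
    case False
    then have "on_points k n (hom_part n d (Poly_Mapping.single b r * p)) = 0"
      by (auto simp: on_points_def fun_eq_iff hom_part_mult_single)
    then show ?thesis by (simp add: low_span_def fv.span_zero)
  qed
  moreover have "Poly_Mapping.single b r * p \<in> polys n"
    using p b by (intro polys_mult polys_single) (auto simp: top_ideal_def)
  ultimately show ?thesis by (simp add: top_ideal_def)
qed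

lemma top_ideal_mult:
  assumes p: "p \<in> top_ideal n k" and c: "c \<in> polys n"
  shows "c * p \<in> top_ideal n k"
proof -
  have sum: "sum f A \<in> top_ideal n k" if "\<And>i. i \<in> A \<Longrightarrow> f i \<in> top_ideal n k"
    for f :: "(nat \<Rightarrow>\<^sub>0 nat) \<Rightarrow> rpoly" and A
    using that by (induction A rule: infinite_finite_induct) (auto intro: top_ideal_0 top_ideal_add)
  have "c * p = (\<Sum>m\<in>Poly_Mapping.keys c. Poly_Mapping.single m (Poly_Mapping.lookup c m) * p)"
    unfolding sum_distrib_right[symmetric] poly_as_sum[of c, symmetric] ..
  also have "\<dots> \<in> top_ideal n k"
    by (intro sum top_ideal_mult_single p polys_keys[OF c])
  finally show ?thesis .
qed

text \<open>On the points the coordinate \<open>i\<close> is a root of the monic polynomial with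
  roots \<open>0\<close> to \<open>k - 1\<close>, which expresses its \<open>k\<close>-th power by
  lower ones.\<close>

lemma top_ideal_X_power:
  assumes i: "i \<in> {1..n}"
  shows "X i ^ k \<in> top_ideal n k"
proof -
  let ?q = "\<Prod>j<k. [:- of_nat j, 1:] :: rat poly"
  have deg_q: "degree ?q = k" by (simp add: degree_prod_eq_sum_degree)
  have "lead_coeff ?q = 1" by (simp add: lead_coeff_prod)
  then have lead: "coeff ?q k = 1" by (simp add: deg_q)
  have root: "(of_nat (ys ! (i - 1)) :: rat) ^ k = (\<Sum>t<k. - coeff ?q t * of_nat (ys ! (i - 1)) ^ t)"
    if ys: "ys \<in> points k n" for ys
  proof -
    let ?y = "of_nat (ys ! (i - 1)) :: rat"
    have len: "length ys = n" and set: "set ys = {..<k}" using ys unfolding points_iff by blast+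
    have "i - 1 < length ys" using i len unfolding atLeastAtMost_iff by linarith
    then have "ys ! (i - 1) \<in> {..<k}" using nth_mem[of "i - 1" ys] unfolding set by blast
    moreover have "poly [:- of_nat (ys ! (i - 1)), 1:] ?y = 0" by simp
    ultimately have "poly ?q ?y = 0" unfolding poly_prod by (intro prod_zero) blast+
    then have "(\<Sum>t\<le>k. coeff ?q t * ?y ^ t) = 0" by (simp add: poly_altdef deg_q)
    then have "(\<Sum>t<k. coeff ?q t * ?y ^ t) + ?y ^ k = 0"
      by (simp add: lessThan_Suc_atMost[symmetric] lead)
    then show ?thesis by (simp add: sum_negf eq_neg_iff_add_eq_0 add.commute)
  qed
  have "on_points k n (hom_part n d (X i ^ k)) \<in> low_span k n d" for d
  proof (cases "d = k")
    case True
    have "on_points k n (hom_part n d (X i ^ k)) =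
        on_points k n (\<lambda>ys. \<Sum>t<k. - coeff ?q t * mval n ys (Poly_Mapping.single i t))"
    proof
      fix ys
      show "on_points k n (hom_part n d (X i ^ k)) ys =
          on_points k n (\<lambda>ys. \<Sum>t<k. - coeff ?q t * mval n ys (Poly_Mapping.single i t)) ys"
        unfolding on_points_def X_power hom_part_single deg_single[OF i] mval_single[OF i] True
        by (cases "ys \<in> points k n") (simp_all only: root if_True if_False mult_1_left simp_thms)
    qed
    also have "\<dots> \<in> low_span k n d"
      unfolding low_span_def
      by (rule on_points_sum_mfun_in_span) (use i True in \<open>auto simp: monomials_single deg_single\<close>)
    finally show ?thesis .
  next
    case False
    then have "on_points k n (hom_part n d (X i ^ k)) = 0"
      using i by (auto simp: on_points_def fun_eq_iff X_power hom_part_single deg_single)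
    then show ?thesis by (simp add: low_span_def fv.span_zero)
  qed
  then show ?thesis using i by (simp add: top_ideal_def polys_power polys_X)
qed

text \<open>All values \<open>0\<close> to \<open>k - 1\<close> occur at a point, so the product of
  the \<open>1 - y i * fps_X\<close> is divisible by \<open>Q\<close> and the quotient has degree at
  most \<open>n - k\<close>. Its coefficient at \<open>d\<close> vanishes. Since \<open>Q\<close> is
  the same for every point, so are the coefficients \<open>w\<close>.\<close>

lemma elem_sym_points_relation:
  assumes "k \<le> n" "n - k < d"
  shows "\<exists>w :: nat \<Rightarrow> rat. \<forall>ys\<in>points k n.
    (\<Sum>A | A \<subseteq> {1..n} \<and> card A = d. \<Prod>i\<in>A. of_nat (ys ! (i - 1))) =
    (\<Sum>e<d. w e * (\<Sum>A | A \<subseteq> {1..n} \<and> card A = e. \<Prod>i\<in>A. of_nat (ys ! (i - 1))))"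
proof -
  let ?c = "\<lambda>a :: rat. 1 - fps_const a * fps_X"
  define Q where "Q = (\<Prod>j<k. ?c (of_nat j))"
  define R where "R = inverse Q"
  have "fps_nth Q 0 = 1"
    unfolding Q_def by (induction k) simp_all
  then have RQ: "R * Q = 1" unfolding R_def by (intro inverse_mult_eq_1) simp
  have R0: "fps_nth R 0 = 1" using \<open>fps_nth Q 0 = 1\<close> by (simp add: R_def)
  define w where "w e = - ((-1) ^ d * (fps_nth R (d - e) * (-1) ^ e))" for e
  have "(\<Sum>A | A \<subseteq> {1..n} \<and> card A = d. \<Prod>i\<in>A. of_nat (ys ! (i - 1))) =
      (\<Sum>e<d. w e * (\<Sum>A | A \<subseteq> {1..n} \<and> card A = e. \<Prod>i\<in>A. of_nat (ys ! (i - 1))))"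
    if ys: "ys \<in> points k n" for ys
  proof -
    let ?y = "\<lambda>i. of_nat (ys ! (i - 1)) :: rat"
    let ?e = "\<lambda>d. \<Sum>A | A \<subseteq> {1..n} \<and> card A = d. \<Prod>i\<in>A. ?y i"
    have "(\<lambda>i. ys ! (i - 1)) ` {1..n} = {..<k}"
    proof -
      have "(\<lambda>i. ys ! (i - 1)) ` {1..n} = (\<lambda>i. ys ! i) ` {..<n}"
        unfolding image_Suc_lessThan[symmetric] image_image by simp
      also have "\<dots> = set ys" using ys by (auto simp: set_conv_nth points_iff)
      finally show ?thesis using ys by (simp add: points_iff)
    qed
    \<comment> \<open>A set of \<open>k\<close> coordinates on which each value occurs exactly once;
      its factors multiply to \<open>Q\<close>.\<close>
    then obtain A where A: "A \<subseteq> {1..n}" "inj_on (\<lambda>i. ys ! (i - 1)) A" "(\<lambda>i. ys ! (i - 1)) ` A = {..<k}"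
      by (metis subset_image_inj subset_refl)
    have "card A = k" using card_image[OF A(2)] A(3) by simp
    have finA: "finite A" using A(1) finite_subset by blast
    have prodA: "(\<Prod>i\<in>A. ?c (?y i)) = Q"
      unfolding Q_def A(3)[symmetric] prod.reindex[OF A(2)] o_def ..
    have "(\<Prod>i\<in>{1..n}. ?c (?y i)) = (\<Prod>i\<in>{1..n} - A. ?c (?y i)) * Q"
      unfolding prodA[symmetric] by (rule prod.subset_diff[OF A(1)]) simp
    then have "R * (\<Prod>i\<in>{1..n}. ?c (?y i)) = (\<Prod>i\<in>{1..n} - A. ?c (?y i)) * (R * Q)"
      by (simp only: mult.assoc mult.left_commute[of R])
    then have RE: "R * (\<Prod>i\<in>{1..n}. ?c (?y i)) = (\<Prod>i\<in>{1..n} - A. ?c (?y i))"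
      by (simp only: RQ mult_1_right)
    have none: "{B. B \<subseteq> {1..n} - A \<and> card B = d} = {}"
    proof -
      have "card B \<noteq> d" if "B \<subseteq> {1..n} - A" for B
      proof -
        have "card B \<le> card ({1..n} - A)" using that by (intro card_mono) auto
        also have "\<dots> = n - k" using A(1) finA \<open>card A = k\<close> by (simp add: card_Diff_subset)
        finally show ?thesis using assms by simp
      qed
      then show ?thesis by blast
    qed
    have finD: "finite ({1..n} - A)" by simp
    have "fps_nth (R * (\<Prod>i\<in>{1..n}. ?c (?y i))) d = 0"
      unfolding RE prod_one_minus_nth[OF finD] none by (simp only: sum.empty mult_zero_right)
    then have "(\<Sum>j=0..d. fps_nth (\<Prod>i\<in>{1..n}. ?c (?y i)) j * fps_nth R (d - j)) = 0"
      unfolding mult.commute[of R] fps_mult_nth .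
    then have "(\<Sum>j=0..d. (-1) ^ j * ?e j * fps_nth R (d - j)) = 0"
      unfolding prod_one_minus_nth[OF finite_atLeastAtMost] .
    moreover have "{0..d} = insert d {..<d}" by auto
    ultimately have "(-1) ^ d * ?e d + (\<Sum>j<d. (-1) ^ j * ?e j * fps_nth R (d - j)) = 0"
      by (simp add: R0)
    then have "(-1) ^ d * ?e d = - (\<Sum>j<d. (-1) ^ j * ?e j * fps_nth R (d - j))"
      by (simp only: eq_neg_iff_add_eq_0)
    then have "(-1) ^ d * ((-1) ^ d * ?e d) = (-1) ^ d * (- (\<Sum>j<d. (-1) ^ j * ?e j * fps_nth R (d - j)))"
      by (simp only:)
    then have "?e d = (-1) ^ d * (- (\<Sum>j<d. (-1) ^ j * ?e j * fps_nth R (d - j)))"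
      by (simp flip: mult.assoc power_add)
    also have "\<dots> = (\<Sum>e<d. w e * ?e e)"
      by (simp add: w_def sum_distrib_left sum_negf mult_ac)
    finally show ?thesis .
  qed
  then show ?thesis by (intro exI[of _ w] ballI)
qed

lemma top_ideal_elem_sym:
  assumes "k \<le> n" "d0 \<in> {n - k + 1..n}"
  shows "elem_sym n d0 \<in> top_ideal n k"
proof -
  let ?S = "\<lambda>e. {A. A \<subseteq> {1..n} \<and> card A = e}"
  \<comment> \<open>The squarefree exponent vector of \<open>A\<close>. The dummy first component
    turns indices into cells, so that \<open>fill_wt\<close> can be reused.\<close>
  define x where "x A = fill_wt (Pair 0 ` A) snd" for A :: "nat set"
  have elem: "elem_sym n e = (\<Sum>A\<in>?S e. Poly_Mapping.single (x A) 1)" for e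
  proof -
    have "(\<Prod>i\<in>A. X i) = Poly_Mapping.single (x A) 1" for A
    proof -
      have "(\<Prod>i\<in>A. X i) = (\<Prod>c\<in>Pair (0::nat) ` A. X (snd c))"
        by (subst prod.reindex) (auto simp: inj_on_def)
      then show ?thesis unfolding x_def prod_X .
    qed
    then show ?thesis by (simp add: elem_sym_def)
  qed
  have look: "Poly_Mapping.lookup (x A) i = (if i \<in> A then 1 else 0)" if "A \<subseteq> {1..n}" for A i
  proof -
    have "finite A" using that finite_subset by blast
    moreover have "{c \<in> Pair (0::nat) ` A. snd c = i} = (if i \<in> A then {(0, i)} else {})" by auto
    ultimately show ?thesis by (simp add: x_def lookup_fill_wt)
  qed
  have mem: "x A \<in> monomials n" if "A \<subseteq> {1..n}" for A
    using that look[OF that] by (auto simp: monomials_def in_keys_iff split: if_splits)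
  have degx: "deg n (x A) = card A" if "A \<subseteq> {1..n}" for A
    using that by (simp add: deg_def look[OF that] sum.If_cases Int_absorb1)
  have val: "mval n ys (x A) = (\<Prod>i\<in>A. of_nat (ys ! (i - 1)))" if "A \<subseteq> {1..n}" for A ys
  proof -
    have "mval n ys (x A) = (\<Prod>i\<in>{1..n}. if i \<in> A then of_nat (ys ! (i - 1)) else 1)"
      unfolding mval_def look[OF that] by (intro prod.cong) auto
    then show ?thesis using that by (simp add: prod.If_cases Int_absorb1)
  qed
  have nk: "n - k < d0" using assms(2) by simp
  obtain w where w: "\<forall>ys\<in>points k n.
    (\<Sum>A\<in>?S d0. \<Prod>i\<in>A. rat_of_nat (ys ! (i - 1))) =
    (\<Sum>e<d0. w e * (\<Sum>A\<in>?S e. \<Prod>i\<in>A. rat_of_nat (ys ! (i - 1))))"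
    using elem_sym_points_relation[OF assms(1) nk] by (rule exE)
  have part: "hom_part n d (elem_sym n d0) ys = (if d = d0 then \<Sum>A\<in>?S d0. mval n ys (x A) else 0)" for d ys
    unfolding elem hom_part_sum hom_part_single by (auto simp: degx intro!: sum.cong sum.neutral)
  have "on_points k n (hom_part n d (elem_sym n d0)) \<in> low_span k n d" for d
  proof (cases "d = d0")
    case True
    have "on_points k n (hom_part n d (elem_sym n d0)) =
        on_points k n (\<lambda>ys. \<Sum>(e, A)\<in>(SIGMA e:{..<d0}. ?S e). w e * mval n ys (x A))"
    proof
      fix ys
      have "(\<Sum>A\<in>?S d0. mval n ys (x A)) = (\<Sum>(e, A)\<in>(SIGMA e:{..<d0}. ?S e). w e * mval n ys (x A))"
        if ys: "ys \<in> points k n"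
      proof -
        have "(\<Sum>A\<in>?S e. mval n ys (x A)) = (\<Sum>A\<in>?S e. \<Prod>i\<in>A. rat_of_nat (ys ! (i - 1)))" for e
          by (intro sum.cong refl val) auto
        then have "(\<Sum>A\<in>?S d0. mval n ys (x A)) = (\<Sum>e<d0. w e * (\<Sum>A\<in>?S e. mval n ys (x A)))"
          using bspec[OF w ys] by simp
        then show ?thesis by (simp add: sum_distrib_left sum.Sigma)
      qed
      then show "on_points k n (hom_part n d (elem_sym n d0)) ys =
          on_points k n (\<lambda>ys. \<Sum>(e, A)\<in>(SIGMA e:{..<d0}. ?S e). w e * mval n ys (x A)) ys"
        by (simp add: on_points_def part True)
    qed
    also have "\<dots> = on_points k n (\<lambda>ys. \<Sum>c\<in>(SIGMA e:{..<d0}. ?S e). w (fst c) * mval n ys (x (snd c)))"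
      by (simp add: case_prod_unfold)
    also have "\<dots> \<in> low_span k n d"
      unfolding low_span_def
      by (rule on_points_sum_mfun_in_span) (use mem degx True in auto)
    finally show ?thesis .
  next
    case False
    then have "on_points k n (hom_part n d (elem_sym n d0)) = 0"
      by (auto simp: on_points_def fun_eq_iff part)
    then show ?thesis by (simp add: low_span_def fv.span_zero)
  qed
  then show ?thesis by (simp add: top_ideal_def polys_elem_sym)
qed

lemma I_ideal_subset_top_ideal: "k \<le> n \<Longrightarrow> I_ideal n k \<subseteq> top_ideal n k"
  unfolding I_ideal_def
proof (rule genideal_subsetI)
  assume "k \<le> n"
  then show "{X i ^ k | i. i \<in> {1..n}} \<union> {elem_sym n d | d. d \<in> {n - k + 1..n}} \<subseteq> top_ideal n k"
    using top_ideal_X_power top_ideal_elem_sym by blast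
  show "top_ideal n k \<subseteq> polys n" by (auto simp: top_ideal_def)
qed (use top_ideal_0 top_ideal_add top_ideal_mult in auto)

section \<open>Leading exponents and spanning by non-leading monomials\<close>

definition lead_exps :: "nat \<Rightarrow> nat \<Rightarrow> (nat \<Rightarrow>\<^sub>0 nat) set" where
  "lead_exps n k = lead_exp ` (I_ideal n k - {0})"

lemma lead_exp_in_keys: "p \<noteq> 0 \<Longrightarrow> lead_exp p \<in> Poly_Mapping.keys p"
  unfolding lead_exp_def by (rule Max_in) simp_all

lemma lead_exp_ge: "m \<in> Poly_Mapping.keys p \<Longrightarrow> m \<le> lead_exp p"
  unfolding lead_exp_def by (rule Max_ge) simp_all

lemma lead_exp_single_mult:
  assumes "p \<noteq> 0"
  shows "Poly_Mapping.single c (1::rat) * p \<noteq> 0" "lead_exp (Poly_Mapping.single c 1 * p) = c + lead_exp p"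
proof -
  have look: "Poly_Mapping.lookup (Poly_Mapping.single c 1 * p) (c + m) = Poly_Mapping.lookup p m" for m
  proof -
    have "Poly_Mapping.single c 1 * p =
        (\<Sum>a\<in>Poly_Mapping.keys p. Poly_Mapping.single (c + a) (Poly_Mapping.lookup p a))"
      by (subst poly_as_sum[of p]) (simp add: sum_distrib_left mult_single)
    then have "Poly_Mapping.lookup (Poly_Mapping.single c 1 * p) (c + m) =
        (\<Sum>a\<in>Poly_Mapping.keys p. if a = m then Poly_Mapping.lookup p m else 0)"
      by (auto simp: lookup_sum lookup_single when_def intro!: sum.cong)
    then show ?thesis by (simp add: in_keys_iff)
  qed
  have key: "c + lead_exp p \<in> Poly_Mapping.keys (Poly_Mapping.single c 1 * p)"
    using lead_exp_in_keys[OF assms] by (simp add: in_keys_iff look)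
  then show "Poly_Mapping.single c (1::rat) * p \<noteq> 0" by auto
  have "m \<le> c + lead_exp p" if m: "m \<in> Poly_Mapping.keys (Poly_Mapping.single c 1 * p)" for m
  proof -
    obtain a where "m = c + a" "a \<in> Poly_Mapping.keys p"
      using m keys_mult[of "Poly_Mapping.single c 1" p] by auto
    then show ?thesis using lead_exp_ge by (simp add: add_left_mono)
  qed
  then show "lead_exp (Poly_Mapping.single c 1 * p) = c + lead_exp p"
    unfolding lead_exp_def[of "Poly_Mapping.single c 1 * p"] using key by (intro Max_eqI) auto
qed

lemma I_ideal_polys: "I_ideal n k \<subseteq> polys n"
  unfolding I_ideal_def
  by (rule genideal_subsetI) (use I_ideal_gens polys_add polys_mult in auto)

lemma lead_exps_up:
  assumes "a \<in> lead_exps n k" "c \<in> monomials n"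
  shows "c + a \<in> lead_exps n k"
proof -
  obtain p where p: "p \<in> I_ideal n k" "p \<noteq> 0" "a = lead_exp p" using assms(1) by (auto simp: lead_exps_def)
  have "Poly_Mapping.single c 1 * p \<in> I_ideal n k"
    unfolding I_ideal_def
    by (rule genideal_zero_add_mult(3)[OF I_ideal_gens]) (use p assms(2) polys_single in \<open>auto simp: I_ideal_def\<close>)
  then show ?thesis
    using lead_exp_single_mult[OF p(2), of c] p(3) unfolding lead_exps_def
    by (intro image_eqI[of _ _ "Poly_Mapping.single c 1 * p"]) auto
qed

text \<open>Degree comes first because reduction on the points produces monomials of smaller degree
  that may be lexicographically larger; within one degree the lexicographic order decides.\<close>

definition grlex_less :: "nat \<Rightarrow> (nat \<Rightarrow>\<^sub>0 nat) \<Rightarrow> (nat \<Rightarrow>\<^sub>0 nat) \<Rightarrow> bool" where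
  "grlex_less n b a \<longleftrightarrow> deg n b < deg n a \<or> deg n b = deg n a \<and> b < a"

text \<open>Only the homogeneous part in the degree of \<open>a\<close> is used. On the points it
  equals a combination of monomials of lower degree, and its monomials other than \<open>a\<close>
  are lexicographically smaller, so the equation can be solved for \<open>a\<close>.\<close>

lemma mfun_lead_exp_in_span:
  assumes "k \<le> n" "a \<in> lead_exps n k"
  shows "mfun k n a \<in> fv.span (mfun k n ` {b \<in> monomials n. grlex_less n b a})"
proof -
  obtain p where p: "p \<in> I_ideal n k" "p \<noteq> 0" "a = lead_exp p" using assms(2) by (auto simp: lead_exps_def)
  let ?V = "fv.span (mfun k n ` {b \<in> monomials n. grlex_less n b a})"
  let ?d = "deg n a" and ?c = "Poly_Mapping.lookup p"
  let ?M = "{m \<in> Poly_Mapping.keys p. deg n m = ?d}"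
  have key: "a \<in> Poly_Mapping.keys p" using lead_exp_in_keys[OF p(2)] p(3) by simp
  have "p \<in> top_ideal n k" using I_ideal_subset_top_ideal[OF assms(1)] p(1) by blast
  then have "on_points k n (hom_part n ?d p) \<in> low_span k n ?d" by (simp add: top_ideal_def)
  moreover have "low_span k n ?d \<subseteq> ?V"
    unfolding low_span_def by (intro fv.span_mono image_mono) (auto simp: grlex_less_def)
  ultimately have 1: "on_points k n (hom_part n ?d p) \<in> ?V" by blast
  have 2: "on_points k n (\<lambda>ys. \<Sum>m\<in>?M - {a}. ?c m * mval n ys m) \<in> ?V"
  proof (rule on_points_sum_mfun_in_span)
    fix m assume m: "m \<in> ?M - {a}"
    then have "m \<le> a" using lead_exp_ge[of m p] p(3) by simp
    then show "m \<in> {b \<in> monomials n. grlex_less n b a}"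
      using m polys_keys[of p n m] p(1) I_ideal_polys by (auto simp: grlex_less_def)
  qed
  have "hom_part n ?d p ys = ?c a * mval n ys a + (\<Sum>m\<in>?M - {a}. ?c m * mval n ys m)" for ys
  proof -
    have "hom_part n ?d p ys = (\<Sum>m\<in>?M. ?c m * mval n ys m)"
      unfolding hom_part_def by (rule sum.inter_filter[symmetric]) simp
    also have "\<dots> = ?c a * mval n ys a + (\<Sum>m\<in>?M - {a}. ?c m * mval n ys m)"
      by (rule sum.remove) (use key in auto)
    finally show ?thesis .
  qed
  then have "(\<lambda>ys. ?c a * mfun k n a ys) =
      on_points k n (hom_part n ?d p) - on_points k n (\<lambda>ys. \<Sum>m\<in>?M - {a}. ?c m * mval n ys m)"
    by (auto simp: on_points_def fun_eq_iff)
  then have "(\<lambda>ys. ?c a * mfun k n a ys) \<in> ?V" using fv.span_diff[OF 1 2] by simp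
  then have "(\<lambda>ys. inverse (?c a) * (?c a * mfun k n a ys)) \<in> ?V" by (rule fv.span_scale)
  moreover have "(\<lambda>ys. inverse (?c a) * (?c a * mfun k n a ys)) = mfun k n a"
    using key by (simp add: in_keys_iff)
  ultimately show ?thesis by simp
qed

lemma finite_monomials_bounded: "finite {m \<in> monomials n. \<forall>i. Poly_Mapping.lookup m i \<le> d}"
proof (rule finite_imageD)
  let ?A = "{m \<in> monomials n. \<forall>i. Poly_Mapping.lookup m i \<le> d}"
  have "Poly_Mapping.lookup ` ?A \<subseteq> {f. \<forall>i. (i \<in> {1..n} \<longrightarrow> f i \<in> {..d}) \<and> (i \<notin> {1..n} \<longrightarrow> f i = 0)}"
    by (auto simp: monomials_def in_keys_iff subset_iff)
  then show "finite (Poly_Mapping.lookup ` ?A)"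
    by (rule finite_subset) (intro finite_set_of_finite_funs, auto)
  show "inj_on Poly_Mapping.lookup ?A" by (intro inj_onI poly_mapping_eqI) (rule fun_cong)
qed

lemma finite_monomials_deg: "finite {m \<in> monomials n. deg n m = d}"
proof (rule finite_subset[OF _ finite_monomials_bounded])
  show "{m \<in> monomials n. deg n m = d} \<subseteq> {m \<in> monomials n. \<forall>i. Poly_Mapping.lookup m i \<le> d}"
  proof (safe)
    fix m i assume m: "m \<in> monomials n" "d = deg n m"
    show "Poly_Mapping.lookup m i \<le> deg n m"
    proof (cases "i \<in> {1..n}")
      case True
      then show ?thesis unfolding deg_def by (intro member_le_sum) auto
    next
      case False
      then have "Poly_Mapping.lookup m i = 0" using m by (auto simp: monomials_def in_keys_iff subset_iff)
      then show ?thesis by simp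
    qed
  qed
qed

lemma wf_grlex: "wf {(b, a). a \<in> monomials n \<and> b \<in> monomials n \<and> grlex_less n b a}"
proof (rule wf_subset)
  let ?f = "\<lambda>a. (deg n a, card {b \<in> monomials n. deg n b = deg n a \<and> b < a})"
  show "wf (inv_image (less_than <*lex*> less_than) ?f)" by auto
  show "{(b, a). a \<in> monomials n \<and> b \<in> monomials n \<and> grlex_less n b a} \<subseteq>
      inv_image (less_than <*lex*> less_than) ?f"
  proof (safe)
    fix b a assume ba: "a \<in> monomials n" "b \<in> monomials n" "grlex_less n b a"
    have "card {c \<in> monomials n. deg n c = deg n b \<and> c < b} < card {c \<in> monomials n. deg n c = deg n a \<and> c < a}"
      if eq: "deg n b = deg n a" "b < a"
    proof (rule psubset_card_mono)
      show "finite {c \<in> monomials n. deg n c = deg n a \<and> c < a}"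
        by (rule finite_subset[OF _ finite_monomials_deg[of n "deg n a"]]) auto
      have "b \<in> {c \<in> monomials n. deg n c = deg n a \<and> c < a}" using ba eq by simp
      moreover have "b \<notin> {c \<in> monomials n. deg n c = deg n b \<and> c < b}" by simp
      moreover have "{c \<in> monomials n. deg n c = deg n b \<and> c < b} \<subseteq> {c \<in> monomials n. deg n c = deg n a \<and> c < a}"
        using eq by auto
      ultimately show "{c \<in> monomials n. deg n c = deg n b \<and> c < b} \<subset> {c \<in> monomials n. deg n c = deg n a \<and> c < a}"
        by blast
    qed
    then show "(b, a) \<in> inv_image (less_than <*lex*> less_than) ?f"
      using ba(3) by (auto simp: grlex_less_def)
  qed
qed

lemma mfun_in_standard_span:
  assumes k: "k \<le> n"
  shows "a \<in> monomials n \<Longrightarrow> mfun k n a \<in> fv.span (mfun k n ` (monomials n - lead_exps n k))"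
proof (induction a rule: wf_induct_rule[OF wf_grlex[of n]])
  case (1 a)
  let ?V = "fv.span (mfun k n ` (monomials n - lead_exps n k))"
  show ?case
  proof (cases "a \<in> lead_exps n k")
    case True
    have "mfun k n ` {b \<in> monomials n. grlex_less n b a} \<subseteq> ?V" using 1 by auto
    then have "fv.span (mfun k n ` {b \<in> monomials n. grlex_less n b a}) \<subseteq> ?V"
      by (intro fv.span_minimal) auto
    then show ?thesis using mfun_lead_exp_in_span[OF k True] by blast
  next
    case False
    then show ?thesis using 1(2) by (intro fv.span_base) auto
  qed
qed

section \<open>Interpolation and the dimension bound\<close>

definition delta :: "nat \<Rightarrow> nat \<Rightarrow> nat list \<Rightarrow> nat list \<Rightarrow> rat" where
  "delta k n ys zs = (if zs = ys then 1 else 0)"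

lemma coordinate_mult_span:
  assumes h: "h \<in> fv.span (mfun k n ` monomials n)" and i: "i \<in> {1..n}"
  shows "(\<lambda>ys. (of_nat (ys ! (i - 1)) - c) * h ys) \<in> fv.span (mfun k n ` monomials n)"
proof -
  have "(\<lambda>ys. of_nat (ys ! (i - 1)) * h ys) \<in> fv.span (mfun k n ` monomials n)"
    using h
  proof (induction rule: fv.span_induct_alt)
    case base
    have "(\<lambda>ys. of_nat (ys ! (i - 1)) * (0 :: nat list \<Rightarrow> rat) ys) = 0" by (simp add: fun_eq_iff)
    then show ?case using fv.span_zero by simp
  next
    case (step e h g)
    then obtain m where m: "m \<in> monomials n" "h = mfun k n m" by auto
    have "(\<lambda>ys. of_nat (ys ! (i - 1)) * ((\<lambda>x. e * h x) + g) ys) =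
        (\<lambda>ys. e * mfun k n (Poly_Mapping.single i 1 + m) ys) + (\<lambda>ys. of_nat (ys ! (i - 1)) * g ys)"
      using i by (auto simp: fun_eq_iff m(2) on_points_def mval_add mval_single algebra_simps)
    also have "\<dots> \<in> fv.span (mfun k n ` monomials n)"
    proof (rule fv.span_add)
      show "(\<lambda>ys. e * mfun k n (Poly_Mapping.single i 1 + m) ys) \<in> fv.span (mfun k n ` monomials n)"
        using m i by (intro fv.span_scale fv.span_base imageI monomials_add monomials_single) auto
    qed (rule step)
    finally show ?case .
  qed
  moreover have "(\<lambda>ys. c * h ys) \<in> fv.span (mfun k n ` monomials n)" using h by (rule fv.span_scale)
  ultimately have "(\<lambda>ys. of_nat (ys ! (i - 1)) * h ys) - (\<lambda>ys. c * h ys) \<in> fv.span (mfun k n ` monomials n)"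
    by (rule fv.span_diff)
  moreover have "(\<lambda>ys. of_nat (ys ! (i - 1)) * h ys) - (\<lambda>ys. c * h ys) = (\<lambda>ys. (of_nat (ys ! (i - 1)) - c) * h ys)"
    by (auto simp: fun_eq_iff algebra_simps)
  ultimately show ?thesis by simp
qed

lemma delta_in_span:
  assumes ys: "ys \<in> points k n"
  shows "delta k n ys \<in> fv.span (mfun k n ` monomials n)"
proof -
  let ?V = "fv.span (mfun k n ` monomials n)"
  let ?f = "\<lambda>(zs :: nat list) (i, c). (of_nat (zs ! (i - 1)) - of_nat c :: rat)"
  \<comment> \<open>Lagrange interpolation: one linear factor for each coordinate and each value
    other than the one taken at \<open>ys\<close>.\<close>
  define Q where "Q = (SIGMA i:{1..n}. {..<k} - {ys ! (i - 1)})"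
  have prod_in: "(\<lambda>zs. (\<Prod>q\<in>B. ?f zs q) * mfun k n 0 zs) \<in> ?V" if "finite B" "B \<subseteq> Q" for B
    using that
  proof (induction B rule: finite_induct)
    case empty
    have "mfun k n 0 \<in> ?V" by (intro fv.span_base imageI) (simp add: monomials_def)
    then show ?case by simp
  next
    case (insert q B)
    obtain i c where q: "q = (i, c)" by (cases q)
    have "i \<in> {1..n}" using insert.prems by (auto simp: Q_def q)
    then have "(\<lambda>zs. (of_nat (zs ! (i - 1)) - of_nat c) * ((\<Prod>q\<in>B. ?f zs q) * mfun k n 0 zs)) \<in> ?V"
      using insert by (intro coordinate_mult_span) auto
    then show ?case using insert.hyps by (simp add: q mult.assoc)
  qed
  have finQ: "finite Q" by (simp add: Q_def)
  let ?C = "\<Prod>q\<in>Q. ?f ys q"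
  have "?f ys q \<noteq> 0" if "q \<in> Q" for q using that by (auto simp: Q_def)
  then have C: "?C \<noteq> 0" using finQ by simp
  have zero: "(\<Prod>q\<in>Q. ?f zs q) = 0" if zs: "zs \<in> points k n" "zs \<noteq> ys" for zs
  proof -
    have len: "length zs = n" "length ys = n" "set zs = {..<k}" using zs ys by (auto simp: points_iff)
    then obtain j where j: "j < n" "zs ! j \<noteq> ys ! j" using zs(2) nth_equalityI[of zs ys] by auto
    have "zs ! j \<in> {..<k}" using nth_mem[of j zs] j len by auto
    then have "(Suc j, zs ! j) \<in> Q" using j by (auto simp: Q_def)
    moreover have "?f zs (Suc j, zs ! j) = 0" by simp
    ultimately show ?thesis using finQ by (intro prod_zero) blast+
  qed
  have "delta k n ys = (\<lambda>zs. inverse ?C * ((\<Prod>q\<in>Q. ?f zs q) * mfun k n 0 zs))"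
  proof
    fix zs
    show "delta k n ys zs = inverse ?C * ((\<Prod>q\<in>Q. ?f zs q) * mfun k n 0 zs)"
    proof (cases "zs = ys")
      case True
      then show ?thesis using ys C by (simp add: delta_def on_points_def)
    next
      case False
      show ?thesis
      proof (cases "zs \<in> points k n")
        case True
        then show ?thesis using zero[OF True False] False by (simp add: delta_def)
      next
        case out: False
        then show ?thesis using False by (simp add: delta_def on_points_def)
      qed
    qed
  qed
  also have "\<dots> \<in> ?V" by (intro fv.span_scale prod_in finQ) auto
  finally show ?thesis .
qed

lemma card_points_le:
  assumes "finite B" "B \<subseteq> monomials n" "mfun k n ` monomials n \<subseteq> fv.span (mfun k n ` B)"
  shows "card (points k n) \<le> card B"
proof -
  have finP: "finite (points k n)" unfolding points_def using finite_words by simp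
  have inj: "inj (delta k n)"
    by (rule injI) (metis delta_def zero_neq_one)
  have "fv.independent (delta k n ` points k n)"
  proof (rule fv.independent_if_scalars_zero)
    show "finite (delta k n ` points k n)" using finP by simp
    fix f h assume sum: "(\<Sum>h\<in>delta k n ` points k n. (\<lambda>x. f h * h x)) = 0" and "h \<in> delta k n ` points k n"
    then obtain ys where ys: "ys \<in> points k n" "h = delta k n ys" by blast
    have "(\<Sum>h\<in>delta k n ` points k n. (\<lambda>x. f h * h x)) = (\<Sum>zs\<in>points k n. (\<lambda>x. f (delta k n zs) * delta k n zs x))"
      using inj by (subst sum.reindex) (auto simp: inj_on_def dest: injD)
    then have "0 = (\<Sum>zs\<in>points k n. (\<lambda>x. f (delta k n zs) * delta k n zs x)) ys" using sum by simp
    also have "\<dots> = (\<Sum>zs\<in>points k n. if zs = ys then f (delta k n ys) else 0)"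
      unfolding sum_fun_apply by (intro sum.cong) (auto simp: delta_def)
    also have "\<dots> = f (delta k n ys)" using finP ys by simp
    finally show "f h = 0" using ys by simp
  qed
  moreover have "delta k n ` points k n \<subseteq> fv.span (mfun k n ` B)"
  proof -
    have "fv.span (mfun k n ` monomials n) \<subseteq> fv.span (mfun k n ` B)"
      using assms(3) by (intro fv.span_minimal) auto
    then show ?thesis using delta_in_span by blast
  qed
  ultimately have "card (delta k n ` points k n) \<le> card (mfun k n ` B)"
    using fv.independent_span_bound[of "mfun k n ` B"] assms(1) by blast
  also have "\<dots> \<le> card B" using assms(1) by (rule card_image_le)
  also have "card (delta k n ` points k n) = card (points k n)"
    using inj by (intro card_image) (auto intro: inj_on_subset)
  finally show ?thesis .
qed

section \<open>Comparison of leading exponents with the proposed basis\<close>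

lemma monomial_diff:
  fixes a b :: "nat \<Rightarrow>\<^sub>0 nat"
  assumes "a \<in> monomials n" "\<And>i. Poly_Mapping.lookup b i \<le> Poly_Mapping.lookup a i"
  shows "\<exists>c\<in>monomials n. a = c + b"
proof (rule bexI[of _ "a - b"])
  show "a = a - b + b"
    using assms(2) by (intro poly_mapping_eqI) (simp add: lookup_add lookup_minus)
  show "a - b \<in> monomials n"
    using assms(1) by (auto simp: monomials_def in_keys_iff lookup_minus)
qed

lemma X_power_lead:
  "X i ^ k \<noteq> 0" "lead_exp (X i ^ k) = Poly_Mapping.single i k" "lead_coef (X i ^ k) = 1"
proof -
  have keys: "Poly_Mapping.keys (X i ^ k) = {Poly_Mapping.single i k}" by (simp add: X_power)
  show "X i ^ k \<noteq> 0"
  proof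
    assume "X i ^ k = 0"
    then have "Poly_Mapping.keys (X i ^ k) = {}" by (simp only: keys_zero)
    then show False unfolding keys by blast
  qed
  show lead: "lead_exp (X i ^ k) = Poly_Mapping.single i k" by (simp add: lead_exp_def keys)
  show "lead_coef (X i ^ k) = 1" unfolding lead_coef_def lead by (simp add: X_power)
qed

lemma X_power_in_I_ideal: "i \<in> {1..n} \<Longrightarrow> X i ^ k \<in> I_ideal n k"
  unfolding I_ideal_def by (rule subsetD[OF genideal_superset[OF I_ideal_gens]]) blast

text \<open>Sets with \<open>n \<in> S\<close> exclude no additional monomials: their part at
  \<open>n\<close> is \<open>k\<close>, which the bound on the exponents already rules out.
  Admitting them matches the output of the greedy selection.\<close>

definition standard :: "nat \<Rightarrow> nat \<Rightarrow> (nat \<Rightarrow>\<^sub>0 nat) set" where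
  "standard n k = {a \<in> monomials n. (\<forall>i. Poly_Mapping.lookup a i < k) \<and>
     \<not> (\<exists>S. S \<subseteq> {1..n} \<and> card S = n - k + 1 \<and> (\<forall>s\<in>S. skip_comp S s \<le> Poly_Mapping.lookup a s))}"

lemma not_lead_exp_standard: "monomials n - lead_exps n k \<subseteq> standard n k" if "1 \<le> k"
proof
  fix a assume a: "a \<in> monomials n - lead_exps n k"
  have upward: False if p: "p \<in> I_ideal n k" "p \<noteq> 0"
    "\<And>i. Poly_Mapping.lookup (lead_exp p) i \<le> Poly_Mapping.lookup a i" for p
  proof -
    obtain c where "c \<in> monomials n" "a = c + lead_exp p"
      using monomial_diff[of a n "lead_exp p"] a p(3) by blast
    moreover have "lead_exp p \<in> lead_exps n k" using p by (auto simp: lead_exps_def)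
    ultimately show False using lead_exps_up a by blast
  qed
  have "Poly_Mapping.lookup a i < k" for i
  proof (rule ccontr)
    assume ge: "\<not> Poly_Mapping.lookup a i < k"
    then have "i \<in> Poly_Mapping.keys a" using \<open>1 \<le> k\<close> by (simp add: in_keys_iff)
    then have i: "i \<in> {1..n}" using a by (auto simp: monomials_def)
    show False
      by (rule upward[OF X_power_in_I_ideal[OF i] X_power_lead(1)])
        (use ge in \<open>auto simp: X_power_lead lookup_single when_def\<close>)
  qed
  moreover have False if S: "S \<subseteq> {1..n}" "card S = n - k + 1" "\<forall>s\<in>S. skip_comp S s \<le> Poly_Mapping.lookup a s" for S
  proof (rule upward[OF rev_demazure_in_I_ideal[OF S(1,2)] lead_K_poly(3)[OF S(1)]])
    fix i
    have "finite S" using S(1) finite_subset by blast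
    then show "Poly_Mapping.lookup (lead_exp (K_poly n S)) i \<le> Poly_Mapping.lookup a i"
      using S(3) skip_comp_notin[of i S] by (cases "i \<in> S") (auto simp: lead_K_poly(1)[OF S(1)] lookup_skip_exp)
  qed
  ultimately show "a \<in> standard n k" using a unfolding standard_def mem_Collect_eq by blast
qed

text \<open>By the greedy selection the exponent word of a standard monomial passes at least
  \<open>k\<close> positions, and such words are equinumerous with the points.\<close>

lemma card_standard_le:
  assumes "1 \<le> k" "k \<le> n"
  shows "finite (standard n k)" "card (standard n k) \<le> card (points k n)"
proof -
  let ?f = "\<lambda>a. map (Poly_Mapping.lookup a) [1..<Suc n]"
  have inj: "inj_on ?f (standard n k)"
  proof (rule inj_onI, rule poly_mapping_eqI)
    fix a b i assume ab: "a \<in> standard n k" "b \<in> standard n k" "?f a = ?f b"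
    show "Poly_Mapping.lookup a i = Poly_Mapping.lookup b i"
    proof (cases "i \<in> {1..n}")
      case True
      then have "i \<in> set [1..<Suc n]" by auto
      then show ?thesis using ab(3) unfolding map_eq_conv by blast
    next
      case False
      then have "i \<notin> Poly_Mapping.keys a" "i \<notin> Poly_Mapping.keys b"
        using ab(1,2) by (auto simp: standard_def monomials_def)
      then show ?thesis by (simp add: in_keys_iff)
    qed
  qed
  let ?W = "{xs \<in> words k n. k \<le> passed 0 xs}"
  have sub: "?f ` standard n k \<subseteq> ?W"
  proof
    fix xs assume "xs \<in> ?f ` standard n k"
    then obtain a where a: "a \<in> standard n k" "xs = ?f a" by blast
    have "xs \<in> words k n" using a by (auto simp: words_def standard_def)
    moreover have "k \<le> passed 0 xs"
    proof (rule ccontr)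
      assume "\<not> k \<le> passed 0 xs"
      then have "passed 0 (?f a) < k" unfolding a(2) by linarith
      from greedy_skip_comp[OF assms this] a(1) show False unfolding standard_def mem_Collect_eq by blast
    qed
    ultimately show "xs \<in> ?W" by blast
  qed
  have finW: "finite ?W" using finite_words by simp
  have "card ?W = card (points k n)"
    using card_passed_eq_card_image[of 0 k n] by (simp add: points_def)
  then show "card (standard n k) \<le> card (points k n)"
    using card_inj_on_le[OF inj sub finW] by simp
  show "finite (standard n k)" using finite_imageD[OF finite_subset[OF sub finW] inj] .
qed

text \<open>The standard monomials span the functions on the points, so there are at least as many of
  them as points; by the count above, no standard monomial can be a leading monomial.\<close>

lemma lead_exp_not_standard:
  assumes k: "1 \<le> k" "k \<le> n" and p: "p \<in> I_ideal n k" "p \<noteq> 0"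
  shows "lead_exp p \<notin> standard n k"
proof -
  let ?B = "monomials n - lead_exps n k"
  have sub: "?B \<subseteq> standard n k" by (rule not_lead_exp_standard[OF k(1)])
  have fin: "finite (standard n k)" by (rule card_standard_le(1)[OF k])
  have "card (points k n) \<le> card ?B"
  proof (rule card_points_le)
    show "finite ?B" by (rule finite_subset[OF sub fin])
    show "mfun k n ` monomials n \<subseteq> fv.span (mfun k n ` ?B)"
      using mfun_in_standard_span[OF k(2)] by blast
  qed blast
  then have "card (standard n k) \<le> card ?B" using card_standard_le(2)[OF k] by linarith
  then have "?B = standard n k" by (rule card_seteq[OF fin sub])
  moreover have "lead_exp p \<in> lead_exps n k" using p by (auto simp: lead_exps_def)
  ultimately show ?thesis by blast
qed

lemma lead_exp_divisible:
  assumes k: "1 \<le> k" "k \<le> n" and p: "p \<in> I_ideal n k" "p \<noteq> 0"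
  shows "(\<exists>i\<in>{1..n}. \<exists>c\<in>monomials n. lead_exp p = c + Poly_Mapping.single i k) \<or>
    (\<exists>S. S \<subseteq> {1..n - 1} \<and> card S = n - k + 1 \<and> (\<exists>c\<in>monomials n. lead_exp p = c + skip_exp S))"
proof -
  let ?a = "lead_exp p"
  have mon: "?a \<in> monomials n"
    using polys_keys[of p n ?a] I_ideal_polys p lead_exp_in_keys by blast
  have power: ?thesis if "k \<le> Poly_Mapping.lookup ?a i" for i
  proof -
    have "i \<in> Poly_Mapping.keys ?a" using that k by (simp add: in_keys_iff)
    then have "i \<in> {1..n}" using mon by (auto simp: monomials_def)
    moreover have "\<exists>c\<in>monomials n. ?a = c + Poly_Mapping.single i k"
      by (rule monomial_diff[OF mon]) (use that in \<open>auto simp: lookup_single when_def\<close>)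
    ultimately show ?thesis by blast
  qed
  have "?a \<notin> standard n k" by (rule lead_exp_not_standard[OF k p])
  then consider i where "k \<le> Poly_Mapping.lookup ?a i"
    | S where "S \<subseteq> {1..n}" "card S = n - k + 1" "\<forall>s\<in>S. skip_comp S s \<le> Poly_Mapping.lookup ?a s"
    using mon unfolding standard_def mem_Collect_eq by (meson not_less)
  then show ?thesis
  proof cases
    case 1
    then show ?thesis by (rule power)
  next
    case 2
    have fin: "finite S" using 2(1) finite_subset by blast
    show ?thesis
    proof (cases "n \<in> S")
      case True
      have "{s \<in> S. s \<le> n} = S" using 2(1) by auto
      \<comment> \<open>All \<open>n - k + 1\<close> elements are at most \<open>n\<close>, so the
        part is \<open>n - (n - k + 1) + 1\<close>. Divisibility by the \<open>k\<close>-th power of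
        the last variable replaces divisibility by this skip monomial.\<close>
      then have "skip_comp S n = k" using True 2(2) k by (simp add: skip_comp_def)
      then have "k \<le> Poly_Mapping.lookup ?a n" using 2(3) True by auto
      then show ?thesis by (rule power)
    next
      case False
      have "S \<subseteq> {1..n - 1}"
      proof
        fix s assume "s \<in> S"
        then have "s \<in> {1..n}" "s \<noteq> n" using 2(1) False by auto
        then show "s \<in> {1..n - 1}" by auto
      qed
      moreover have "\<exists>c\<in>monomials n. ?a = c + skip_exp S"
      proof (rule monomial_diff[OF mon])
        show "Poly_Mapping.lookup (skip_exp S) i \<le> Poly_Mapping.lookup ?a i" for i
          using 2(3) skip_comp_notin[of i S] by (cases "i \<in> S") (auto simp: lookup_skip_exp[OF fin])
      qed
      ultimately show ?thesis using 2(2) by blast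
    qed
  qed
qed

lemma lead_mon_polys: "p \<in> polys n \<Longrightarrow> p \<noteq> 0 \<Longrightarrow> lead_mon p \<in> polys n"
  unfolding lead_mon_def by (intro polys_single polys_keys[of p] lead_exp_in_keys)

lemma lead_mon_mult:
  assumes "lead_exp p = c + lead_exp g"
  shows "lead_mon p = Poly_Mapping.single c 1 * lead_mon g"
  by (simp add: lead_mon_def assms mult_single)

lemma groebner_basis_skip:
  assumes k: "1 \<le> k" "k \<le> n"
    and G: "G = {X i ^ k | i. i \<in> {1..n}} \<union> {K_poly n S | S. S \<subseteq> {1..n - 1} \<and> card S = n - k + 1}"
  shows "groebner_basis n (I_ideal n k) G"
proof -
  have up: "S \<subseteq> {1..n}" if "S \<subseteq> {1..n - 1}" for S
    using that by (rule order_trans) (simp add: atLeastatMost_subset_iff)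
  have "G \<subseteq> (\<lambda>i. X i ^ k) ` {1..n} \<union> K_poly n ` Pow {1..n - 1}" unfolding G by blast
  then have fin: "finite G" by (rule finite_subset) simp
  have sub: "G \<subseteq> I_ideal n k - {0}"
  proof
    fix g assume "g \<in> G"
    then consider i where "i \<in> {1..n}" "g = X i ^ k"
      | S where "S \<subseteq> {1..n - 1}" "card S = n - k + 1" "g = K_poly n S" unfolding G by blast
    then show "g \<in> I_ideal n k - {0}"
    proof cases
      case 1
      then show ?thesis using X_power_in_I_ideal[of i n k] X_power_lead(1)[of i k] by simp
    next
      case 2
      then show ?thesis using rev_demazure_in_I_ideal[OF up[OF 2(1)] 2(2)] lead_K_poly(3)[OF up[OF 2(1)]] by simp
    qed
  qed
  have polysI: "lead_mon ` (I_ideal n k - {0}) \<subseteq> polys n"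
    using lead_mon_polys I_ideal_polys by blast
  then have polysG: "lead_mon ` G \<subseteq> polys n" using sub by blast
  have "initial_ideal n (I_ideal n k) = genideal (poly_ring n) (lead_mon ` G)"
    unfolding initial_ideal_def
  proof (rule antisym)
    show "genideal (poly_ring n) (lead_mon ` (I_ideal n k - {0})) \<subseteq> genideal (poly_ring n) (lead_mon ` G)"
    proof (rule genideal_subsetI)
      show "genideal (poly_ring n) (lead_mon ` G) \<subseteq> polys n"
        by (rule genideal_subsetI[OF polysG]) (auto intro: polys_add polys_mult)
      show "lead_mon ` (I_ideal n k - {0}) \<subseteq> genideal (poly_ring n) (lead_mon ` G)"
      proof
        fix q assume "q \<in> lead_mon ` (I_ideal n k - {0})"
        then obtain p where p: "p \<in> I_ideal n k" "p \<noteq> 0" "q = lead_mon p" by blast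
        have "\<exists>g\<in>G. \<exists>c\<in>monomials n. lead_exp p = c + lead_exp g"
          using lead_exp_divisible[OF k p(1,2)]
        proof (elim disjE bexE exE conjE)
          fix i c assume "i \<in> {1..n}" "c \<in> monomials n" "lead_exp p = c + Poly_Mapping.single i k"
          then show ?thesis unfolding G
            by (intro bexI[of _ "X i ^ k"] bexI[of _ c]) (auto simp: X_power_lead(2))
        next
          fix S c assume "S \<subseteq> {1..n - 1}" "card S = n - k + 1" "c \<in> monomials n" "lead_exp p = c + skip_exp S"
          then show ?thesis unfolding G
            by (intro bexI[of _ "K_poly n S"] bexI[of _ c]) (auto simp: lead_K_poly(1)[OF up])
        qed
        then obtain g c where g: "g \<in> G" "c \<in> monomials n" "lead_exp p = c + lead_exp g" by blast
        have "lead_mon g \<in> genideal (poly_ring n) (lead_mon ` G)"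
          using genideal_superset[OF polysG] g(1) by blast
        then show "q \<in> genideal (poly_ring n) (lead_mon ` G)"
          unfolding p(3) lead_mon_mult[OF g(3)]
          by (rule genideal_zero_add_mult(3)[OF polysG]) (rule polys_single[OF g(2)])
      qed
    qed (rule genideal_zero_add_mult[OF polysG]; assumption)+
    show "genideal (poly_ring n) (lead_mon ` G) \<subseteq> genideal (poly_ring n) (lead_mon ` (I_ideal n k - {0}))"
    proof (rule genideal_subsetI)
      show "genideal (poly_ring n) (lead_mon ` (I_ideal n k - {0})) \<subseteq> polys n"
        by (rule genideal_subsetI[OF polysI]) (auto intro: polys_add polys_mult)
      show "lead_mon ` G \<subseteq> genideal (poly_ring n) (lead_mon ` (I_ideal n k - {0}))"
        using genideal_superset[OF polysI] sub by blast
    qed (rule genideal_zero_add_mult[OF polysI]; assumption)+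
  qed
  then show ?thesis using fin sub by (simp add: groebner_basis_def)
qed

lemma reduced_skip:
  assumes k: "1 \<le> k" "k < n"
    and G: "G = {X i ^ k | i. i \<in> {1..n}} \<union> {K_poly n S | S. S \<subseteq> {1..n - 1} \<and> card S = n - k + 1}"
    and g: "g \<in> G"
  shows "lead_coef g = 1" "\<And>h m. h \<in> G \<Longrightarrow> h \<noteq> g \<Longrightarrow> m \<in> Poly_Mapping.keys g \<Longrightarrow> \<not> mon_dvd (lead_exp h) m"
proof -
  have up: "S \<subseteq> {1..n}" if "S \<subseteq> {1..n - 1}" for S
    using that by (rule order_trans) (simp add: atLeastatMost_subset_iff)
  have cases: "(\<exists>i. h = X i ^ k) \<or> (\<exists>S. S \<subseteq> {1..n - 1} \<and> card S = n - k + 1 \<and> h = K_poly n S)"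
    if "h \<in> G" for h using that unfolding G by blast
  have dvd: "Poly_Mapping.lookup a i \<le> Poly_Mapping.lookup m i" if "mon_dvd a m" for a m i
    using that by (auto simp: mon_dvd_def lookup_add)
  show "lead_coef g = 1"
    using cases[OF g] by (auto simp: X_power_lead(3) lead_K_poly(2)[OF up])
  fix h m assume h: "h \<in> G" "h \<noteq> g" and m: "m \<in> Poly_Mapping.keys g"
  show "\<not> mon_dvd (lead_exp h) m"
  proof
    assume d: "mon_dvd (lead_exp h) m"
    from cases[OF h(1)] show False
    proof (elim disjE exE conjE)
      fix j assume j: "h = X j ^ k"
      then have "k \<le> Poly_Mapping.lookup m j"
        using dvd[OF d, of j] by (simp add: X_power_lead(2))
      from cases[OF g] show False
      proof (elim disjE exE conjE)
        fix i assume i: "g = X i ^ k"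
        then have "m = Poly_Mapping.single i k" using m by (simp add: X_power)
        then have "i = j" using \<open>k \<le> Poly_Mapping.lookup m j\<close> k by (auto simp: lookup_single when_def split: if_splits)
        then show False using h(2) i j by simp
      next
        fix S assume S: "S \<subseteq> {1..n - 1}" "card S = n - k + 1" "g = K_poly n S"
        have "Poly_Mapping.lookup m j < k"
          using K_poly_exponent_less[OF S(1,2) k(1) less_imp_le[OF k(2)]] m S(3) by simp
        then show False using \<open>k \<le> Poly_Mapping.lookup m j\<close> by simp
      qed
    next
      fix T assume T: "T \<subseteq> {1..n - 1}" "card T = n - k + 1" "h = K_poly n T"
      have lead: "lead_exp h = skip_exp T" using lead_K_poly(1)[OF up[OF T(1)]] T(3) by simp
      have finT: "finite T" using T(1) finite_subset by blast
      from cases[OF g] show False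
      proof (elim disjE exE conjE)
        fix i assume i: "g = X i ^ k"
        then have m': "m = Poly_Mapping.single i k" using m by (simp add: X_power)
        have "t = i" if t: "t \<in> T" for t
        proof -
          have "1 \<le> Poly_Mapping.lookup m t"
            using dvd[OF d, of t] skip_comp_pos[OF t] by (simp add: lead lookup_skip_exp[OF finT])
          then show ?thesis by (auto simp: m' lookup_single when_def split: if_splits)
        qed
        \<comment> \<open>Here \<open>k < n\<close> enters: \<open>T\<close> has at least two
          elements, so its skip monomial involves two variables. For \<open>k = n\<close> it would
          be a power of a single variable and divide the corresponding \<open>k\<close>-th
          power.\<close>
        then have "T \<subseteq> {i}" by blast
        then have "card T \<le> card {i}" by (rule card_mono[rotated]) simp
        then show False using T(2) k(2) by simp
      next
        fix S assume S: "S \<subseteq> {1..n - 1}" "card S = n - k + 1" "g = K_poly n S"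
        have "T \<noteq> S" using h(2) S(3) T(3) by blast
        then show False
          using K_poly_not_dvd[OF up[OF S(1)] up[OF T(1)] _ _ m[unfolded S(3)]] S(2) T(2) d lead by simp
      qed
    qed
  qed
qed

theorem theorem4p14:
  fixes n k :: nat and G :: "rpoly set"
  assumes "1 \<le> k" and "k \<le> n"
    and "G = {X i ^ k | i. i \<in> {1..n}} \<union>
             {rev_demazure n (rev_comp n (skip_comp S)) | S.
                S \<subseteq> {1..n - 1} \<and> card S = n - k + 1}"
  shows "groebner_basis n (I_ideal n k) G \<and>
         (k < n \<longrightarrow> reduced_groebner_basis n (I_ideal n k) G)"
proof -
  have "groebner_basis n (I_ideal n k) G"
    by (rule groebner_basis_skip[OF assms])
  moreover have "reduced_groebner_basis n (I_ideal n k) G" if "k < n"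
    unfolding reduced_groebner_basis_def
    using calculation reduced_skip[OF assms(1) that assms(3)] by blast
  ultimately show ?thesis by blast
qed

end
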